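(* There exist absolute constants $C_1,C_2>0$ such that the following holds. Let $\delta_0,\delta_1>0$ be given. There exist a constant $C(\delta_1)$ depending only on $\delta_1$ and a number $\Lambda(\delta_0,\delta_1)<0$ depending only on $\delta_0$ and $\delta_1$ such that, if $x\in\mathbb{R}^n\setminus\{0\}$, $X=xx^\top$, $a_1,\dots,a_m\in\mathbb{R}^n$ are random vectors with i.i.d. standard Gaussian entries, $A_j=a_ja_j^\top$, $$f(Z)=\frac{1}{2m}\sum_{j=1}^m|\langle A_j,Z-X\rangle|^2\qquad\text{on } \mathcal{M}_1,$$ and $m\ge C(\delta_1)\,n\log n$, then with probability at least $1-\frac{C_1}{m}-e^{-C_2n}$, for all $Z\in\mathcal{M}_1$ satisfying $$\langle Z,X\rangle\le\delta_0\|Z\|_F\|X\|_F,\qquad \tfrac13-\delta_0\le\frac{\|Z\|_F}{\|X\|_F}\le\tfrac13+\delta_0,\qquad P_{T_Z}(\nabla f(Z))=0,$$ one has $$\lambda_{\min}(\mathrm{Hess} f(Z))\le\Lambda(\delta_0,\delta_1)<0 .$$ If moreover $\delta_0<\frac16$ and $\delta_1<\frac5{36}$, then $\lambda_{\min}(\mathrm{Hess} f(Z))<-1$ for all such $Z$ (on the same event).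
   Context: $\mathcal{M}_1$ is the manifold of real symmetric $n\times n$ matrices of rank $1$, with the Riemannian metric inherited from the Frobenius inner product $\langle A,B\rangle=\mathrm{trace}(A^\top B)$, $\|A\|_F^2=\langle A,A\rangle$. For $Z\in\mathcal{M}_1$ with column space spanned by a unit vector $u$, the tangent space is $T_Z=\{w\,uu^\top+uv^\top+vu^\top: w\in\mathbb{R},\ v\in\mathbb{R}^n,\ v\perp u\}$ and $P_{T_Z}$ is the orthogonal projection onto it. $\nabla f$ is the gradient in the ambient matrix space, so that the Riemannian gradient is $P_{T_Z}(\nabla f(Z))=\frac1m\sum_{j=1}^m\langle A_j,Z-X\rangle P_{T_Z}(A_j)$. $\mathrm{Hess} f(Z):T_Z\to T_Z$ is the Riemannian Hessian (covariant derivative of the Riemannian gradient for the Levi-Civita connection); for $Z=zz^\top$, $u=z/\|z\|_2$ and $\xi=w\,uu^\top+uv^\top+vu^\top\in T_Z$ it is given by $$\langle\mathrm{Hess} f(Z)[\xi],\xi\rangle=\frac1m\sum_{j=1}^m\left(2\langle A_j,Z-X\rangle\langle A_j,\eta\rangle+\langle A_j,\xi\rangle^2\right),\qquad \eta=\frac{vv^\top}{\|Z\|_F}.$$ $\lambda_{\min}$ denotes the smallest eigenvalue with respect to the Frobenius inner product on $T_Z$.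
   Formalization: The formal statement requires 0 < δ₀ < 1 instead of δ₀ > 0 (and m ≥ 1, so that f is defined): for δ₀ ≥ 1 the point Z = X meets all conditions while Hess f(X) is positive semidefinite, so the claim fails. *)

theory Defs
  imports
    "HOL-Probability.Probability"
    "Jordan_Normal_Form.Matrix"
    "Jordan_Normal_Form.DL_Rank"
begin

text \<open>
  The constants of the theorem must not depend on the dimension \<open>n\<close>, so \<open>n\<close> has to be quantified
  inside the statement. Vectors and matrices are therefore the carrier-based ones of
  Jordan\_Normal\_Form (\<open>carrier_vec n\<close>, \<open>carrier_mat n n\<close>), not the type-indexed ones of HOL-Analysis.
\<close>

definition mat_trace :: "real mat \<Rightarrow> real" where
  "mat_trace A = (\<Sum>i<dim_row A. A $$ (i, i))"

definition frob_inner :: "real mat \<Rightarrow> real mat \<Rightarrow> real" where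
  "frob_inner A B = mat_trace (transpose_mat A * B)"

definition frob_norm :: "real mat \<Rightarrow> real" where
  "frob_norm A = sqrt (frob_inner A A)"

definition outer :: "real Matrix.vec \<Rightarrow> real Matrix.vec \<Rightarrow> real mat" where
  "outer u v = Matrix.mat (dim_vec u) (dim_vec v) (\<lambda>(i, j). vec_index u i * vec_index v j)"

definition rank_one_manifold :: "nat \<Rightarrow> real mat set" where
  "rank_one_manifold n =
     {Z \<in> carrier_mat n n. transpose_mat Z = Z \<and> vec_space.rank n Z = 1}"

text \<open>The unit vector \<open>u\<close> is determined by \<open>Z\<close> up to sign, and the sign does not affect the set.\<close>

definition tangent_space :: "nat \<Rightarrow> real mat \<Rightarrow> real mat set" where
  "tangent_space n Z =
     {w \<cdot>\<^sub>m outer u u + outer u v + outer v u | w u v.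
        u \<in> carrier_vec n \<and> scalar_prod u u = 1 \<and>
        vec_space.col_space n Z = range (\<lambda>c. c \<cdot>\<^sub>v u) \<and>
        v \<in> carrier_vec n \<and> scalar_prod v u = 0}"

definition orth_proj :: "real mat set \<Rightarrow> real mat \<Rightarrow> real mat" where
  "orth_proj S A = (THE B. B \<in> S \<and> (\<forall>\<xi>\<in>S. frob_inner (A - B) \<xi> = 0))"

definition ambient_grad :: "nat \<Rightarrow> (real mat \<Rightarrow> real) \<Rightarrow> real mat \<Rightarrow> real mat" where
  "ambient_grad n f Z = (THE G. G \<in> carrier_mat n n \<and>
     (\<forall>H\<in>carrier_mat n n.
        ((\<lambda>t. f (Z + t \<cdot>\<^sub>m H)) has_real_derivative frob_inner G H) (at 0)))"

definition riem_grad :: "nat \<Rightarrow> (real mat \<Rightarrow> real) \<Rightarrow> real mat \<Rightarrow> real mat" where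
  "riem_grad n f Z = orth_proj (tangent_space n Z) (ambient_grad n f Z)"

definition has_mat_derivative_at0 :: "nat \<Rightarrow> (real \<Rightarrow> real mat) \<Rightarrow> real mat \<Rightarrow> bool" where
  "has_mat_derivative_at0 n \<gamma> D \<longleftrightarrow> D \<in> carrier_mat n n \<and>
     (\<forall>i<n. \<forall>j<n. ((\<lambda>t. \<gamma> t $$ (i, j)) has_real_derivative D $$ (i, j)) (at 0))"

text \<open>
  The Levi-Civita connection of a submanifold of a Euclidean space is the tangential part of the
  ambient derivative: if \<open>\<gamma>\<close> is a curve in the manifold through \<open>Z\<close> with velocity \<open>\<xi>\<close>, the covariant
  derivative of a tangential vector field \<open>V\<close> along \<open>\<xi>\<close> is the projection of the derivative of
  \<open>V \<circ> \<gamma>\<close> onto the tangent space at \<open>Z\<close>. It does not depend on the choice of \<open>\<gamma>\<close>.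
\<close>

definition cov_deriv ::
  "nat \<Rightarrow> (real mat \<Rightarrow> real mat) \<Rightarrow> real mat \<Rightarrow> real mat \<Rightarrow> real mat" where
  "cov_deriv n V Z \<xi> = (THE D. \<exists>\<gamma> W.
     (\<forall>\<^sub>F t in nhds 0. \<gamma> t \<in> rank_one_manifold n) \<and> \<gamma> 0 = Z \<and>
     has_mat_derivative_at0 n \<gamma> \<xi> \<and>
     has_mat_derivative_at0 n (\<lambda>t. V (\<gamma> t)) W \<and>
     D = orth_proj (tangent_space n Z) W)"

definition riem_hess :: "nat \<Rightarrow> (real mat \<Rightarrow> real) \<Rightarrow> real mat \<Rightarrow> real mat \<Rightarrow> real mat" where
  "riem_hess n f Z \<xi> = cov_deriv n (riem_grad n f) Z \<xi>"

definition lambda_min_hess :: "nat \<Rightarrow> (real mat \<Rightarrow> real) \<Rightarrow> real mat \<Rightarrow> real" where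
  "lambda_min_hess n f Z = (LEAST \<mu>.
     \<exists>\<xi>\<in>tangent_space n Z. \<xi> \<noteq> 0\<^sub>m n n \<and> riem_hess n f Z \<xi> = \<mu> \<cdot>\<^sub>m \<xi>)"

definition loss :: "nat \<Rightarrow> (nat \<Rightarrow> real Matrix.vec) \<Rightarrow> real mat \<Rightarrow> real mat \<Rightarrow> real" where
  "loss m a X Z =
     1 / (2 * real m) * (\<Sum>j<m. \<bar>frob_inner (outer (a j) (a j)) (Z - X)\<bar>\<^sup>2)"

text \<open>
  The joint law of the entries of \<open>a\<^sub>0, \<dots>, a\<^sub>m\<^sub>-\<^sub>1\<close>: coordinate \<open>(j, i)\<close> of an outcome is the
  \<open>i\<close>-th entry of \<open>a\<^sub>j\<close>.
\<close>

definition gauss_space :: "nat \<Rightarrow> nat \<Rightarrow> (nat \<times> nat \<Rightarrow> real) measure" where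
  "gauss_space m n = PiM ({..<m} \<times> {..<n}) (\<lambda>_. std_normal_distribution)"

definition gauss_vec :: "nat \<Rightarrow> (nat \<times> nat \<Rightarrow> real) \<Rightarrow> nat \<Rightarrow> real Matrix.vec" where
  "gauss_vec n \<omega> j = Matrix.vec n (\<lambda>i. \<omega> (j, i))"

end

theory Submission
  imports Defs
begin

text \<open>
  Writing \<open>Z = s u u\<^sup>T\<close>, \<open>X = \<rho> x x\<^sup>T\<close> with unit vectors \<open>u\<close>, \<open>x\<close>, \<open>r = s / \<rho>\<close> and
  \<open>S\<^sub>i\<close> for the empirical mean of \<open>\<langle>a, u\<rangle>\<^sup>i \<langle>a, x\<rangle>\<^sup>4\<^sup>-\<^sup>i\<close>, criticality of \<open>Z\<close> gives \<open>r S\<^sub>4 = S\<^sub>2\<close> and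
  \<open>r S\<^sub>3 = S\<^sub>1\<close>. With \<open>m \<ge> C n ln n\<close> samples the quartic means \<open>S\<^sub>3\<close>, \<open>S\<^sub>4\<close> do not concentrate from above
  uniformly in \<open>u\<close>, but \<open>S\<^sub>0\<close>, \<open>S\<^sub>1\<close>, \<open>S\<^sub>2\<close> (a quadratic form in \<open>u\<close>) do, and \<open>S\<^sub>4\<close> is bounded below by
  truncation. By Cauchy-Schwarz, \<open>S\<^sub>3\<^sup>2 \<le> S\<^sub>4 S\<^sub>2\<close>, so \<open>S\<^sub>1\<^sup>2 S\<^sub>4 \<le> S\<^sub>2\<^sup>3\<close>; inserting the expectations, \<open>t = \<langle>u, x\<rangle>\<^sup>2\<close>
  satisfies \<open>27 t \<le> (1 + 2 t)\<^sup>3\<close> up to a small error, so \<open>t\<close> is either at most \<open>1/18\<close> or close to \<open>1\<close>. In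
  the first case the Hessian in the direction \<open>z x\<^sup>T + x z\<^sup>T\<close> has Rayleigh quotient at most \<open>-2\<close>; in the
  second \<open>Z\<close> is close to \<open>X\<close>, where truncated second moments show that \<open>X\<close> is the only critical
  point, and \<open>X\<close> is excluded by \<open>\<delta>\<^sub>0 < 1\<close>. Hence \<open>\<Lambda> = -2\<close> and \<open>C\<close> can be chosen universally.
\<close>

text \<open>Upper tails of quartic Gaussian means are too heavy for a union bound over a net of
  e^O(n) points with m of order n log n, which decides which moment may be bounded from which side.
  \<open>S\<^sub>2\<close> is quadratic in u with random weights
  \<open>\<langle>a, x\<rangle>\<^sup>2\<close>. The weights do not involve u, so outside an event
  of probability at most 2/m all of them are below 6 ln m; the resulting tail rate m / ln m beats
  the net as soon as A n ln m \<le> m. Hence the logarithm and the term \<open>C\<^sub>1\<close> /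
  m. \<open>S\<^sub>1\<close> is obtained from \<open>S\<^sub>2\<close> by polarisation, and lower
  bounds come from bounded truncations, which are Lipschitz in u.

  The expectations of \<open>S\<^sub>1\<close>, \<open>S\<^sub>2\<close>, \<open>S\<^sub>4\<close>
  are 3c, 1 + 2c^2, 3 with c = \<open>\<langle>u, x\<rangle>\<close>. The cubic inequality is an
  equality at t = 1, so smaller errors never exclude the region near X, and a local argument is used
  there.

  The other difficulty is formal: gradients, covariant derivatives and eigenvalues are given by
  descriptions. Writing every tangent vector as \<open>sym_outer u y\<close> with one free vector y
  turns them into identities between bilinear forms in y.\<close>

notation scalar_prod (infixl "\<diamondop>" 70)

section \<open>Frobenius inner product and bilinear forms\<close>

lemma scalar_prod_sum: "dim_vec w = n \<Longrightarrow> v \<diamondop> w = (\<Sum>i<n. vec_index v i * vec_index w i)"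
  by (simp add: scalar_prod_def atLeast0LessThan)

lemma frob_inner_sum:
  assumes "A \<in> carrier_mat n n" "B \<in> carrier_mat n n"
  shows "frob_inner A B = (\<Sum>i<n. \<Sum>k<n. A $$ (i,k) * B $$ (i,k))"
proof -
  have "frob_inner A B = (\<Sum>i<n. \<Sum>k<n. A $$ (k,i) * B $$ (k,i))"
    using assms by (auto simp: frob_inner_def mat_trace_def scalar_prod_def atLeast0LessThan intro!: sum.cong)
  also have "\<dots> = (\<Sum>i<n. \<Sum>k<n. A $$ (i,k) * B $$ (i,k))" by (rule sum.swap)
  finally show ?thesis .
qed

lemma outer_carrier[simp]: "u \<in> carrier_vec n \<Longrightarrow> v \<in> carrier_vec k \<Longrightarrow> outer u v \<in> carrier_mat n k"
  by (auto simp: outer_def)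

lemma outer_index[simp]: "i < dim_vec u \<Longrightarrow> k < dim_vec v \<Longrightarrow> outer u v $$ (i,k) = vec_index u i * vec_index v k"
  by (auto simp: outer_def)

text \<open>The number v^T A w. Defined by entries, its linearity in each argument and its
  derivative along a curve are plain facts about finite sums; matrix identities are later tested
  through it.\<close>

definition bil :: "nat \<Rightarrow> real mat \<Rightarrow> real Matrix.vec \<Rightarrow> real Matrix.vec \<Rightarrow> real" where
  "bil n A v w = (\<Sum>i<n. \<Sum>k<n. A $$ (i,k) * (vec_index v i * vec_index w k))"

lemma frob_inner_outer:
  assumes "A \<in> carrier_mat n n" "v \<in> carrier_vec n" "w \<in> carrier_vec n"
  shows "frob_inner A (outer v w) = bil n A v w" 
  using assms by (simp add: frob_inner_sum[OF assms(1) outer_carrier] bil_def)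

lemma frob_inner_commute:
  assumes "A \<in> carrier_mat n n" "B \<in> carrier_mat n n"
  shows "frob_inner A B = frob_inner B A"
  by (simp add: frob_inner_sum[OF assms] frob_inner_sum[OF assms(2,1)] mult.commute)

lemma frob_inner_add_right:
  assumes "A \<in> carrier_mat n n" "B \<in> carrier_mat n n" "C \<in> carrier_mat n n"
  shows "frob_inner A (B + C) = frob_inner A B + frob_inner A C"
  using assms by (simp add: frob_inner_sum[where n=n] algebra_simps sum.distrib)

lemma frob_inner_smult_right:
  assumes "A \<in> carrier_mat n n" "B \<in> carrier_mat n n"
  shows "frob_inner A (c \<cdot>\<^sub>m B) = c * frob_inner A B"
  using assms by (simp add: frob_inner_sum[where n=n] sum_distrib_left algebra_simps)

lemma frob_inner_diff_left:
  assumes "A \<in> carrier_mat n n" "B \<in> carrier_mat n n" "C \<in> carrier_mat n n"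
  shows "frob_inner (A - B) C = frob_inner A C - frob_inner B C"
  using assms by (simp add: frob_inner_sum[where n=n] algebra_simps sum_subtractf minus_carrier_mat)

lemma frob_inner_self_eq_0:
  assumes "A \<in> carrier_mat n n" "frob_inner A A = 0"
  shows "A = 0\<^sub>m n n"
proof (rule eq_matI)
  fix i k assume ik: "i < dim_row (0\<^sub>m n n :: real mat)" "k < dim_col (0\<^sub>m n n :: real mat)"
  have "\<forall>i\<in>{..<n}. (\<Sum>k<n. A $$ (i,k) * A $$ (i,k)) = 0"
    using assms by (subst (asm) frob_inner_sum[where n=n]) (auto simp: sum_nonneg_eq_0_iff sum_nonneg)
  then have "\<forall>i\<in>{..<n}. \<forall>k\<in>{..<n}. A $$ (i,k) * A $$ (i,k) = 0"
    by (simp add: sum_nonneg_eq_0_iff)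
  then show "A $$ (i,k) = (0\<^sub>m n n) $$ (i,k)" using ik by simp
qed (use assms in auto)

lemma dim_outer[simp]: "dim_row (outer u v) = dim_vec u" "dim_col (outer u v) = dim_vec v"
  by (auto simp: outer_def)

lemma mult_mat_vec_index:
  assumes "A \<in> carrier_mat n k" "v \<in> carrier_vec k" "i < n"
  shows "vec_index (A *\<^sub>v v) i = (\<Sum>l<k. A $$ (i,l) * vec_index v l)"
  using assms by (simp add: mult_mat_vec_def scalar_prod_def atLeast0LessThan)

lemma outer_inner:
  assumes "u \<in> carrier_vec n" "v \<in> carrier_vec n" "y \<in> carrier_vec n" "z \<in> carrier_vec n"
  shows "frob_inner (outer u v) (outer y z) = (u \<diamondop> y) * (v \<diamondop> z)"
  using assms by (simp add: frob_inner_sum[where n=n] scalar_prod_sum[where n=n] sum_product algebra_simps)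

section \<open>Rank-one symmetric matrices\<close>

text \<open>Connects \<open>tangent_space\<close>, which speaks of column spaces, with the
  factorised form s u u^T: the matrix sends v to (s <u,v>) u, and this reaches the whole line of u
  because s \<noteq> 0.\<close>

lemma col_space_rank_one:
  assumes u: "u \<in> carrier_vec n" "u \<diamondop> u = 1" and s: "s \<noteq> 0"
  shows "vec_space.col_space n (s \<cdot>\<^sub>m outer u u) = range (\<lambda>c. c \<cdot>\<^sub>v u)"
proof -
  interpret vec_space "TYPE(real)" n .
  have car: "s \<cdot>\<^sub>m outer u u \<in> carrier_mat n n" using u by simp
  have mv: "(s \<cdot>\<^sub>m outer u u) *\<^sub>v v = (s * (u \<diamondop> v)) \<cdot>\<^sub>v u" if "v \<in> carrier_vec n" for v
    using u that mult_mat_vec_index[OF car that] by (intro eq_vecI)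
      (auto simp: scalar_prod_sum[where n=n] sum_distrib_left sum_distrib_right mult_ac simp del: index_mult_mat_vec intro!: sum.cong)
  show ?thesis
  proof (intro subset_antisym subsetI)
    fix w assume "w \<in> col_space (s \<cdot>\<^sub>m outer u u)"
    then show "w \<in> range (\<lambda>c. c \<cdot>\<^sub>v u)" using u mv by (auto simp: col_space_eq[OF car])
  next
    fix w assume "w \<in> range (\<lambda>c. c \<cdot>\<^sub>v u)"
    then obtain c where c: "w = c \<cdot>\<^sub>v u" by auto
    have "(s \<cdot>\<^sub>m outer u u) *\<^sub>v ((c / s) \<cdot>\<^sub>v u) = w"
      using u s c by (subst mv) auto
    moreover have "(c / s) \<cdot>\<^sub>v u \<in> carrier_vec (dim_col (s \<cdot>\<^sub>m outer u u))" using u by simp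
    moreover have "w \<in> carrier_vec (dim_row (s \<cdot>\<^sub>m outer u u))" using u c by simp
    ultimately show "w \<in> col_space (s \<cdot>\<^sub>m outer u u)" unfolding col_space_eq[OF car] by blast
  qed
qed

lemma scalar_prod_self_pos:
  fixes w :: "real Matrix.vec"
  assumes "w \<in> carrier_vec n" "w \<noteq> 0\<^sub>v n"
  shows "w \<diamondop> w > 0"
proof -
  obtain i where "i < n" "vec_index w i \<noteq> 0" using assms by (metis eq_vecI carrier_vecD index_zero_vec)
  then have "0 < (\<Sum>i<n. vec_index w i * vec_index w i)"
    by (intro sum_pos2[where i=i]) (auto simp: not_sum_squares_lt_zero mult_neg_neg zero_less_mult_iff linorder_neq_iff)
  then show ?thesis using assms by (simp add: scalar_prod_sum[where n=n])
qed

text \<open>Puts the explicit curve of the Hessian computation on the manifold. Entries of product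
  form give rank at most 1, and a single nonzero column is an independent set.\<close>

lemma symmetric_rank_one_outer:
  assumes w: "w \<in> carrier_vec n" "w \<noteq> 0\<^sub>v n" and s: "s \<noteq> 0"
  shows "s \<cdot>\<^sub>m outer w w \<in> rank_one_manifold n"
proof -
  interpret vec_space "TYPE(real)" n .
  let ?Z = "s \<cdot>\<^sub>m outer w w"
  have car: "?Z \<in> carrier_mat n n" using w by simp
  have le: "rank ?Z \<le> 1"
    using w by (intro rank_le_1_product_entries[OF car, where f="\<lambda>i. s * vec_index w i" and g="vec_index w"]) auto
  obtain k where k: "k < n" "vec_index w k \<noteq> 0" using w by (metis eq_vecI carrier_vecD index_zero_vec)
  let ?v = "col ?Z k"
  have vk: "?v \<in> carrier_vec n" using car k(1) by (metis col_dim carrier_matD(1))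
  have vnz: "vec_index ?v k \<noteq> 0" using w k s by simp
  have "lin_indpt {?v}"
  proof
    assume "lin_dep {?v}"
    then obtain a v where a: "lincomb a {?v} = 0\<^sub>v n" "v \<in> {?v}" "a v \<noteq> 0"
      using finite_lin_dep[of "{?v}"] vk by auto
    then have "vec_index (lincomb a {?v}) k = 0" using k by simp
    then have "a ?v * vec_index ?v k = 0" using lincomb_index[of k "{?v}" a] k vk by simp
    then show False using a vnz by auto
  qed
  then have "rank ?Z \<ge> card {?v}"
    using car k by (intro rank_ge_card_indpt) (auto simp: cols_def)
  moreover have "transpose_mat ?Z = ?Z" using w by (intro eq_matI) auto
  ultimately show ?thesis using le car by (auto simp: rank_one_manifold_def)
qed

text \<open>Rank 1 makes every column a multiple of one fixed nonzero column w, and symmetry makes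
  the multipliers proportional to w itself. Normalising w moves its squared length into s, whose
  sign stays free.\<close>

lemma rank_one_manifoldE:
  assumes "Z \<in> rank_one_manifold n"
  obtains s u where "s \<noteq> 0" "u \<in> carrier_vec n" "u \<diamondop> u = 1" "Z = s \<cdot>\<^sub>m outer u u"
proof -
  interpret vec_space "TYPE(real)" n .
  have Z: "Z \<in> carrier_mat n n" "transpose_mat Z = Z" "rank Z = 1"
    using assms by (auto simp: rank_one_manifold_def)
  have sym: "Z $$ (i,k) = Z $$ (k,i)" if "i < n" "k < n" for i k
    using Z that by (metis carrier_matD index_transpose_mat(1))
  have "Z \<noteq> 0\<^sub>m n n" using Z(3) rank_0I[of n] by auto
  then obtain i0 q where iq: "i0 < n" "q < n" "Z $$ (i0,q) \<noteq> 0"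
    using Z(1) by (metis eq_matI carrier_matD index_zero_mat)
  define w where "w = col Z q"
  have w: "w \<in> carrier_vec n" using Z iq by (simp add: w_def carrier_vecI)
  have wi: "vec_index w i = Z $$ (i,q)" if "i < n" for i using that Z iq by (simp add: w_def)
  have "\<exists>c. \<forall>i<n. Z $$ (i,k) = c * vec_index w i" if k: "k < n" for k
  proof (cases "col Z k = w")
    case True
    then have "\<forall>i<n. Z $$ (i,k) = vec_index w i" using Z k by (metis index_col carrier_matD)
    then show ?thesis by (intro exI[of _ 1]) auto
  next
    case False
    let ?v = "col Z k"
    have v: "?v \<in> carrier_vec n" using Z k by (simp add: carrier_vecI)
    have sub: "{w, ?v} \<subseteq> set (cols Z)" using Z iq k by (auto simp: w_def cols_def)
    have "lin_dep {w, ?v}"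
    proof (rule ccontr)
      assume "\<not> lin_dep {w, ?v}"
      from rank_ge_card_indpt[OF Z(1) sub this] show False using Z(3) False by auto
    qed
    then obtain a x where a: "lincomb a {w,?v} = 0\<^sub>v n" "x \<in> {w,?v}" "a x \<noteq> 0"
      using finite_lin_dep[of "{w,?v}"] v w by auto
    have eq: "a w * vec_index w i + a ?v * Z $$ (i,k) = 0" if i: "i < n" for i
    proof -
      have "vec_index (lincomb a {w,?v}) i = 0" using a i by simp
      then show ?thesis using lincomb_index[of i "{w,?v}" a] i v w False Z k by simp
    qed
    have "a ?v \<noteq> 0"
    proof
      assume 0: "a ?v = 0"
      then have "a w \<noteq> 0" using a by auto
      then show False using eq[OF iq(1)] 0 wi iq by auto
    qed
    then have "\<forall>i<n. Z $$ (i,k) = (- a w / a ?v) * vec_index w i"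
      using eq by (auto simp: field_simps add_eq_0_iff)
    then show ?thesis by blast
  qed
  then obtain c where c: "\<And>i k. i < n \<Longrightarrow> k < n \<Longrightarrow> Z $$ (i,k) = c k * vec_index w i" by metis
  define \<sigma> where "\<sigma> = c i0 / vec_index w i0"
  have w0: "vec_index w i0 \<noteq> 0" using iq wi by auto
  have ck: "c k = \<sigma> * vec_index w k" if "k < n" for k
    using sym[OF iq(1) that] c[OF iq(1) that] c[OF that iq(1)] w0 by (simp add: \<sigma>_def field_simps)
  have Zs: "Z $$ (i,k) = \<sigma> * (vec_index w i * vec_index w k)" if "i < n" "k < n" for i k
    using c[OF that] ck[OF that(2)] by simp
  have "w \<noteq> 0\<^sub>v n" using w0 iq by auto
  then have pos: "w \<diamondop> w > 0" using w by (rule scalar_prod_self_pos[rotated])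
  define N where "N = sqrt (w \<diamondop> w)"
  have N: "N > 0" "N * N = w \<diamondop> w" using pos by (auto simp: N_def)
  show thesis
  proof (rule that)
    show "\<sigma> * (w \<diamondop> w) \<noteq> 0" using Zs[OF iq(1,2)] iq pos by auto
    show "(1 / N) \<cdot>\<^sub>v w \<in> carrier_vec n" using w by simp
    show "((1 / N) \<cdot>\<^sub>v w) \<diamondop> ((1 / N) \<cdot>\<^sub>v w) = 1"
      using w N pos by (simp add: field_simps)
    show "Z = (\<sigma> * (w \<diamondop> w)) \<cdot>\<^sub>m outer ((1 / N) \<cdot>\<^sub>v w) ((1 / N) \<cdot>\<^sub>v w)"
      using w N Z by (intro eq_matI) (auto simp: Zs N(2)[symmetric])
  qed
qed

section \<open>Tangent spaces and projections\<close>

text \<open>Coordinates on the tangent space: y = v + (w/2) u merges the two parameters of w u u^T +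
  u v^T + v u^T into one unconstrained vector.\<close>

definition sym_outer :: "real Matrix.vec \<Rightarrow> real Matrix.vec \<Rightarrow> real mat" where
  "sym_outer u y = outer u y + outer y u"

lemma sym_outer_carrier[simp]:
  "u \<in> carrier_vec n \<Longrightarrow> y \<in> carrier_vec n \<Longrightarrow> sym_outer u y \<in> carrier_mat n n"
  by (simp add: sym_outer_def)

lemma sym_outer_index[simp]:
  assumes "u \<in> carrier_vec n" "y \<in> carrier_vec n" "i < n" "k < n"
  shows "sym_outer u y $$ (i,k) = vec_index u i * vec_index y k + vec_index y i * vec_index u k"
  using assms by (simp add: sym_outer_def)

text \<open>Two unit vectors spanning the same line differ by a factor c with c^2 = 1, which is
  absorbed into y; this removes the choice of u from the definition.\<close>

lemma tangent_space_rank_one: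
  assumes u: "u \<in> carrier_vec n" "u \<diamondop> u = 1" and s: "s \<noteq> 0"
  shows "tangent_space n (s \<cdot>\<^sub>m outer u u) = sym_outer u ` carrier_vec n"
proof (intro subset_antisym subsetI)
  fix \<xi> assume "\<xi> \<in> tangent_space n (s \<cdot>\<^sub>m outer u u)"
  then obtain w v u' where h: "\<xi> = w \<cdot>\<^sub>m outer u' u' + outer u' v + outer v u'" "u' \<in> carrier_vec n"
    "u' \<diamondop> u' = 1" "range (\<lambda>c. c \<cdot>\<^sub>v u) = range (\<lambda>c. c \<cdot>\<^sub>v u')" "v \<in> carrier_vec n"
    by (auto simp: tangent_space_def col_space_rank_one[OF u s])
  have "u' \<in> range (\<lambda>c. c \<cdot>\<^sub>v u)" unfolding h(4) by (rule range_eqI[of _ _ 1]) simp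
  then obtain c where c: "u' = c \<cdot>\<^sub>v u" by auto
  have "c * c = 1" using h(3) u by (simp add: c)
  have "\<xi> = sym_outer u (c \<cdot>\<^sub>v v + (w / 2) \<cdot>\<^sub>v u)"
    unfolding h(1) using u h(2,5)
    by (intro eq_matI) (auto simp: c \<open>c * c = 1\<close> sym_outer_def algebra_simps)
  then show "\<xi> \<in> sym_outer u ` carrier_vec n" using u h by auto
next
  fix \<xi> assume "\<xi> \<in> sym_outer u ` carrier_vec n"
  then obtain y where y: "y \<in> carrier_vec n" "\<xi> = sym_outer u y" by auto
  define v where "v = y - (u \<diamondop> y) \<cdot>\<^sub>v u"
  have v: "v \<in> carrier_vec n" "v \<diamondop> u = 0"
    using u y by (auto simp: v_def minus_scalar_prod_distrib[where n=n] comm_scalar_prod[OF u(1) y(1)])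
  have "\<xi> = (2 * (u \<diamondop> y)) \<cdot>\<^sub>m outer u u + outer u v + outer v u"
    using u y by (intro eq_matI) (auto simp: v_def sym_outer_def algebra_simps)
  then show "\<xi> \<in> tangent_space n (s \<cdot>\<^sub>m outer u u)"
    unfolding tangent_space_def col_space_rank_one[OF u s] using u v by blast
qed

lemma frob_inner_sym_outer:
  assumes "A \<in> carrier_mat n n" "u \<in> carrier_vec n" "y \<in> carrier_vec n"
  shows "frob_inner A (sym_outer u y) = bil n A u y + bil n A y u"
  using assms by (simp add: sym_outer_def frob_inner_add_right[where n=n] frob_inner_outer)

lemma bil_sym_outer:
  assumes "u \<in> carrier_vec n" "y \<in> carrier_vec n" "v \<in> carrier_vec n" "w \<in> carrier_vec n"
  shows "bil n (sym_outer u y) v w = (u \<diamondop> v) * (y \<diamondop> w) + (y \<diamondop> v) * (u \<diamondop> w)"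
proof -
  have "bil n (sym_outer u y) v w = (\<Sum>i<n. \<Sum>k<n. (vec_index u i * vec_index v i) * (vec_index y k * vec_index w k)
    + (vec_index y i * vec_index v i) * (vec_index u k * vec_index w k))"
    unfolding bil_def using assms by (intro sum.cong refl) (simp add: algebra_simps)
  then show ?thesis using assms by (simp add: scalar_prod_sum[where n=n] sum_product sum.distrib)
qed

text \<open>The Gram form of the coordinates y. It is not the Euclidean one, so eigenvalue questions
  on the tangent space become generalised eigenvalue problems in y.\<close>

lemma sym_outer_inner:
  assumes "u \<in> carrier_vec n" "u \<diamondop> u = 1" "y \<in> carrier_vec n" "y' \<in> carrier_vec n"
  shows "frob_inner (sym_outer u y) (sym_outer u y') = 2 * (y \<diamondop> y') + 2 * (u \<diamondop> y) * (u \<diamondop> y')"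
  using assms(2) comm_scalar_prod[OF assms(3,1)]
  by (simp add: frob_inner_sym_outer[OF sym_outer_carrier[OF assms(1,3)] assms(1,4)]
      bil_sym_outer[OF assms(1,3)] assms)

lemma bil_smult_left: "v \<in> carrier_vec n \<Longrightarrow> bil n A (c \<cdot>\<^sub>v v) w = c * bil n A v w"
  by (simp add: bil_def sum_distrib_left algebra_simps)

lemma bil_smult_right: "w \<in> carrier_vec n \<Longrightarrow> bil n A v (c \<cdot>\<^sub>v w) = c * bil n A v w"
  by (simp add: bil_def sum_distrib_left algebra_simps)

lemma bil_add_left: "v \<in> carrier_vec n \<Longrightarrow> v' \<in> carrier_vec n \<Longrightarrow> bil n A (v + v') w = bil n A v w + bil n A v' w"
  by (simp add: bil_def algebra_simps sum.distrib)

lemma bil_add_right: "w \<in> carrier_vec n \<Longrightarrow> w' \<in> carrier_vec n \<Longrightarrow> bil n A v (w + w') = bil n A v w + bil n A v w'"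
  by (simp add: bil_def algebra_simps sum.distrib)

text \<open>Turns the description in \<open>orth_proj\<close> into a test against tangent vectors.
  Uniqueness holds because the difference of two candidates is again tangent and orthogonal to
  itself.\<close>

lemma orth_proj_eqI:
  assumes u: "u \<in> carrier_vec n" "u \<diamondop> u = 1" and A: "A \<in> carrier_mat n n"
    and y: "y \<in> carrier_vec n"
    and orth: "\<And>y'. y' \<in> carrier_vec n \<Longrightarrow>
      frob_inner (sym_outer u y) (sym_outer u y') = frob_inner A (sym_outer u y')"
  shows "orth_proj (sym_outer u ` carrier_vec n) A = sym_outer u y"
  unfolding orth_proj_def
proof (rule the_equality)
  show "sym_outer u y \<in> sym_outer u ` carrier_vec n \<and>
    (\<forall>\<xi>\<in>sym_outer u ` carrier_vec n. frob_inner (A - sym_outer u y) \<xi> = 0)"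
    using u A y orth by (auto simp: frob_inner_diff_left[where n=n])
next
  fix B assume B: "B \<in> sym_outer u ` carrier_vec n \<and>
    (\<forall>\<xi>\<in>sym_outer u ` carrier_vec n. frob_inner (A - B) \<xi> = 0)"
  then obtain b where b: "b \<in> carrier_vec n" "B = sym_outer u b" by auto
  have ab: "frob_inner A (sym_outer u y') = frob_inner B (sym_outer u y')" if "y' \<in> carrier_vec n" for y'
    using B that u A b by (auto simp: frob_inner_diff_left[where n=n])
  have eq: "sym_outer u (b - y) = sym_outer u b - sym_outer u y"
    using u b y by (intro eq_matI) (auto simp: sym_outer_def algebra_simps)
  have "frob_inner (sym_outer u (b - y)) (sym_outer u (b - y)) = 0"
    using ab[of "b - y"] orth[of "b - y"] u b y A
    by (subst (1) eq) (simp add: frob_inner_diff_left[where n=n])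
  then have "sym_outer u (b - y) = 0\<^sub>m n n" using u b y by (intro frob_inner_self_eq_0) auto
  then have z: "sym_outer u b - sym_outer u y = 0\<^sub>m n n" by (simp add: eq)
  show "B = sym_outer u y" unfolding b(2)
  proof (rule eq_matI)
    fix i k assume "i < dim_row (sym_outer u y)" "k < dim_col (sym_outer u y)"
    then have ik: "i < n" "k < n" using u y by (auto simp: sym_outer_def)
    then have "(sym_outer u b - sym_outer u y) $$ (i,k) = 0" using z by simp
    then show "sym_outer u b $$ (i,k) = sym_outer u y $$ (i,k)" using ik u b y
      by (simp add: sym_outer_def)
  qed (use u b y in \<open>auto simp: sym_outer_def\<close>)
qed

text \<open>Solves y + <u,y> u = S u, where S is the symmetric part of A. Pairing with u gives <u,y>
  = (u^T A u)/2, hence y = S u - (u^T A u)/2 u, and \<open>sym_outer u y\<close> is the projection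
  of A.\<close>

definition tangent_coord :: "nat \<Rightarrow> real Matrix.vec \<Rightarrow> real mat \<Rightarrow> real Matrix.vec" where
  "tangent_coord n u A = Matrix.vec n (\<lambda>i.
     (\<Sum>k<n. (A $$ (i,k) + A $$ (k,i)) * vec_index u k) / 2 - bil n A u u / 2 * vec_index u i)"

lemma tangent_coord_carrier[simp]: "tangent_coord n u A \<in> carrier_vec n"
  by (simp add: tangent_coord_def)

lemma tangent_coord_inner:
  assumes u: "u \<in> carrier_vec n" and y: "y \<in> carrier_vec n"
  shows "tangent_coord n u A \<diamondop> y = (bil n A u y + bil n A y u) / 2 - bil n A u u / 2 * (u \<diamondop> y)"
proof -
  have "tangent_coord n u A \<diamondop> y = (\<Sum>i<n. \<Sum>k<n. A $$ (i,k) * (vec_index y i * vec_index u k)) / 2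
     + (\<Sum>i<n. \<Sum>k<n. A $$ (k,i) * (vec_index u k * vec_index y i)) / 2 - bil n A u u / 2 * (u \<diamondop> y)"
    using u y by (simp add: scalar_prod_sum[where n=n] tangent_coord_def algebra_simps sum_divide_distrib
        sum.distrib sum_distrib_left sum_subtractf add_divide_distrib)
  also have "(\<Sum>i<n. \<Sum>k<n. A $$ (k,i) * (vec_index u k * vec_index y i)) = bil n A u y"
    unfolding bil_def by (rule sum.swap)
  finally show ?thesis by (simp add: bil_def add_divide_distrib)
qed

lemma sym_outer_tangent_coord_inner:
  assumes u: "u \<in> carrier_vec n" "u \<diamondop> u = 1" and A: "A \<in> carrier_mat n n" and y: "y \<in> carrier_vec n"
  shows "frob_inner (sym_outer u (tangent_coord n u A)) (sym_outer u y) = frob_inner A (sym_outer u y)"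
proof -
  have "u \<diamondop> tangent_coord n u A = bil n A u u / 2"
    using tangent_coord_inner[OF u(1) u(1), of A] u comm_scalar_prod[OF u(1) tangent_coord_carrier[of n u A]]
    by simp
  then show ?thesis
    using tangent_coord_inner[OF u(1) y, of A]
    by (simp add: sym_outer_inner[OF u _ y] frob_inner_sym_outer[OF A u(1) y] field_simps)
qed

lemma orth_proj_tangent:
  assumes u: "u \<in> carrier_vec n" "u \<diamondop> u = 1" and A: "A \<in> carrier_mat n n"
  shows "orth_proj (sym_outer u ` carrier_vec n) A = sym_outer u (tangent_coord n u A)"
  by (intro orth_proj_eqI[OF u A] sym_outer_tangent_coord_inner[OF u A]) auto

lemma orth_proj_inner:
  assumes u: "u \<in> carrier_vec n" "u \<diamondop> u = 1" and A: "A \<in> carrier_mat n n" and y: "y \<in> carrier_vec n"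
  shows "frob_inner (orth_proj (sym_outer u ` carrier_vec n) A) (sym_outer u y) = frob_inner A (sym_outer u y)"
  using sym_outer_tangent_coord_inner[OF assms] by (simp add: orth_proj_tangent[OF u A])

section \<open>Eigenvalues of symmetric forms\<close>

text \<open>The sphere is modelled by functions on nat that vanish from n on: a closed subset of a
  product of compact intervals, hence compact, so the continuous ratio attains its minimum. Both
  forms are homogeneous of degree two, which extends the inequality to all y.\<close>

lemma sphere_form_ratio_min:
  fixes B N :: "real mat"
  assumes n: "n > 0" and pos: "\<And>y. y \<in> carrier_vec n \<Longrightarrow> y \<noteq> 0\<^sub>v n \<Longrightarrow> bil n N y y > 0"
  obtains y0 where "y0 \<in> carrier_vec n" "y0 \<noteq> 0\<^sub>v n"
    "\<And>y. y \<in> carrier_vec n \<Longrightarrow> bil n B y y \<ge> bil n B y0 y0 / bil n N y0 y0 * bil n N y y"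
proof -
  define K :: "(nat \<Rightarrow> real) set" where
    "K = Pi\<^sub>E UNIV (\<lambda>i. if i < n then {-1..1} else {0}) \<inter> {g. (\<Sum>i<n. g i * g i) = 1}"
  define F where "F M g = (\<Sum>i<n. \<Sum>k<n. M $$ (i,k) * (g i * g k))" for M :: "real mat" and g :: "nat \<Rightarrow> real"
  have cont: "continuous_on A (F M)" for M A
    unfolding F_def by (intro continuous_intros continuous_on_subset[OF continuous_on_product_coordinates subset_UNIV])
  have "compactin (product_topology (\<lambda>_. euclidean) UNIV) (Pi\<^sub>E UNIV (\<lambda>i. if i < n then {-1..1::real} else {0}))"
    by (subst compactin_PiE) auto
  then have "compact (Pi\<^sub>E UNIV (\<lambda>i. if i < n then {-1..1::real} else {0}) :: (nat \<Rightarrow> real) set)"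
    by (simp add: euclidean_product_topology)
  moreover have "closed {g :: nat \<Rightarrow> real. (\<Sum>i<n. g i * g i) = 1}"
    by (intro closed_Collect_eq continuous_intros continuous_on_product_coordinates)
  ultimately have K: "compact K" unfolding K_def by (rule compact_Int_closed)
  have FV: "F M g = bil n M (Matrix.vec n g) (Matrix.vec n g)" for M g
    by (simp add: F_def bil_def)
  have Kn: "Matrix.vec n g \<noteq> 0\<^sub>v n" if "g \<in> K" for g
  proof
    assume "Matrix.vec n g = 0\<^sub>v n"
    then have "\<forall>i<n. g i = 0" by (metis index_vec index_zero_vec(1))
    then show False using that by (simp add: K_def)
  qed
  have FN: "F N g > 0" if "g \<in> K" for g using pos[OF _ Kn[OF that]] by (simp add: FV)
  \<comment> \<open>The first coordinate vector witnesses that K is nonempty; this is where n > 0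
    enters.\<close>
  have "(\<Sum>i<n. (if i = 0 then 1 else 0) * (if i = 0 then 1 else (0::real))) = (\<Sum>i<n. if i = 0 then 1 else 0)"
    by (intro sum.cong) auto
  also have "\<dots> = 1" using n by (subst sum.delta) auto
  finally have "(\<lambda>i. if i = 0 then 1 else 0) \<in> K" using n unfolding K_def by auto
  then have "K \<noteq> {}" by blast
  moreover have "continuous_on K (\<lambda>g. F B g / F N g)"
    using FN by (intro continuous_intros cont) force
  ultimately obtain g0 where g0: "g0 \<in> K" "\<And>g. g \<in> K \<Longrightarrow> F B g0 / F N g0 \<le> F B g / F N g"
    using continuous_attains_inf[of K "\<lambda>g. F B g / F N g", OF K] by blast
  show thesis
  proof (rule that[of "Matrix.vec n g0"])
    fix y :: "real Matrix.vec" assume y: "y \<in> carrier_vec n"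
    show "bil n B y y \<ge> bil n B (Matrix.vec n g0) (Matrix.vec n g0) / bil n N (Matrix.vec n g0) (Matrix.vec n g0) * bil n N y y"
    proof (cases "y = 0\<^sub>v n")
      case True then show ?thesis by (simp add: bil_def)
    next
      case False
      define r where "r = sqrt (y \<diamondop> y)"
      have r: "r > 0" "r * r = y \<diamondop> y" using scalar_prod_self_pos[OF y False] by (auto simp: r_def)
      define g where "g i = (if i < n then vec_index y i / r else 0)" for i
      have yy: "y = r \<cdot>\<^sub>v Matrix.vec n g" using r y by (intro eq_vecI) (auto simp: g_def)
      have s1: "(\<Sum>i<n. g i * g i) = 1"
      proof -
        have "(\<Sum>i<n. g i * g i) = (\<Sum>i<n. vec_index y i * vec_index y i / (r * r))"
          by (intro sum.cong refl) (simp add: g_def)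
        also have "\<dots> = (y \<diamondop> y) / (r * r)"
          using y by (simp only: scalar_prod_sum[where n=n] carrier_vecD sum_divide_distrib)
        finally show ?thesis using r(1) by (simp flip: r(2))
      qed
      have "\<bar>g i\<bar> \<le> 1" if "i < n" for i
      proof -
        have "g i * g i \<le> (\<Sum>i<n. g i * g i)" using that by (intro member_le_sum) auto
        then have "(g i)\<^sup>2 \<le> 1" using s1 by (simp add: power2_eq_square)
        then show ?thesis by (simp add: abs_square_le_1)
      qed
      then have "g \<in> K" unfolding K_def using s1 by (auto simp: abs_le_iff minus_le_iff) (simp add: g_def)
      from g0(2)[OF this] FN[OF this] FN[OF g0(1)] have "F B g0 / F N g0 * F N g \<le> F B g"
        by (simp add: pos_le_divide_eq)
      then have "r * r * (F B g0 / F N g0 * F N g) \<le> r * r * F B g"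
        using r(1) by (intro mult_left_mono) auto
      moreover have "bil n M y y = r * r * F M g" for M
        unfolding FV by (subst (1 2) yy) (simp add: bil_smult_left[where n=n] bil_smult_right[where n=n])
      ultimately show ?thesis unfolding FV[symmetric] by (simp add: mult.assoc mult.left_commute)
    qed
  qed (use Kn g0 in auto)
qed

text \<open>First-order condition at a minimiser of the ratio: moving from a test vector y along y0
  gives 0 \<le> p + 2 l q for every real l, which forces q = 0. N will be the Gram matrix of the
  tangent coordinates.\<close>

lemma generalized_eigenvector_min:
  fixes B N :: "real mat"
  assumes n: "n > 0" and pos: "\<And>y. y \<in> carrier_vec n \<Longrightarrow> y \<noteq> 0\<^sub>v n \<Longrightarrow> bil n N y y > 0"
    and symB: "\<And>y z. y \<in> carrier_vec n \<Longrightarrow> z \<in> carrier_vec n \<Longrightarrow> bil n B y z = bil n B z y"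
    and symN: "\<And>y z. y \<in> carrier_vec n \<Longrightarrow> z \<in> carrier_vec n \<Longrightarrow> bil n N y z = bil n N z y"
  shows "\<exists>\<mu> y0. y0 \<in> carrier_vec n \<and> y0 \<noteq> 0\<^sub>v n \<and>
    (\<forall>y\<in>carrier_vec n. bil n B y0 y = \<mu> * bil n N y0 y) \<and>
    (\<forall>y\<in>carrier_vec n. bil n B y y \<ge> \<mu> * bil n N y y)"
proof -
  obtain y0 where y0: "y0 \<in> carrier_vec n" "y0 \<noteq> 0\<^sub>v n" and
    min: "\<And>y. y \<in> carrier_vec n \<Longrightarrow> bil n B y y \<ge> bil n B y0 y0 / bil n N y0 y0 * bil n N y y"
    using sphere_form_ratio_min[OF n pos] by metis
  define \<mu> where "\<mu> = bil n B y0 y0 / bil n N y0 y0"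
  have eq0: "bil n B y0 y0 = \<mu> * bil n N y0 y0" using pos[OF y0] by (simp add: \<mu>_def)
  have "bil n B y0 y = \<mu> * bil n N y0 y" if y: "y \<in> carrier_vec n" for y
  proof (rule ccontr)
    define q where "q = bil n B y0 y - \<mu> * bil n N y0 y"
    define p where "p = bil n B y y - \<mu> * bil n N y y"
    assume "\<not> ?thesis"
    then have q: "q \<noteq> 0" by (simp add: q_def)
    have "0 \<le> p + 2 * l * q" for l
    proof -
      have c: "y + l \<cdot>\<^sub>v y0 \<in> carrier_vec n" using y y0 by simp
      have ex: "bil n M (y + l \<cdot>\<^sub>v y0) (y + l \<cdot>\<^sub>v y0) = bil n M y y + l * bil n M y y0 + l * bil n M y0 y + l * l * bil n M y0 y0" for M
        using y y0 by (simp add: bil_add_left[where n=n] bil_add_right[where n=n] bil_smult_left[where n=n] bil_smult_right[where n=n] algebra_simps)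
      from min[OF c, folded \<mu>_def] show ?thesis
        unfolding ex symB[OF y y0(1)] symN[OF y y0(1)] eq0 by (simp add: p_def q_def algebra_simps)
    qed
    \<comment> \<open>This l makes the right-hand side equal to -1.\<close>
    from this[of "- (p + 1) / (2 * q)"] show False using q by (simp add: field_simps)
  qed
  then show ?thesis using y0 min[folded \<mu>_def] by blast
qed

section \<open>Gradient and Hessian of the loss\<close>

text \<open>The weights q stay arbitrary so that one matrix (1/m) sum q_j a_j a_j^T serves as the
  gradient, as its directional derivative and as the matrix of the Hessian form.\<close>

definition emp_grad :: "nat \<Rightarrow> nat \<Rightarrow> (nat \<Rightarrow> real Matrix.vec) \<Rightarrow> (nat \<Rightarrow> real) \<Rightarrow> real mat" where
  "emp_grad n m a q = Matrix.mat n n (\<lambda>(i,k). 1 / real m * (\<Sum>j<m. q j * (vec_index (a j) i * vec_index (a j) k)))"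

lemma emp_grad_carrier[simp]: "emp_grad n m a q \<in> carrier_mat n n"
  by (simp add: emp_grad_def)

definition quad :: "nat \<Rightarrow> (nat \<Rightarrow> real Matrix.vec) \<Rightarrow> real mat \<Rightarrow> nat \<Rightarrow> real" where
  "quad n a Y j = bil n Y (a j) (a j)"

lemma frob_inner_outer_quad:
  assumes "\<And>j. a j \<in> carrier_vec n" "Y \<in> carrier_mat n n"
  shows "frob_inner (outer (a j) (a j)) Y = quad n a Y j"
  using assms by (simp add: frob_inner_commute[where n=n] frob_inner_outer quad_def)

lemma bil_diff_mat:
  assumes "Y \<in> carrier_mat n n" "X \<in> carrier_mat n n"
  shows "bil n (Y - X) v w = bil n Y v w - bil n X v w"
  using assms by (simp add: bil_def algebra_simps sum_subtractf)

lemma bil_add_mat: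
  assumes "Y \<in> carrier_mat n n" "X \<in> carrier_mat n n"
  shows "bil n (Y + X) v w = bil n Y v w + bil n X v w"
  using assms by (simp add: bil_def algebra_simps sum.distrib)

lemma bil_smult_mat:
  assumes "Y \<in> carrier_mat n n"
  shows "bil n (c \<cdot>\<^sub>m Y) v w = c * bil n Y v w"
  using assms by (simp add: bil_def algebra_simps sum_distrib_left)

lemma bil_outer:
  assumes "u \<in> carrier_vec n" "y \<in> carrier_vec n" "v \<in> carrier_vec n" "w \<in> carrier_vec n"
  shows "bil n (outer u y) v w = (u \<diamondop> v) * (y \<diamondop> w)"
  using assms outer_inner[of u n y v w] frob_inner_outer[of "outer u y" n v w] by simp

lemma quad_smult: "Y \<in> carrier_mat n n \<Longrightarrow> quad n a (c \<cdot>\<^sub>m Y) j = c * quad n a Y j"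
  by (simp add: quad_def bil_smult_mat)

lemma quad_diff: "Y \<in> carrier_mat n n \<Longrightarrow> X \<in> carrier_mat n n \<Longrightarrow> quad n a (Y - X) j = quad n a Y j - quad n a X j"
  by (simp add: quad_def bil_diff_mat)

lemma quad_add: "Y \<in> carrier_mat n n \<Longrightarrow> X \<in> carrier_mat n n \<Longrightarrow> quad n a (Y + X) j = quad n a Y j + quad n a X j"
  by (simp add: quad_def bil_add_mat)

lemma frob_inner_emp_grad:
  assumes "H \<in> carrier_mat n n"
  shows "frob_inner (emp_grad n m a q) H = 1 / real m * (\<Sum>j<m. q j * quad n a H j)"
proof -
  have "frob_inner (emp_grad n m a q) H = (\<Sum>i<n. \<Sum>k<n. \<Sum>j<m. 1 / real m * (q j * (H $$ (i,k) * (vec_index (a j) i * vec_index (a j) k))))"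
    unfolding frob_inner_sum[OF emp_grad_carrier assms]
  proof (intro sum.cong refl)
    fix i k assume "i \<in> {..<n}" "k \<in> {..<n}"
    then have "emp_grad n m a q $$ (i,k) = 1 / real m * (\<Sum>j<m. q j * (vec_index (a j) i * vec_index (a j) k))"
      by (simp add: emp_grad_def)
    then show "emp_grad n m a q $$ (i,k) * H $$ (i,k) =
      (\<Sum>j<m. 1 / real m * (q j * (H $$ (i,k) * (vec_index (a j) i * vec_index (a j) k))))"
      by (simp only: sum_distrib_left sum_distrib_right) (intro sum.cong refl, simp only: mult_ac)
  qed
  also have "\<dots> = (\<Sum>i<n. \<Sum>j<m. \<Sum>k<n. 1 / real m * (q j * (H $$ (i,k) * (vec_index (a j) i * vec_index (a j) k))))"
    by (rule sum.cong[OF refl], rule sum.swap)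
  also have "\<dots> = (\<Sum>j<m. \<Sum>i<n. \<Sum>k<n. 1 / real m * (q j * (H $$ (i,k) * (vec_index (a j) i * vec_index (a j) k))))"
    by (rule sum.swap)
  finally show ?thesis by (simp only: sum_distrib_left quad_def bil_def)
qed

lemma bil_emp_grad:
  assumes a: "\<And>j. a j \<in> carrier_vec n" and v: "v \<in> carrier_vec n" "w \<in> carrier_vec n"
  shows "bil n (emp_grad n m a q) v w = 1 / real m * (\<Sum>j<m. q j * ((a j \<diamondop> v) * (a j \<diamondop> w)))"
proof -
  have "quad n a (outer v w) j = (a j \<diamondop> v) * (a j \<diamondop> w)" for j
    unfolding quad_def bil_outer[OF v a a] comm_scalar_prod[OF v(1) a] comm_scalar_prod[OF v(2) a] ..
  then show ?thesis
    by (simp only: frob_inner_outer[OF emp_grad_carrier v, symmetric] frob_inner_emp_grad[OF outer_carrier[OF v]])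
qed

text \<open>Along a line the loss is a quadratic polynomial in t, which gives the derivative;
  uniqueness follows by testing the difference of two candidates against itself.\<close>

lemma ambient_grad_loss:
  assumes a: "\<And>j. a j \<in> carrier_vec n" and X: "X \<in> carrier_mat n n" and Z: "Z \<in> carrier_mat n n"
  shows "ambient_grad n (loss m a X) Z = emp_grad n m a (quad n a (Z - X))"
  unfolding ambient_grad_def
proof (rule the_equality, intro conjI ballI)
  have D: "((\<lambda>t. loss m a X (Z + t \<cdot>\<^sub>m H)) has_real_derivative
      frob_inner (emp_grad n m a (quad n a (Z - X))) H) (at 0)" if H: "H \<in> carrier_mat n n" for H
  proof -
    have eq: "loss m a X (Z + t \<cdot>\<^sub>m H) = 1 / (2 * real m) * (\<Sum>j<m. (quad n a (Z - X) j + t * quad n a H j)\<^sup>2)" for t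
    proof -
      have "Z + t \<cdot>\<^sub>m H - X = (Z - X) + t \<cdot>\<^sub>m H" using Z X H by (intro eq_matI) auto
      then have "quad n a (Z + t \<cdot>\<^sub>m H - X) j = quad n a (Z - X) j + t * quad n a H j" for j
        using Z X H by (simp add: quad_add quad_smult minus_carrier_mat)
      moreover have c: "Z + t \<cdot>\<^sub>m H - X \<in> carrier_mat n n" using X by (rule minus_carrier_mat)
      ultimately have "frob_inner (outer (a j) (a j)) (Z + t \<cdot>\<^sub>m H - X) = quad n a (Z - X) j + t * quad n a H j" for j
        using frob_inner_outer_quad[of a n, OF a c] by simp
      then show ?thesis unfolding loss_def by simp
    qed
    show ?thesis unfolding eq frob_inner_emp_grad[OF H]
      by (auto intro!: derivative_eq_intros sum.cong simp: sum_distrib_left field_simps)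
  qed
  show "\<And>H. H \<in> carrier_mat n n \<Longrightarrow> ((\<lambda>t. loss m a X (Z + t \<cdot>\<^sub>m H)) has_real_derivative
      frob_inner (emp_grad n m a (quad n a (Z - X))) H) (at 0)" by (rule D)
  fix G assume G: "G \<in> carrier_mat n n \<and> (\<forall>H\<in>carrier_mat n n.
    ((\<lambda>t. loss m a X (Z + t \<cdot>\<^sub>m H)) has_real_derivative frob_inner G H) (at 0))"
  define E where "E = emp_grad n m a (quad n a (Z - X))"
  have E: "E \<in> carrier_mat n n" by (simp add: E_def)
  have GE: "G - E \<in> carrier_mat n n" using E by (rule minus_carrier_mat)
  have "frob_inner G (G - E) = frob_inner E (G - E)"
    using DERIV_unique[OF _ D[OF GE]] G GE by (auto simp: E_def)
  then have "frob_inner (G - E) (G - E) = 0" using frob_inner_diff_left[OF _ E GE] G by auto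
  then have z: "G - E = 0\<^sub>m n n" by (rule frob_inner_self_eq_0[OF GE])
  show "G = emp_grad n m a (quad n a (Z - X))" unfolding E_def[symmetric]
  proof (rule eq_matI)
    fix i k assume "i < dim_row E" "k < dim_col E"
    then have ik: "i < n" "k < n" using E by auto
    then have "(G - E) $$ (i,k) = 0" using z by simp
    then show "G $$ (i,k) = E $$ (i,k)" using ik E by simp
  qed (use E G in auto)
qed simp

lemma bil_sym_grad:
  assumes "\<And>j. a j \<in> carrier_vec n" "v \<in> carrier_vec n" "w \<in> carrier_vec n"
  shows "bil n (emp_grad n m a q) v w = bil n (emp_grad n m a q) w v"
  by (simp add: bil_emp_grad assms mult.commute)

lemma riem_grad_loss:
  assumes a: "\<And>j. a j \<in> carrier_vec n" and X: "X \<in> carrier_mat n n"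
    and u: "u \<in> carrier_vec n" "u \<diamondop> u = 1" and s: "s \<noteq> 0" and Z: "Z = s \<cdot>\<^sub>m outer u u"
  shows "riem_grad n (loss m a X) Z = orth_proj (sym_outer u ` carrier_vec n) (emp_grad n m a (quad n a (Z - X)))"
proof -
  have "Z \<in> carrier_mat n n" using Z u by simp
  then show ?thesis
    by (simp add: riem_grad_def ambient_grad_loss[OF a X] tangent_space_rank_one[OF u s] Z)
qed

text \<open>As y is unconstrained and the ambient gradient G is symmetric, vanishing of the
  Riemannian gradient is the full equation G u = 0, not only its part orthogonal to u. All
  cancellations in the Hessian computation rest on this.\<close>

lemma riem_grad_zeroD:
  assumes a: "\<And>j. a j \<in> carrier_vec n" and X: "X \<in> carrier_mat n n"
    and u: "u \<in> carrier_vec n" "u \<diamondop> u = 1" and s: "s \<noteq> 0" and Z: "Z = s \<cdot>\<^sub>m outer u u"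
    and crit: "riem_grad n (loss m a X) Z = 0\<^sub>m n n" and y: "y \<in> carrier_vec n"
  shows "bil n (emp_grad n m a (quad n a (Z - X))) u y = 0"
proof -
  let ?G = "emp_grad n m a (quad n a (Z - X))"
  have "frob_inner (0\<^sub>m n n) (sym_outer u y) = frob_inner ?G (sym_outer u y)"
    using orth_proj_inner[OF u emp_grad_carrier y, of m a "quad n a (Z - X)"] crit riem_grad_loss[OF a X u s Z] by simp
  moreover have "frob_inner (0\<^sub>m n n) (sym_outer u y) = 0"
    using u y by (subst frob_inner_sum[where n=n]) auto
  ultimately show ?thesis
    using frob_inner_sym_outer[OF emp_grad_carrier u(1) y, of m a "quad n a (Z - X)"] bil_sym_grad[OF a y u(1), where m=m and q="quad n a (Z - X)"] by simp
qed

text \<open>With \<open>\<Pi> = Y / tr Y\<close> and \<open>G\<close> the ambient gradient at \<open>Y\<close>, the Riemannian gradient is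
  \<open>\<Pi> G + G \<Pi> - \<Pi> G \<Pi>\<close>. This form extends smoothly off the manifold, so it can be
  differentiated along an arbitrary curve.\<close>

definition normalized_image :: "nat \<Rightarrow> real mat \<Rightarrow> real Matrix.vec \<Rightarrow> real Matrix.vec" where
  "normalized_image n Y v = Matrix.vec n (\<lambda>i. (\<Sum>l<n. Y $$ (i,l) * vec_index v l) / (\<Sum>l<n. Y $$ (l,l)))"

lemma normalized_image_rank_one:
  assumes "u \<in> carrier_vec n" "u \<diamondop> u = 1" "s \<noteq> 0" "v \<in> carrier_vec n"
  shows "normalized_image n (s \<cdot>\<^sub>m outer u u) v = (u \<diamondop> v) \<cdot>\<^sub>v u"
proof -
  have "(\<Sum>l<n. s * (vec_index u l * vec_index u l)) = s"
    using assms by (simp add: scalar_prod_sum[where n=n] flip: sum_distrib_left)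
  then show ?thesis using assms
    by (intro eq_vecI) (auto simp: normalized_image_def scalar_prod_sum[where n=n] sum_distrib_left sum_distrib_right sum_divide_distrib mult_ac intro!: sum.cong)
qed

text \<open>The right-hand side no longer mentions u, which is determined only up to sign at each
  point of a curve and so could not be differentiated as it stands.\<close>

lemma bil_riem_grad:
  fixes m :: nat
  assumes a: "\<And>j. a j \<in> carrier_vec n" and X: "X \<in> carrier_mat n n"
    and Y: "Y \<in> rank_one_manifold n" and v: "v \<in> carrier_vec n" "w \<in> carrier_vec n"
  defines "G \<equiv> emp_grad n m a (quad n a (Y - X))"
  shows "bil n (riem_grad n (loss m a X) Y) v w =
    bil n G (normalized_image n Y v) w + bil n G v (normalized_image n Y w)
    - bil n G (normalized_image n Y v) (normalized_image n Y w)"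
proof -
  obtain s u where u: "s \<noteq> 0" "u \<in> carrier_vec n" "u \<diamondop> u = 1" "Y = s \<cdot>\<^sub>m outer u u"
    using rank_one_manifoldE[OF Y] .
  have G: "G \<in> carrier_mat n n" by (simp add: G_def)
  have "riem_grad n (loss m a X) Y = sym_outer u (tangent_coord n u G)"
    using riem_grad_loss[OF a X u(2,3,1,4)] orth_proj_tangent[OF u(2,3) G] by (simp add: G_def)
  moreover have t: "tangent_coord n u G \<diamondop> y = bil n G u y - bil n G u u / 2 * (u \<diamondop> y)" if "y \<in> carrier_vec n" for y
    using tangent_coord_inner[OF u(2) that, of G] bil_sym_grad[OF a that u(2)] by (simp add: G_def)
  ultimately have "bil n (riem_grad n (loss m a X) Y) v w =
      (u \<diamondop> v) * (bil n G u w - bil n G u u / 2 * (u \<diamondop> w)) + (bil n G u v - bil n G u u / 2 * (u \<diamondop> v)) * (u \<diamondop> w)"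
    by (simp only: bil_sym_outer[OF u(2) tangent_coord_carrier v] t[OF v(1)] t[OF v(2)])
  also have "\<dots> = (u \<diamondop> v) * bil n G u w + (u \<diamondop> w) * bil n G u v - (u \<diamondop> w) * ((u \<diamondop> v) * bil n G u u)"
    by (simp add: field_simps)
  also have "\<dots> = bil n G ((u \<diamondop> v) \<cdot>\<^sub>v u) w + bil n G v ((u \<diamondop> w) \<cdot>\<^sub>v u) - bil n G ((u \<diamondop> v) \<cdot>\<^sub>v u) ((u \<diamondop> w) \<cdot>\<^sub>v u)"
    using bil_sym_grad[of a n, OF a v(1) u(2), where m=m and q="quad n a (Y - X)"]
    by (simp only: bil_smult_left[OF u(2)] bil_smult_right[OF u(2)] G_def)
  finally show ?thesis
    by (simp only: u(4) normalized_image_rank_one[OF u(2,3,1) v(1)] normalized_image_rank_one[OF u(2,3,1) v(2)])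
qed

definition has_vec_derivative_at0 :: "nat \<Rightarrow> (real \<Rightarrow> real Matrix.vec) \<Rightarrow> real Matrix.vec \<Rightarrow> bool" where
  "has_vec_derivative_at0 n \<alpha> D \<longleftrightarrow> D \<in> carrier_vec n \<and>
     (\<forall>i<n. ((\<lambda>t. vec_index (\<alpha> t) i) has_real_derivative vec_index D i) (at 0))"

lemma bil_has_derivative:
  assumes "has_mat_derivative_at0 n G G'" "has_vec_derivative_at0 n \<alpha> \<alpha>'" "has_vec_derivative_at0 n \<beta> \<beta>'"
  shows "((\<lambda>t. bil n (G t) (\<alpha> t) (\<beta> t)) has_real_derivative
    bil n G' (\<alpha> 0) (\<beta> 0) + bil n (G 0) \<alpha>' (\<beta> 0) + bil n (G 0) (\<alpha> 0) \<beta>') (at 0)"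
  unfolding bil_def sum.distrib[symmetric]
  using assms unfolding has_mat_derivative_at0_def has_vec_derivative_at0_def
  by (auto intro!: derivative_eq_intros simp: algebra_simps)

lemma const_vec_derivative: "v \<in> carrier_vec n \<Longrightarrow> has_vec_derivative_at0 n (\<lambda>t. v) (0\<^sub>v n)"
  by (auto simp: has_vec_derivative_at0_def)

lemma bil_zero_right[simp]: "bil n A v (0\<^sub>v n) = 0" by (simp add: bil_def)
lemma bil_zero_left[simp]: "bil n A (0\<^sub>v n) v = 0" by (simp add: bil_def)

lemma bil_unit_vec: "i < n \<Longrightarrow> k < n \<Longrightarrow> bil n A (unit_vec n i) (unit_vec n k) = A $$ (i,k)"
proof -
  assume ik: "i < n" "k < n"
  have "bil n A (unit_vec n i) (unit_vec n k) = (\<Sum>i'<n. \<Sum>k'<n. if k' = k then (if i' = i then A $$ (i',k') else 0) else 0)"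
    unfolding bil_def by (intro sum.cong refl) (auto simp: unit_vec_def)
  also have "\<dots> = A $$ (i,k)" using ik by (simp add: sum.delta)
  finally show ?thesis .
qed

lemma emp_grad_derivative:
  assumes X: "X \<in> carrier_mat n n" and \<gamma>: "has_mat_derivative_at0 n \<gamma> \<xi>"
    and ev: "\<forall>\<^sub>F t in nhds 0. \<gamma> t \<in> carrier_mat n n"
  shows "has_mat_derivative_at0 n (\<lambda>t. emp_grad n m a (quad n a (\<gamma> t - X))) (emp_grad n m a (quad n a \<xi>))"
proof -
  have "((\<lambda>t. emp_grad n m a (quad n a (\<gamma> t - X)) $$ (i,k)) has_real_derivative emp_grad n m a (quad n a \<xi>) $$ (i,k)) (at 0)"
    if ik: "i < n" "k < n" for i k
  proof -
    have q: "((\<lambda>t. bil n (\<gamma> t) (a j) (a j) - quad n a X j) has_real_derivative quad n a \<xi> j) (at 0)" for j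
      unfolding bil_def quad_def using \<gamma> unfolding has_mat_derivative_at0_def
      by (auto intro!: derivative_eq_intros)
    have "((\<lambda>t. 1 / real m * (\<Sum>j<m. (bil n (\<gamma> t) (a j) (a j) - quad n a X j) * (vec_index (a j) i * vec_index (a j) k)))
      has_real_derivative 1 / real m * (\<Sum>j<m. quad n a \<xi> j * (vec_index (a j) i * vec_index (a j) k))) (at 0)"
      by (intro DERIV_cmult DERIV_sum DERIV_cmult_right q)
    moreover have "\<forall>\<^sub>F t in nhds 0. emp_grad n m a (quad n a (\<gamma> t - X)) $$ (i,k) =
      1 / real m * (\<Sum>j<m. (bil n (\<gamma> t) (a j) (a j) - quad n a X j) * (vec_index (a j) i * vec_index (a j) k))"
      using ev by eventually_elim (use ik X in \<open>simp add: emp_grad_def quad_diff, simp add: quad_def\<close>)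
    ultimately show ?thesis
      using ik by (subst DERIV_cong_ev[OF refl]) (auto simp: emp_grad_def)
  qed
  then show ?thesis by (simp add: has_mat_derivative_at0_def)
qed

text \<open>Differentiating the trace in the denominator only adds a multiple b of the image itself.
  On the manifold this is a multiple of u, which a critical gradient annihilates, so the value of b
  may stay unspecified.\<close>

lemma normalized_image_derivative:
  assumes \<gamma>: "has_mat_derivative_at0 n \<gamma> \<xi>" and tr: "(\<Sum>l<n. \<gamma> 0 $$ (l,l)) = \<tau>" "\<tau> \<noteq> 0" and v: "v \<in> carrier_vec n"
  obtains b where "has_vec_derivative_at0 n (\<lambda>t. normalized_image n (\<gamma> t) v)
    (Matrix.vec n (\<lambda>i. (\<Sum>l<n. \<xi> $$ (i,l) * vec_index v l) / \<tau> + b * vec_index (normalized_image n (\<gamma> 0) v) i))"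
proof -
  define T where "T = (\<Sum>l<n. \<xi> $$ (l,l))"
  have d: "((\<lambda>t. (\<Sum>l<n. \<gamma> t $$ (i,l) * vec_index v l) / (\<Sum>l<n. \<gamma> t $$ (l,l))) has_real_derivative
    ((\<Sum>l<n. \<xi> $$ (i,l) * vec_index v l) * \<tau> - (\<Sum>l<n. \<gamma> 0 $$ (i,l) * vec_index v l) * T) / (\<tau> * \<tau>)) (at 0)" if i: "i < n" for i
    using \<gamma> i tr unfolding has_mat_derivative_at0_def
    by (auto intro!: derivative_eq_intros simp: T_def)
  have "has_vec_derivative_at0 n (\<lambda>t. normalized_image n (\<gamma> t) v)
    (Matrix.vec n (\<lambda>i. (\<Sum>l<n. \<xi> $$ (i,l) * vec_index v l) / \<tau> + (- T / \<tau>) * vec_index (normalized_image n (\<gamma> 0) v) i))"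
    unfolding has_vec_derivative_at0_def
  proof (intro conjI allI impI)
    fix i assume i: "i < n"
    show "((\<lambda>t. vec_index (normalized_image n (\<gamma> t) v) i) has_real_derivative vec_index
      (Matrix.vec n (\<lambda>i. (\<Sum>l<n. \<xi> $$ (i,l) * vec_index v l) / \<tau> + (- T / \<tau>) * vec_index (normalized_image n (\<gamma> 0) v) i)) i) (at 0)"
      using d[OF i] i tr by (simp add: normalized_image_def diff_divide_distrib mult.commute[of T])
  qed simp
  then show thesis by (rule that)
qed


section \<open>The Hessian at a critical point\<close>

context
  fixes n m :: nat and a :: "nat \<Rightarrow> real Matrix.vec" and X Z :: "real mat" and u :: "real Matrix.vec" and s :: real
  assumes a: "\<And>j. a j \<in> carrier_vec n" and X: "X \<in> carrier_mat n n"
    and u: "u \<in> carrier_vec n" "u \<diamondop> u = 1" and s: "s \<noteq> 0" and Z: "Z = s \<cdot>\<^sub>m outer u u"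
    and crit: "\<And>y. y \<in> carrier_vec n \<Longrightarrow> bil n (emp_grad n m a (quad n a (Z - X))) u y = 0"
begin

abbreviation (input) "G\<^sub>0 \<equiv> emp_grad n m a (quad n a (Z - X))"
abbreviation (input) "G\<^sub>1 y \<equiv> emp_grad n m a (quad n a (sym_outer u y))"

text \<open>The product rule for \<Pi> G + G \<Pi> - \<Pi> G \<Pi> at a critical point:
  \<open>G\<^sub>1 y\<close> comes from differentiating G, the terms with 1/s from differentiating
  \<Pi>, and every term in which \<open>G\<^sub>0\<close> meets u has vanished.\<close>

definition grad_deriv :: "real Matrix.vec \<Rightarrow> real Matrix.vec \<Rightarrow> real Matrix.vec \<Rightarrow> real" where
  "grad_deriv y v w = (u \<diamondop> v) * bil n (G\<^sub>1 y) u w + (u \<diamondop> v) * bil n G\<^sub>0 y w / s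
     + (u \<diamondop> w) * bil n (G\<^sub>1 y) v u + (u \<diamondop> w) * bil n G\<^sub>0 v y / s - (u \<diamondop> v) * (u \<diamondop> w) * bil n (G\<^sub>1 y) u u"

lemma crit': "y \<in> carrier_vec n \<Longrightarrow> bil n G\<^sub>0 y u = 0"
  using crit[of y] bil_sym_grad[of a n y u, OF a _ u(1)] by simp

text \<open>The curve is arbitrary because \<open>cov_deriv\<close> quantifies over all curves with
  the given velocity. The derivative depends on the curve only through that velocity, which is what
  makes the description in \<open>cov_deriv\<close> unambiguous.\<close>

lemma riem_grad_along_curve:
  assumes \<gamma>: "\<forall>\<^sub>F t in nhds 0. \<gamma> t \<in> rank_one_manifold n" "\<gamma> 0 = Z"
    "has_mat_derivative_at0 n \<gamma> (sym_outer u y)"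
    and y: "y \<in> carrier_vec n" and v: "v \<in> carrier_vec n" "w \<in> carrier_vec n"
  shows "((\<lambda>t. bil n (riem_grad n (loss m a X) (\<gamma> t)) v w) has_real_derivative grad_deriv y v w) (at 0)"
proof -
  let ?\<alpha> = "\<lambda>v t. normalized_image n (\<gamma> t) v"
  let ?G = "\<lambda>t. emp_grad n m a (quad n a (\<gamma> t - X))"
  have tr: "(\<Sum>l<n. \<gamma> 0 $$ (l,l)) = s"
    using u s by (simp add: \<gamma>(2) Z scalar_prod_sum[where n=n] flip: sum_distrib_left)
  have \<alpha>0: "?\<alpha> v 0 = (u \<diamondop> v) \<cdot>\<^sub>v u" if "v \<in> carrier_vec n" for v
    using normalized_image_rank_one[OF u s that] by (simp add: \<gamma>(2) Z)
  have \<alpha>Z: "normalized_image n Z v = (u \<diamondop> v) \<cdot>\<^sub>v u" if "v \<in> carrier_vec n" for v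
    using \<alpha>0[OF that] by (simp only: \<gamma>(2))
  have ex: "\<exists>D. has_vec_derivative_at0 n (?\<alpha> v) D \<and> D \<in> carrier_vec n \<and>
     (\<forall>w\<in>carrier_vec n. bil n G\<^sub>0 D w = (u \<diamondop> v) * bil n G\<^sub>0 y w / s \<and> bil n G\<^sub>0 w D = (u \<diamondop> v) * bil n G\<^sub>0 w y / s)"
    if v: "v \<in> carrier_vec n" for v
  proof -
    obtain b where b: "has_vec_derivative_at0 n (?\<alpha> v)
      (Matrix.vec n (\<lambda>i. (\<Sum>l<n. sym_outer u y $$ (i,l) * vec_index v l) / s + b * vec_index (?\<alpha> v 0) i))"
      using normalized_image_derivative[OF \<gamma>(3) tr s v] .
    \<comment> \<open>D splits the derivative of \<Pi> v into a u-part and a y-part. The coefficient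
      c, which contains the unknown b, does not matter because \<open>G\<^sub>0\<close> annihilates
      u; only the multiple (<u,v>/s) y survives.\<close>
    define c where "c = (y \<diamondop> v) / s + b * (u \<diamondop> v)"
    define D where "D = c \<cdot>\<^sub>v u + ((u \<diamondop> v) / s) \<cdot>\<^sub>v y"
    have D: "D \<in> carrier_vec n" using u y by (simp add: D_def)
    have "Matrix.vec n (\<lambda>i. (\<Sum>l<n. sym_outer u y $$ (i,l) * vec_index v l) / s + b * vec_index (?\<alpha> v 0) i) = D"
    proof (rule eq_vecI)
      fix i assume "i < dim_vec D"
      then have i: "i < n" using D by simp
      have "(\<Sum>l<n. sym_outer u y $$ (i,l) * vec_index v l) = (\<Sum>l<n. vec_index u i * (vec_index y l * vec_index v l) + vec_index y i * (vec_index u l * vec_index v l))"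
        using i u y by (intro sum.cong refl) (simp add: algebra_simps)
      also have "\<dots> = vec_index u i * (y \<diamondop> v) + vec_index y i * (u \<diamondop> v)"
        using v by (simp add: scalar_prod_sum[where n=n] sum.distrib sum_distrib_left)
      finally show "vec_index (Matrix.vec n (\<lambda>i. (\<Sum>l<n. sym_outer u y $$ (i,l) * vec_index v l) / s + b * vec_index (?\<alpha> v 0) i)) i = vec_index D i"
        using i u y v s by (simp add: \<alpha>0 D_def c_def field_simps)
    qed (use D in auto)
    with b have "has_vec_derivative_at0 n (?\<alpha> v) D" by simp
    moreover have "bil n G\<^sub>0 D w = (u \<diamondop> v) * bil n G\<^sub>0 y w / s \<and> bil n G\<^sub>0 w D = (u \<diamondop> v) * bil n G\<^sub>0 w y / s"
      if w: "w \<in> carrier_vec n" for w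
      using u y crit[OF w] crit'[OF w] unfolding D_def
      by (simp add: bil_add_left[where n=n] bil_add_right[where n=n] bil_smult_left[where n=n] bil_smult_right[where n=n])
    ultimately show ?thesis using D by blast
  qed
  obtain A where A: "has_vec_derivative_at0 n (?\<alpha> v) A" "A \<in> carrier_vec n"
    "\<And>w. w \<in> carrier_vec n \<Longrightarrow> bil n G\<^sub>0 A w = (u \<diamondop> v) * bil n G\<^sub>0 y w / s"
    using ex[OF v(1)] by blast
  obtain B where B: "has_vec_derivative_at0 n (?\<alpha> w) B" "B \<in> carrier_vec n"
    "\<And>v. v \<in> carrier_vec n \<Longrightarrow> bil n G\<^sub>0 v B = (u \<diamondop> w) * bil n G\<^sub>0 v y / s"
    using ex[OF v(2)] by blast
  have "\<forall>\<^sub>F t in nhds 0. \<gamma> t \<in> carrier_mat n n"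
    using \<gamma>(1) by eventually_elim (simp add: rank_one_manifold_def)
  note Gd = emp_grad_derivative[OF X \<gamma>(3) this, of m a]
  note d1 = bil_has_derivative[OF Gd A(1) const_vec_derivative[OF v(2)]]
  note d2 = bil_has_derivative[OF Gd const_vec_derivative[OF v(1)] B(1)]
  note d3 = bil_has_derivative[OF Gd A(1) B(1)]
  have "((\<lambda>t. bil n (?G t) (?\<alpha> v t) w + bil n (?G t) v (?\<alpha> w t) - bil n (?G t) (?\<alpha> v t) (?\<alpha> w t)) has_real_derivative grad_deriv y v w) (at 0)"
    by (rule DERIV_cong[OF DERIV_diff[OF DERIV_add[OF d1 d2] d3]])
      (simp add: \<gamma>(2) \<alpha>Z[OF v(1)] \<alpha>Z[OF v(2)] A(2) B(2) A(3)[OF v(2)] B(3)[OF v(1)]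
        bil_smult_left[OF u(1)] bil_smult_right[OF u(1)] crit[OF B(2)] crit'[OF A(2)] grad_deriv_def)
  moreover have "\<forall>\<^sub>F t in nhds 0. bil n (riem_grad n (loss m a X) (\<gamma> t)) v w =
    bil n (?G t) (?\<alpha> v t) w + bil n (?G t) v (?\<alpha> w t) - bil n (?G t) (?\<alpha> v t) (?\<alpha> w t)"
    using \<gamma>(1) by eventually_elim (rule bil_riem_grad[OF a X _ v])
  ultimately show ?thesis by (subst DERIV_cong_ev[OF refl _ refl])
qed

text \<open>The Hessian in the coordinates y: the weight 4 <a_j,u>^2 stems from the square of
  <A_j,\<xi>> = 2 <a_j,u> <a_j,y>, the other weight from the curvature term. The latter may use y in
  place of its part v orthogonal to u, since the gradient annihilates u.\<close>

definition hess_form :: "real mat" where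
  "hess_form = emp_grad n m a (\<lambda>j. 2 * quad n a (Z - X) j / s + 4 * (a j \<diamondop> u)\<^sup>2)"

lemma grad_deriv_tangent:
  assumes y: "y \<in> carrier_vec n" "z \<in> carrier_vec n"
  shows "grad_deriv y u z + grad_deriv y z u = bil n hess_form y z"
proof -
  have q: "quad n a (sym_outer u y) j = 2 * ((a j \<diamondop> u) * (a j \<diamondop> y))" for j
    using u y a by (simp add: quad_def bil_sym_outer[OF u(1) y(1) a a] comm_scalar_prod[OF u(1) a] comm_scalar_prod[OF y(1) a])
  have "grad_deriv y u z + grad_deriv y z u = 2 * bil n (G\<^sub>1 y) u z + 2 * bil n G\<^sub>0 y z / s"
    using crit[OF y(1)] crit'[OF y(1)] bil_sym_grad[of a n z u, OF a y(2) u(1)] bil_sym_grad[of a n z y, OF a y(2) y(1)] u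
    by (simp add: grad_deriv_def algebra_simps)
  also have "\<dots> = bil n hess_form y z"
    unfolding hess_form_def bil_emp_grad[of a n, OF a y] bil_emp_grad[of a n, OF a u(1) y(2)] q
    using s by (simp add: sum_distrib_left algebra_simps sum.distrib sum_divide_distrib power2_eq_square add_divide_distrib)
  finally show ?thesis .
qed

text \<open>The description in \<open>cov_deriv\<close> requires that an admissible curve exists and
  that all give the same result. Every admissible curve yields the same pairings with tangent
  vectors, and these determine the projection.\<close>

lemma riem_hess_tangent:
  assumes y: "y \<in> carrier_vec n"
  obtains d where "d \<in> carrier_vec n" "riem_hess n (loss m a X) Z (sym_outer u y) = sym_outer u d"
    "\<And>z. z \<in> carrier_vec n \<Longrightarrow> frob_inner (sym_outer u d) (sym_outer u z) = bil n hess_form y z"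
proof -
  let ?V = "riem_grad n (loss m a X)"
  have inner: "frob_inner W (sym_outer u z) = bil n hess_form y z"
    if "\<forall>\<^sub>F t in nhds 0. \<gamma> t \<in> rank_one_manifold n" "\<gamma> 0 = Z" "has_mat_derivative_at0 n \<gamma> (sym_outer u y)"
      and W: "has_mat_derivative_at0 n (\<lambda>t. ?V (\<gamma> t)) W" and z: "z \<in> carrier_vec n" for \<gamma> W z
  proof -
    have "bil n W v w = grad_deriv y v w" if v: "v \<in> carrier_vec n" "w \<in> carrier_vec n" for v w
      using DERIV_unique[OF bil_has_derivative[OF W const_vec_derivative[OF v(1)] const_vec_derivative[OF v(2)]]
        riem_grad_along_curve[OF \<open>\<forall>\<^sub>F t in nhds 0. \<gamma> t \<in> rank_one_manifold n\<close> \<open>\<gamma> 0 = Z\<close> \<open>has_mat_derivative_at0 n \<gamma> (sym_outer u y)\<close> y v]]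
      by simp
    then show ?thesis
      using W u z grad_deriv_tangent[OF y z]
      by (simp add: has_mat_derivative_at0_def frob_inner_sym_outer[where n=n])
  qed
  \<comment> \<open>The factor 1/s gives s c c^T the velocity u y^T + y u^T at 0. For small t the
    pairing of u with \<open>c t\<close> is positive, so \<open>c t\<close> is nonzero and the curve
    stays on the manifold.\<close>
  define c where "c t = u + (t / s) \<cdot>\<^sub>v y" for t
  define \<gamma> where "\<gamma> t = s \<cdot>\<^sub>m outer (c t) (c t)" for t
  have c: "c t \<in> carrier_vec n" for t using u y by (simp add: c_def)
  have \<gamma>0: "\<gamma> 0 = Z" using u y s by (intro eq_matI) (auto simp: \<gamma>_def c_def Z)
  have "((\<lambda>t. 1 + (t / s) * (u \<diamondop> y)) \<longlongrightarrow> 1 + (0 / s) * (u \<diamondop> y)) (nhds 0)"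
    by (intro tendsto_intros filterlim_ident) (use s in auto)
  then have "\<forall>\<^sub>F t in nhds 0. 1 + (t / s) * (u \<diamondop> y) > 0"
    by (rule order_tendstoD) simp
  then have \<gamma>1: "\<forall>\<^sub>F t in nhds 0. \<gamma> t \<in> rank_one_manifold n"
  proof eventually_elim
    case (elim t)
    have "u \<diamondop> c t = 1 + (t / s) * (u \<diamondop> y)"
      using u y by (simp add: c_def scalar_prod_add_distrib[where n=n])
    then have "c t \<noteq> 0\<^sub>v n" using elim u by auto
    then show ?case unfolding \<gamma>_def by (rule symmetric_rank_one_outer[OF c _ s])
  qed
  have \<gamma>2: "has_mat_derivative_at0 n \<gamma> (sym_outer u y)"
    unfolding has_mat_derivative_at0_def
  proof (intro conjI allI impI)
    fix i k assume ik: "i < n" "k < n"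
    have "((\<lambda>t. s * ((vec_index u i + (t / s) * vec_index y i) * (vec_index u k + (t / s) * vec_index y k)))
      has_real_derivative sym_outer u y $$ (i,k)) (at 0)"
      using s u y ik by (auto intro!: derivative_eq_intros simp: field_simps)
    then show "((\<lambda>t. \<gamma> t $$ (i,k)) has_real_derivative sym_outer u y $$ (i,k)) (at 0)"
      using u y ik by (simp add: \<gamma>_def c_def)
  qed (use u y in simp)
  define W where "W = Matrix.mat n n (\<lambda>(i,k). grad_deriv y (unit_vec n i) (unit_vec n k))"
  have Wd: "has_mat_derivative_at0 n (\<lambda>t. ?V (\<gamma> t)) W"
    unfolding has_mat_derivative_at0_def
  proof (intro conjI allI impI)
    fix i k assume ik: "i < n" "k < n"
    show "((\<lambda>t. ?V (\<gamma> t) $$ (i,k)) has_real_derivative W $$ (i,k)) (at 0)"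
      using riem_grad_along_curve[OF \<gamma>1 \<gamma>0 \<gamma>2 y, of "unit_vec n i" "unit_vec n k"] ik
      by (simp add: bil_unit_vec W_def)
  qed (simp add: W_def)
  define d where "d = tangent_coord n u W"
  have T: "tangent_space n Z = sym_outer u ` carrier_vec n"
    using tangent_space_rank_one[OF u s] by (simp add: Z)
  have Wc: "W \<in> carrier_mat n n" by (simp add: W_def)
  have dW: "orth_proj (tangent_space n Z) W = sym_outer u d"
    unfolding T d_def by (rule orth_proj_tangent[OF u Wc])
  have din: "frob_inner (sym_outer u d) (sym_outer u z) = bil n hess_form y z" if "z \<in> carrier_vec n" for z
    using sym_outer_tangent_coord_inner[OF u Wc that] inner[OF \<gamma>1 \<gamma>0 \<gamma>2 Wd that] by (simp add: d_def)
  have "riem_hess n (loss m a X) Z (sym_outer u y) = sym_outer u d"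
    unfolding riem_hess_def cov_deriv_def
  proof (rule the_equality)
    show "\<exists>\<gamma> W. (\<forall>\<^sub>F t in nhds 0. \<gamma> t \<in> rank_one_manifold n) \<and> \<gamma> 0 = Z \<and>
      has_mat_derivative_at0 n \<gamma> (sym_outer u y) \<and> has_mat_derivative_at0 n (\<lambda>t. ?V (\<gamma> t)) W \<and>
      sym_outer u d = orth_proj (tangent_space n Z) W"
      using \<gamma>1 \<gamma>0 \<gamma>2 Wd dW[symmetric] by blast
  next
    fix D assume "\<exists>\<gamma> W. (\<forall>\<^sub>F t in nhds 0. \<gamma> t \<in> rank_one_manifold n) \<and> \<gamma> 0 = Z \<and>
      has_mat_derivative_at0 n \<gamma> (sym_outer u y) \<and> has_mat_derivative_at0 n (\<lambda>t. ?V (\<gamma> t)) W \<and>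
      D = orth_proj (tangent_space n Z) W"
    then obtain \<gamma>' W' where h: "\<forall>\<^sub>F t in nhds 0. \<gamma>' t \<in> rank_one_manifold n" "\<gamma>' 0 = Z"
      "has_mat_derivative_at0 n \<gamma>' (sym_outer u y)" "has_mat_derivative_at0 n (\<lambda>t. ?V (\<gamma>' t)) W'"
      "D = orth_proj (tangent_space n Z) W'" by blast
    have "W' \<in> carrier_mat n n" using h(4) by (simp add: has_mat_derivative_at0_def)
    then show "D = sym_outer u d" unfolding h(5) T
      by (rule orth_proj_eqI[OF u]) (use inner[OF h(1-4)] din in \<open>auto simp: d_def\<close>)
  qed
  then show thesis using that[of d] din by (simp add: d_def)
qed

text \<open>The least generalised eigenvalue of \<open>hess_form\<close> relative to the Gram matrix
  N is attained and is the least eigenvalue of the Hessian, so the LEAST in the definition is a true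
  minimum. Every Rayleigh quotient is then an upper bound for it.\<close>

lemma lambda_min_hess_le:
  assumes y: "y \<in> carrier_vec n" "y \<noteq> 0\<^sub>v n"
  shows "lambda_min_hess n (loss m a X) Z \<le> bil n hess_form y y / (2 * (y \<diamondop> y) + 2 * (u \<diamondop> y)\<^sup>2)"
proof -
  define N where "N = Matrix.mat n n (\<lambda>(i,k). (if i = k then 2 else 0) + 2 * (vec_index u i * vec_index u k))"
  have N: "bil n N v w = 2 * (v \<diamondop> w) + 2 * ((u \<diamondop> v) * (u \<diamondop> w))" if "v \<in> carrier_vec n" "w \<in> carrier_vec n" for v w
  proof -
    have "bil n N v w = (\<Sum>i<n. \<Sum>k<n. (if i = k then 2 * (vec_index v i * vec_index w k) else 0) + 2 * ((vec_index u i * vec_index v i) * (vec_index u k * vec_index w k)))"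
      unfolding bil_def N_def by (intro sum.cong refl) (simp add: algebra_simps)
    also have "\<dots> = 2 * (v \<diamondop> w) + 2 * ((u \<diamondop> v) * (u \<diamondop> w))"
      using that u by (simp add: sum.distrib sum.delta' scalar_prod_sum[where n=n] sum_product) (simp add: sum_distrib_left)
    finally show ?thesis .
  qed
  have NT: "frob_inner (sym_outer u v) (sym_outer u w) = bil n N v w" if "v \<in> carrier_vec n" "w \<in> carrier_vec n" for v w
    using sym_outer_inner[OF u that] N[OF that] by simp
  have n: "n > 0" using y by (cases n) (auto intro!: eq_vecI)
  have pos: "bil n N v v > 0" if "v \<in> carrier_vec n" "v \<noteq> 0\<^sub>v n" for v
    using N[OF that(1) that(1)] scalar_prod_self_pos[OF that] by (simp add: add_pos_nonneg)
  have symH: "bil n hess_form v w = bil n hess_form w v" if "v \<in> carrier_vec n" "w \<in> carrier_vec n" for v w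
    unfolding hess_form_def by (rule bil_sym_grad[of a n, OF a that])
  have symN: "bil n N v w = bil n N w v" if "v \<in> carrier_vec n" "w \<in> carrier_vec n" for v w
    using N[OF that] N[OF that(2,1)] comm_scalar_prod[OF that] comm_scalar_prod[OF u(1)] by (simp add: mult.commute)
  obtain \<mu> y0 where y0: "y0 \<in> carrier_vec n" "y0 \<noteq> 0\<^sub>v n"
    "\<And>y. y \<in> carrier_vec n \<Longrightarrow> bil n hess_form y0 y = \<mu> * bil n N y0 y"
    "\<And>y. y \<in> carrier_vec n \<Longrightarrow> bil n hess_form y y \<ge> \<mu> * bil n N y y"
    using generalized_eigenvector_min[OF n pos symH symN] by blast
  have T: "tangent_space n Z = sym_outer u ` carrier_vec n"
    using tangent_space_rank_one[OF u s] by (simp add: Z)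
  have "lambda_min_hess n (loss m a X) Z = \<mu>"
    unfolding lambda_min_hess_def
  proof (rule Least_equality)
    obtain d where d: "d \<in> carrier_vec n" "riem_hess n (loss m a X) Z (sym_outer u y0) = sym_outer u d"
      "\<And>z. z \<in> carrier_vec n \<Longrightarrow> frob_inner (sym_outer u d) (sym_outer u z) = bil n hess_form y0 z"
      using riem_hess_tangent[OF y0(1)] by blast
    \<comment> \<open>d and \<mu> y0 have the same N-pairing with their difference e, so e is
      N-orthogonal to itself and vanishes by definiteness.\<close>
    define e where "e = d - \<mu> \<cdot>\<^sub>v y0"
    have e: "e \<in> carrier_vec n" using d(1) y0(1) by (simp add: e_def)
    have "bil n N d e = \<mu> * bil n N y0 e" using d(3)[OF e] y0(3)[OF e] NT[OF d(1) e] by simp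
    moreover have "bil n N d e = bil n N e e + \<mu> * bil n N y0 e"
    proof -
      have "d = e + \<mu> \<cdot>\<^sub>v y0" using d(1) y0(1) by (intro eq_vecI) (auto simp: e_def)
      then have "bil n N d e = bil n N (e + \<mu> \<cdot>\<^sub>v y0) e" by simp
      then show ?thesis using e y0(1) by (simp add: bil_add_left[where n=n] bil_smult_left[where n=n])
    qed
    ultimately have "e = 0\<^sub>v n" using pos[OF e] by force
    then have de: "vec_index d i = \<mu> * vec_index y0 i" if "i < n" for i
      using that d(1) y0(1) by (metis e_def carrier_vecD index_minus_vec(1) index_smult_vec index_zero_vec(1) eq_iff_diff_eq_0)
    have "sym_outer u d = \<mu> \<cdot>\<^sub>m sym_outer u y0"
      using u d(1) y0(1) by (intro eq_matI) (auto simp: sym_outer_def de algebra_simps)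
    moreover have "sym_outer u y0 \<noteq> 0\<^sub>m n n"
    proof
      assume z: "sym_outer u y0 = 0\<^sub>m n n"
      have "frob_inner (0\<^sub>m n n) (0\<^sub>m n n) = 0" by (subst frob_inner_sum[where n=n]) auto
      then show False using NT[OF y0(1) y0(1)] pos[OF y0(1,2)] z by simp
    qed
    ultimately show "\<exists>\<xi>\<in>tangent_space n Z. \<xi> \<noteq> 0\<^sub>m n n \<and> riem_hess n (loss m a X) Z \<xi> = \<mu> \<cdot>\<^sub>m \<xi>"
      unfolding T using d(2) y0(1) by (intro bexI[of _ "sym_outer u y0"]) auto
  next
    fix \<nu> assume "\<exists>\<xi>\<in>tangent_space n Z. \<xi> \<noteq> 0\<^sub>m n n \<and> riem_hess n (loss m a X) Z \<xi> = \<nu> \<cdot>\<^sub>m \<xi>"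
    then obtain v where v: "v \<in> carrier_vec n" "sym_outer u v \<noteq> 0\<^sub>m n n"
      "riem_hess n (loss m a X) Z (sym_outer u v) = \<nu> \<cdot>\<^sub>m sym_outer u v" unfolding T by auto
    have v0: "v \<noteq> 0\<^sub>v n"
    proof
      assume "v = 0\<^sub>v n"
      then have "sym_outer u v = 0\<^sub>m n n" using u by (intro eq_matI) (auto simp: sym_outer_def)
      then show False using v by simp
    qed
    obtain d where d: "d \<in> carrier_vec n" "riem_hess n (loss m a X) Z (sym_outer u v) = sym_outer u d"
      "\<And>z. z \<in> carrier_vec n \<Longrightarrow> frob_inner (sym_outer u d) (sym_outer u z) = bil n hess_form v z"
      using riem_hess_tangent[OF v(1)] by blast
    have sv: "sym_outer u v \<in> carrier_mat n n" using u v by simp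
    have "bil n hess_form v v = frob_inner (\<nu> \<cdot>\<^sub>m sym_outer u v) (sym_outer u v)"
      using d(2,3) v by simp
    also have "\<dots> = \<nu> * bil n N v v"
      using sv frob_inner_commute[of "\<nu> \<cdot>\<^sub>m sym_outer u v" n "sym_outer u v"] NT[OF v(1) v(1)]
      by (simp add: frob_inner_smult_right[where n=n])
    finally have "\<mu> * bil n N v v \<le> \<nu> * bil n N v v" using y0(4)[OF v(1)] by simp
    then show "\<mu> \<le> \<nu>" using pos[OF v(1) v0] by simp
  qed
  then show ?thesis
    using y0(4)[OF y(1)] pos[OF y] N[OF y(1) y(1)] by (simp add: pos_le_divide_eq power2_eq_square)
qed

end

section \<open>Landscape on the good event\<close>

definition emp_mean :: "nat \<Rightarrow> (nat \<Rightarrow> real) \<Rightarrow> real" where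
  "emp_mean m f = 1 / real m * (\<Sum>j<m. f j)"

lemma emp_mean_mono: "(\<And>j. f j \<le> g j) \<Longrightarrow> emp_mean m f \<le> emp_mean m g"
  unfolding emp_mean_def by (intro mult_left_mono sum_mono) auto

lemma emp_mean_add: "emp_mean m (\<lambda>j. f j + g j) = emp_mean m f + emp_mean m g"
  by (simp add: emp_mean_def sum.distrib add_divide_distrib)

lemma emp_mean_diff: "emp_mean m (\<lambda>j. f j - g j) = emp_mean m f - emp_mean m g"
  by (simp add: emp_mean_def sum_subtractf diff_divide_distrib)

lemma emp_mean_cmult: "emp_mean m (\<lambda>j. c * f j) = c * emp_mean m f"
  by (simp add: emp_mean_def sum_distrib_left)

lemma emp_mean_const: "m > 0 \<Longrightarrow> emp_mean m (\<lambda>j. c) = c"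
  by (simp add: emp_mean_def)

lemma emp_mean_nonneg: "(\<And>j. 0 \<le> f j) \<Longrightarrow> 0 \<le> emp_mean m f"
  unfolding emp_mean_def by (intro mult_nonneg_nonneg sum_nonneg) auto

lemma emp_mean_Cauchy_Schwarz:
  "(emp_mean m (\<lambda>j. f j * g j))\<^sup>2 \<le> emp_mean m (\<lambda>j. (f j)\<^sup>2) * emp_mean m (\<lambda>j. (g j)\<^sup>2)"
proof -
  have "(\<Sum>j<m. f j * g j)\<^sup>2 \<le> (\<Sum>j<m. (f j)\<^sup>2) * (\<Sum>j<m. (g j)\<^sup>2)"
    by (rule Cauchy_Schwarz_ineq_sum)
  then have "1 / real m * (1 / real m) * (\<Sum>j<m. f j * g j)\<^sup>2 \<le> 1 / real m * (1 / real m) * ((\<Sum>j<m. (f j)\<^sup>2) * (\<Sum>j<m. (g j)\<^sup>2))"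
    by (rule mult_left_mono) simp
  then show ?thesis by (simp add: emp_mean_def power2_eq_square mult_ac)
qed

text \<open>\<open>S4\<close> enters only through a lower bound, which by r \<open>S4\<close> =
  \<open>S2\<close> turns into an upper bound for r. The target -2(2 + 2c^2) is -2 times the squared
  norm of the direction later inserted into the Hessian.\<close>

lemma critical_moment_dichotomy:
  fixes S0 S1 S2 S3 S4 c r \<epsilon> \<eta> :: real
  assumes \<eta>: "0 < \<eta>" "\<eta> \<le> 1/10" "\<epsilon> = \<eta> / 1000" and c: "\<bar>c\<bar> \<le> 1" and r: "r \<noteq> 0"
    and S: "S0 \<ge> 3 - \<epsilon>" "\<bar>S2 - (1 + 2 * c\<^sup>2)\<bar> \<le> \<epsilon>" "S4 \<ge> 3 - \<epsilon>" "\<bar>S1\<bar> \<ge> 3 * \<bar>c\<bar> - 3 * \<epsilon>"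
    and crit: "r * S4 = S2" "r * S3 = S1" and CS: "S3\<^sup>2 \<le> S4 * S2"
  shows "r > 0 \<and> (6 * S2 - 2 * S0 / r \<le> - 2 * (2 + 2 * c\<^sup>2) \<or> (1 - \<eta> \<le> c\<^sup>2 \<and> \<bar>r - 1\<bar> \<le> \<eta>))"
proof -
  have \<epsilon>: "0 < \<epsilon>" "\<epsilon> \<le> 1/10000" using \<eta> by auto
  define t where "t = c\<^sup>2"
  have t: "0 \<le> t" "t \<le> 1" using c by (auto simp: t_def abs_square_le_1)
  have S2: "1 + 2 * t - \<epsilon> \<le> S2" "S2 \<le> 1 + 2 * t + \<epsilon>" using S(2) by (auto simp: t_def abs_le_iff)
  have S2p: "S2 > 0" and S4p: "S4 > 0" using S2 t \<epsilon> S by auto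
  have rp: "r > 0" using crit(1) S2p S4p by (metis zero_less_mult_pos2)
  have r_eq: "r = S2 / S4" using crit(1) S4p by (simp add: field_simps)
  have r_up: "r \<le> S2 / (3 - \<epsilon>)" unfolding r_eq using S(3) S2p \<epsilon> by (intro divide_left_mono) auto
  have "S1\<^sup>2 = r\<^sup>2 * S3\<^sup>2" by (simp add: crit(2)[symmetric] power_mult_distrib)
  also have "\<dots> \<le> r\<^sup>2 * (S4 * S2)" by (intro mult_left_mono CS) simp
  also have "\<dots> = r * S2\<^sup>2" using crit(1) by (simp add: power2_eq_square)
  finally have S1r: "S1\<^sup>2 \<le> r * S2\<^sup>2" .
  show ?thesis
  \<comment> \<open>The positive root of 8 t^2 + 20 t - 1 lies slightly below 1/18, so beyond this
    threshold the quadratic is at least 1/9 and can be divided out.\<close>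
  proof (cases "t \<le> 1/18")
    case True
    have "2 * S0 / r \<ge> 2 * (3 - \<epsilon>) / r" using S(1) rp by (intro divide_right_mono) auto
    moreover have "2 * (3 - \<epsilon>) / r \<ge> 2 * (3 - \<epsilon>) / (S2 / (3 - \<epsilon>))"
      using r_up rp \<epsilon> S2p by (intro divide_left_mono) auto
    moreover have "2 * (3 - \<epsilon>) / (S2 / (3 - \<epsilon>)) = 2 * (3 - \<epsilon>)\<^sup>2 / S2" by (simp add: power2_eq_square)
    moreover have "(3 - \<epsilon>)\<^sup>2 \<ge> (29/10)\<^sup>2" using \<epsilon> by (intro power_mono) auto
    \<comment> \<open>At t = 1/18 the value without errors is 18/(10/9) = 16.2. The bound 14 leaves
      room for the errors and still exceeds 6 \<open>S2\<close> + 4 + 4t, which is about 10.9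
      there.\<close>
    moreover have "2 * (3 - \<epsilon>)\<^sup>2 / S2 \<ge> 14"
    proof -
      have "14 * S2 \<le> 2 * (29/10)\<^sup>2" using S2 True \<epsilon> by (simp add: power2_eq_square)
      also have "\<dots> \<le> 2 * (3 - \<epsilon>)\<^sup>2" using \<open>(3 - \<epsilon>)\<^sup>2 \<ge> (29/10)\<^sup>2\<close> by simp
      finally show ?thesis using S2p by (simp add: pos_le_divide_eq)
    qed
    ultimately have "2 * S0 / r \<ge> 14" by linarith
    then have "6 * S2 - 2 * S0 / r \<le> - 2 * (2 + 2 * c\<^sup>2)" using S2 True \<epsilon> by (simp add: t_def)
    then show ?thesis using rp by blast
  next
    case False
    have "\<bar>c\<bar> \<ge> \<epsilon>"
    proof (rule ccontr)
      assume "\<not> ?thesis"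
      then have "\<bar>c\<bar>\<^sup>2 \<le> (1/10)\<^sup>2" using \<epsilon> by (intro power_mono) auto
      then show False using False by (simp add: t_def power2_eq_square)
    qed
    then have "(3 * \<bar>c\<bar> - 3 * \<epsilon>)\<^sup>2 \<le> \<bar>S1\<bar>\<^sup>2" using S(4) by (intro power_mono) auto
    moreover have "(3 * \<bar>c\<bar> - 3 * \<epsilon>)\<^sup>2 = 9 * t - 18 * (\<epsilon> * \<bar>c\<bar>) + 9 * \<epsilon>\<^sup>2"
      by (simp add: t_def power2_eq_square algebra_simps flip: abs_mult)
    moreover have "\<epsilon> * \<bar>c\<bar> \<le> \<epsilon> * 1" using c \<epsilon> by (intro mult_left_mono) auto
    ultimately have S1: "9 * t - 18 * \<epsilon> \<le> S1\<^sup>2" using zero_le_power2[of \<epsilon>] unfolding power2_abs by linarith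
    have "S2\<^sup>2 \<le> (1 + 2 * t + \<epsilon>)\<^sup>2" using S2 S2p by (intro power_mono) auto
    \<comment> \<open>Multiplying by the lower bound for \<open>S4\<close> and using r
      \<open>S4\<close> = \<open>S2\<close> eliminates r and \<open>S4\<close> together, without an
      upper bound for a quartic mean.\<close>
    have "S1\<^sup>2 * (3 - \<epsilon>) \<le> r * S2\<^sup>2 * S4"
      using S1r S(3) \<epsilon> rp by (intro mult_mono) auto
    also have "\<dots> = S2 ^ 3" using crit(1) by (simp add: power2_eq_square power3_eq_cube)
    also have "\<dots> \<le> (1 + 2 * t + \<epsilon>) ^ 3" using S2 S2p by (intro power_mono) auto
    finally have 1: "S1\<^sup>2 * (3 - \<epsilon>) \<le> (1 + 2 * t + \<epsilon>) ^ 3" .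
    have 2: "(9 * t - 18 * \<epsilon>) * (3 - \<epsilon>) \<le> S1\<^sup>2 * (3 - \<epsilon>)" using S1 \<epsilon> by (intro mult_right_mono) auto
    have 3: "(1 + 2 * t + \<epsilon>) ^ 3 = (1 + 2 * t) ^ 3 + \<epsilon> * (3 * (1 + 2 * t)\<^sup>2 + 3 * (1 + 2 * t) * \<epsilon> + \<epsilon>\<^sup>2)"
      by (simp add: power2_eq_square power3_eq_cube algebra_simps)
    have "(1 + 2 * t)\<^sup>2 \<le> 3\<^sup>2" using t by (intro power_mono) auto
    moreover have "\<epsilon>\<^sup>2 \<le> 1\<^sup>2" using \<epsilon> by (intro power_mono) auto
    moreover have "(1 + 2 * t) * \<epsilon> \<le> 3 * (1/10000)" using t \<epsilon> by (intro mult_mono) auto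
    ultimately have "3 * (1 + 2 * t)\<^sup>2 + 3 * (1 + 2 * t) * \<epsilon> + \<epsilon>\<^sup>2 \<le> 37"
      unfolding mult.assoc by simp
    then have 4: "\<epsilon> * (3 * (1 + 2 * t)\<^sup>2 + 3 * (1 + 2 * t) * \<epsilon> + \<epsilon>\<^sup>2) \<le> \<epsilon> * 37" using \<epsilon> by (intro mult_left_mono) auto
    have "t * \<epsilon> \<le> 1 * \<epsilon>" using t \<epsilon> by (intro mult_right_mono) auto
    moreover have "(9 * t - 18 * \<epsilon>) * (3 - \<epsilon>) = 27 * t - 9 * (t * \<epsilon>) - 54 * \<epsilon> + 18 * (\<epsilon> * \<epsilon>)"
      by (simp add: algebra_simps)
    moreover have "0 \<le> \<epsilon> * \<epsilon>" by simp
    ultimately have "27 * t - (1 + 2 * t) ^ 3 \<le> 100 * \<epsilon>"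
      using 1 2 3 4 by linarith
    moreover have "27 * t - (1 + 2 * t) ^ 3 = (1 - t) * (8 * t\<^sup>2 + 20 * t - 1)"
      by (simp add: power2_eq_square power3_eq_cube algebra_simps)
    moreover have "8 * t\<^sup>2 + 20 * t - 1 \<ge> 1/9" using False zero_le_power2[of t] by linarith
    then have "(1 - t) * (8 * t\<^sup>2 + 20 * t - 1) \<ge> (1 - t) * (1/9)" using t by (intro mult_left_mono) auto
    ultimately have t1: "1 - t \<le> 900 * \<epsilon>" by simp
    have "S2 / (3 - \<epsilon>) \<le> 1 + \<epsilon>"
    proof -
      have "\<epsilon> * \<epsilon> \<le> \<epsilon> * 1" using \<epsilon> by (intro mult_left_mono) auto
      moreover have "(1 + \<epsilon>) * (3 - \<epsilon>) = 3 + 2 * \<epsilon> - \<epsilon> * \<epsilon>" by (simp add: algebra_simps)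
      ultimately have "S2 \<le> (1 + \<epsilon>) * (3 - \<epsilon>)" using S2 t by linarith
      then show ?thesis using \<epsilon> by (simp add: divide_le_eq)
    qed
    then have r1: "r \<le> 1 + \<epsilon>" using r_up by simp
    \<comment> \<open>For t near 1 the inequality between the square of \<open>S1\<close> and r
      times the square of \<open>S2\<close> reads 9 \<le> 9 r up to errors, which bounds r from
      below.\<close>
    have "S2\<^sup>2 \<le> (3 + \<epsilon>)\<^sup>2" using S2 S2p t by (intro power_mono) auto
    also have "\<dots> \<le> 9 + 7 * \<epsilon>" using \<epsilon> by (simp add: power2_eq_square algebra_simps)
    finally have "r * S2\<^sup>2 \<le> r * (9 + 7 * \<epsilon>)" using rp by (intro mult_left_mono) auto
    then have "9 * (1 - 900 * \<epsilon>) - 18 * \<epsilon> \<le> r * (9 + 7 * \<epsilon>)" using S1 S1r t1 by simp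
    moreover have "r * \<epsilon> \<le> 2 * \<epsilon>" using r1 \<epsilon> by (intro mult_right_mono) auto
    then have "r * (9 + 7 * \<epsilon>) \<le> 9 * r + 14 * \<epsilon>" by (simp add: algebra_simps)
    moreover have "9 * (1 - 900 * \<epsilon>) = 9 - 8100 * \<epsilon>" by simp
    ultimately have "9 - 8100 * \<epsilon> - 18 * \<epsilon> \<le> 9 * r + 14 * \<epsilon>" by linarith
    then have "r \<ge> 1 - 1000 * \<epsilon>" using \<epsilon> by simp
    then show ?thesis using rp t1 r1 \<eta> \<epsilon> by (auto simp: t_def abs_le_iff)
  qed
qed

text \<open>With p = <a,x>, k = <a,v> and z = x + \<tau> v, the left side times \<tau>^2 is one
  summand of the gradient at z paired with z - x. The right side is built for the available
  estimates: the plain product p^2 k^2 appears with a negative sign and needs only an upper bound,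
  while the truncated product supplies the lower one.\<close>

lemma truncated_curvature_bound:
  fixes p k \<tau> L :: real
  assumes "0 \<le> \<tau>" "0 \<le> L"
  shows "k\<^sup>2 * ((2 * p + \<tau> * k) * (p + \<tau> * k)) \<ge> 3 * (min (p\<^sup>2) L * min (k\<^sup>2) L) - p\<^sup>2 * k\<^sup>2 - 48 * \<tau> * L\<^sup>2"
proof -
  define M where "M = min (p\<^sup>2) L * min (k\<^sup>2) L"
  have M1: "M \<le> p\<^sup>2 * k\<^sup>2" unfolding M_def using assms by (intro mult_mono) auto
  have sq: "(2 * p + \<tau> * k) * (p + \<tau> * k) \<ge> - (p\<^sup>2 / 4)"
  proof -
    have "(2 * p + \<tau> * k) * (p + \<tau> * k) = (\<tau> * k + 3/2 * p)\<^sup>2 - p\<^sup>2 / 4"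
      by (simp add: power2_eq_square algebra_simps)
    then show ?thesis by simp
  qed
  show ?thesis
  \<comment> \<open>Below 4L the cubic term is at most 3 \<tau> (4L)^2 = 48 \<tau> L^2. Above 4L the
    truncation loses a factor 4, so three times the truncated product is at most 3/4 p^2 k^2, which
    matches the bound -p^2 k^2 / 4 from completing the square.\<close>
  proof (cases "k\<^sup>2 \<le> 4 * L \<and> p\<^sup>2 \<le> 4 * L")
    case True
    have "(\<bar>p\<bar> * \<bar>k\<bar>) \<le> 4 * L"
    proof -
      have "2 * (\<bar>p\<bar> * \<bar>k\<bar>) \<le> \<bar>p\<bar>\<^sup>2 + \<bar>k\<bar>\<^sup>2" using sum_squares_bound[of "\<bar>p\<bar>" "\<bar>k\<bar>"] by simp
      then show ?thesis using True by simp
    qed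
    then have "(\<bar>p\<bar> * \<bar>k\<bar>) * k\<^sup>2 \<le> (4 * L) * (4 * L)" using True assms by (intro mult_mono[of "\<bar>p\<bar> * \<bar>k\<bar>" "4 * L"]) auto
    then have "\<tau> * ((\<bar>p\<bar> * \<bar>k\<bar>) * k\<^sup>2) \<le> \<tau> * (16 * L\<^sup>2)" using assms by (intro mult_left_mono) (auto simp: power2_eq_square)
    moreover have "- (p * k) * k\<^sup>2 \<le> (\<bar>p\<bar> * \<bar>k\<bar>) * k\<^sup>2"
      by (intro mult_right_mono) (auto simp: abs_mult[symmetric])
    then have "\<tau> * (- (p * k) * k\<^sup>2) \<le> \<tau> * ((\<bar>p\<bar> * \<bar>k\<bar>) * k\<^sup>2)" using assms by (intro mult_left_mono) auto
    ultimately have "\<tau> * (p * k) * k\<^sup>2 \<ge> - 16 * \<tau> * L\<^sup>2" by simp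
    moreover have "k\<^sup>2 * ((2 * p + \<tau> * k) * (p + \<tau> * k)) = 2 * (p\<^sup>2 * k\<^sup>2) + 3 * (\<tau> * (p * k) * k\<^sup>2) + (\<tau> * k\<^sup>2)\<^sup>2"
      by (simp add: power2_eq_square algebra_simps)
    ultimately show ?thesis using M1 zero_le_power2[of "\<tau> * k\<^sup>2"] unfolding M_def[symmetric] by linarith
  next
    case False
    have "4 * M \<le> p\<^sup>2 * k\<^sup>2"
    proof (cases "k\<^sup>2 > 4 * L")
      case True
      have "M \<le> p\<^sup>2 * (k\<^sup>2 / 4)" unfolding M_def using assms True by (intro mult_mono) auto
      then show ?thesis by simp
    next
      case F: False
      then have "p\<^sup>2 > 4 * L" using False by auto
      then have "M \<le> (p\<^sup>2 / 4) * k\<^sup>2" unfolding M_def using assms by (intro mult_mono) auto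
      then show ?thesis by simp
    qed
    moreover have "k\<^sup>2 * ((2 * p + \<tau> * k) * (p + \<tau> * k)) \<ge> k\<^sup>2 * (- (p\<^sup>2 / 4))"
      using sq by (intro mult_left_mono) auto
    moreover have "0 \<le> \<tau> * L\<^sup>2" using assms by simp
    moreover have "k\<^sup>2 * (- (p\<^sup>2 / 4)) = - (p\<^sup>2 * k\<^sup>2) / 4" by simp
    ultimately show ?thesis unfolding M_def[symmetric] mult.assoc by linarith
  qed
qed


text \<open>\<open>L\<close> truncates the squares. The two-sided control of the second moments comes with a tiny error
  \<open>\<epsilon>\<close>, whereas the truncated lower bound is only needed with the fixed error \<open>1/8\<close>.\<close>

definition good_sample :: "nat \<Rightarrow> nat \<Rightarrow> real \<Rightarrow> real \<Rightarrow> (nat \<Rightarrow> real Matrix.vec) \<Rightarrow> real Matrix.vec \<Rightarrow> bool" where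
  "good_sample n m \<epsilon> L a x \<longleftrightarrow> (\<forall>v\<in>carrier_vec n. v \<diamondop> v = 1 \<longrightarrow>
     emp_mean m (\<lambda>j. (a j \<diamondop> x)\<^sup>2 * (a j \<diamondop> v)\<^sup>2) \<le> 1 + 2 * (v \<diamondop> x)\<^sup>2 + \<epsilon> \<and>
     emp_mean m (\<lambda>j. (a j \<diamondop> x)\<^sup>2 * (a j \<diamondop> v)\<^sup>2) \<ge> 1 + 2 * (v \<diamondop> x)\<^sup>2 - \<epsilon> \<and>
     emp_mean m (\<lambda>j. (a j \<diamondop> v) ^ 4) \<ge> 3 - \<epsilon> \<and>
     emp_mean m (\<lambda>j. min ((a j \<diamondop> x)\<^sup>2) L * min ((a j \<diamondop> v)\<^sup>2) L) \<ge> 1 + 2 * (v \<diamondop> x)\<^sup>2 - 1/8)"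

lemma scalar_prod_sub_self:
  fixes u x :: "real Matrix.vec"
  assumes "u \<in> carrier_vec n" "x \<in> carrier_vec n"
  shows "(u - x) \<diamondop> (u - x) = u \<diamondop> u - 2 * (u \<diamondop> x) + x \<diamondop> x"
  using assms comm_scalar_prod[of u n x]
  by (simp add: minus_scalar_prod_distrib[where n=n] scalar_prod_minus_distrib[where n=n])

lemma unit_vec_normalize:
  fixes h :: "real Matrix.vec"
  assumes "h \<in> carrier_vec n" "h \<noteq> 0\<^sub>v n"
  obtains \<tau> v where "\<tau> > 0" "\<tau>\<^sup>2 = h \<diamondop> h" "v \<in> carrier_vec n" "v \<diamondop> v = 1" "h = \<tau> \<cdot>\<^sub>v v"
proof -
  define \<tau> where "\<tau> = sqrt (h \<diamondop> h)"
  have \<tau>: "\<tau> > 0" "\<tau> * \<tau> = h \<diamondop> h" using scalar_prod_self_pos[OF assms] by (auto simp: \<tau>_def)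
  show thesis
  proof (rule that[of \<tau> "(1 / \<tau>) \<cdot>\<^sub>v h"])
    show "((1 / \<tau>) \<cdot>\<^sub>v h) \<diamondop> ((1 / \<tau>) \<cdot>\<^sub>v h) = 1" using assms(1) \<tau>(1) by (simp flip: \<tau>(2))
    show "h = \<tau> \<cdot>\<^sub>v ((1 / \<tau>) \<cdot>\<^sub>v h)" using assms \<tau>(1) by (intro eq_vecI) auto
  qed (use assms \<tau> in \<open>auto simp: power2_eq_square\<close>)
qed

lemma abs_scalar_prod_le_1:
  fixes u x :: "real Matrix.vec"
  assumes "u \<in> carrier_vec n" "x \<in> carrier_vec n" "u \<diamondop> u = 1" "x \<diamondop> x = 1"
  shows "\<bar>u \<diamondop> x\<bar> \<le> 1"
proof -
  have nn: "w \<diamondop> w \<ge> 0" if "w \<in> carrier_vec n" for w :: "real Matrix.vec"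
    using that by (simp add: scalar_prod_sum[where n=n] sum_nonneg)
  have "(u + x) \<diamondop> (u + x) = 2 + 2 * (u \<diamondop> x)"
    using assms comm_scalar_prod[OF assms(1,2)]
    by (simp add: add_scalar_prod_distrib[where n=n] scalar_prod_add_distrib[where n=n])
  then show ?thesis
    using nn[of "u - x"] nn[of "u + x"] scalar_prod_sub_self[OF assms(1,2)] assms by simp
qed

section \<open>Critical points for a good sample\<close>

context
  fixes n m :: nat and \<epsilon> L \<eta> :: real and a :: "nat \<Rightarrow> real Matrix.vec" and x :: "real Matrix.vec"
  assumes x: "x \<in> carrier_vec n" "x \<diamondop> x = 1" and a: "\<And>j. a j \<in> carrier_vec n"
    and good: "good_sample n m \<epsilon> L a x"
    and L: "L \<ge> 1" and \<eta>: "\<eta> = 1 / (20000 * L ^ 4)" and \<epsilon>: "\<epsilon> = \<eta> / 1000"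
begin

lemma \<eta>_bounds: "0 < \<eta>" "\<eta> \<le> 1/10"
proof -
  have "L ^ 4 \<ge> 1" using L by (rule one_le_power)
  moreover from this have "1 / (20000 * L ^ 4) \<le> 1 / (20000 * 1)"
    by (intro divide_left_mono mult_left_mono) auto
  ultimately show "0 < \<eta>" "\<eta> \<le> 1/10" by (auto simp: \<eta>)
qed

lemma \<epsilon>_bounds: "0 < \<epsilon>" "\<epsilon> \<le> 1/10000" using \<eta>_bounds by (auto simp: \<epsilon>)

text \<open>By homogeneity; the bound is needed at differences of unit vectors.\<close>

lemma emp_upper: "v \<in> carrier_vec n \<Longrightarrow> emp_mean m (\<lambda>j. (a j \<diamondop> x)\<^sup>2 * (a j \<diamondop> v)\<^sup>2) \<le> v \<diamondop> v + 2 * (v \<diamondop> x)\<^sup>2 + \<epsilon> * (v \<diamondop> v)"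
proof (cases "v = 0\<^sub>v n")
  case True
  then show ?thesis using x a by (simp add: emp_mean_def)
next
  case False
  assume v: "v \<in> carrier_vec n"
  obtain \<tau> w where w: "\<tau> > 0" "\<tau>\<^sup>2 = v \<diamondop> v" "w \<in> carrier_vec n" "w \<diamondop> w = 1" "v = \<tau> \<cdot>\<^sub>v w"
    using unit_vec_normalize[OF v False] .
  have "emp_mean m (\<lambda>j. (a j \<diamondop> x)\<^sup>2 * (a j \<diamondop> v)\<^sup>2) = emp_mean m (\<lambda>j. \<tau>\<^sup>2 * ((a j \<diamondop> x)\<^sup>2 * (a j \<diamondop> w)\<^sup>2))"
    using w a by (simp add: power_mult_distrib mult.left_commute)
  also have "\<dots> \<le> \<tau>\<^sup>2 * (1 + 2 * (w \<diamondop> x)\<^sup>2 + \<epsilon>)"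
    unfolding emp_mean_cmult using good w by (intro mult_left_mono) (auto simp: good_sample_def)
  finally show ?thesis using w x by (simp add: power_mult_distrib algebra_simps)
qed

text \<open>Polarisation: the quadratic form v \<mapsto> mean of <a,x>^2 <a,v>^2 takes at w - x the
  value \<open>?S2 + ?S0 - 2 * \<sigma> * ?S1\<close>. Its upper bound together with the lower
  bounds for \<open>?S0\<close> and \<open>?S2\<close> bounds \<sigma> \<open>?S1\<close> from
  below. The sign \<sigma> makes <w,x> nonnegative, so w - x has squared norm at most 2.\<close>

lemma cubic_moment_lower:
  assumes u: "u \<in> carrier_vec n" "u \<diamondop> u = 1"
  shows "\<bar>emp_mean m (\<lambda>j. (a j \<diamondop> x) ^ 3 * (a j \<diamondop> u))\<bar> \<ge> 3 * \<bar>u \<diamondop> x\<bar> - 3 * \<epsilon>"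
proof -
  let ?S0 = "emp_mean m (\<lambda>j. (a j \<diamondop> x)\<^sup>2 * (a j \<diamondop> x)\<^sup>2)"
  let ?S1 = "emp_mean m (\<lambda>j. (a j \<diamondop> x) ^ 3 * (a j \<diamondop> u))"
  let ?S2 = "emp_mean m (\<lambda>j. (a j \<diamondop> x)\<^sup>2 * (a j \<diamondop> u)\<^sup>2)"
  have S0: "?S0 \<ge> 3 - \<epsilon>" using good x unfolding good_sample_def by force
  have S2: "?S2 \<ge> 1 + 2 * (u \<diamondop> x)\<^sup>2 - \<epsilon>" using good u unfolding good_sample_def by force
  have main: "\<sigma> * ?S1 \<ge> 3 * (\<sigma> * (u \<diamondop> x)) - 3 * \<epsilon>" if \<sigma>: "\<sigma> = 1 \<or> \<sigma> = -1" and pos: "0 \<le> \<sigma> * (u \<diamondop> x)" for \<sigma>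
  proof -
    define c where "c = \<sigma> * (u \<diamondop> x)"
    define w where "w = \<sigma> \<cdot>\<^sub>v u"
    have s2: "\<sigma> * \<sigma> = 1" using \<sigma> by auto
    have w: "w \<in> carrier_vec n" "w \<diamondop> w = 1" "w \<diamondop> x = c" using u x s2 by (auto simp: w_def c_def)
    have "emp_mean m (\<lambda>j. (a j \<diamondop> x)\<^sup>2 * (a j \<diamondop> (w - x))\<^sup>2) = emp_mean m (\<lambda>j. (a j \<diamondop> x)\<^sup>2 * (a j \<diamondop> u)\<^sup>2 + (a j \<diamondop> x)\<^sup>2 * (a j \<diamondop> x)\<^sup>2 - (2 * \<sigma>) * ((a j \<diamondop> x) ^ 3 * (a j \<diamondop> u)))"
    proof -
      have "(a j \<diamondop> x)\<^sup>2 * (a j \<diamondop> (w - x))\<^sup>2 = (a j \<diamondop> x)\<^sup>2 * (a j \<diamondop> u)\<^sup>2 + (a j \<diamondop> x)\<^sup>2 * (a j \<diamondop> x)\<^sup>2 - (2 * \<sigma>) * ((a j \<diamondop> x) ^ 3 * (a j \<diamondop> u))" for j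
      proof -
        have e: "a j \<diamondop> (w - x) = \<sigma> * (a j \<diamondop> u) - a j \<diamondop> x"
          using scalar_prod_minus_distrib[OF a w(1) x(1)] u a[of j] by (simp add: w_def)
        show ?thesis unfolding e using \<sigma> by (auto simp: power2_eq_square power3_eq_cube algebra_simps)
      qed
      then show ?thesis by simp
    qed
    then have eq: "emp_mean m (\<lambda>j. (a j \<diamondop> x)\<^sup>2 * (a j \<diamondop> (w - x))\<^sup>2) = ?S2 + ?S0 - 2 * \<sigma> * ?S1"
      by (simp only: emp_mean_diff emp_mean_add emp_mean_cmult)
    have c1: "c \<le> 1" using abs_scalar_prod_le_1[OF w(1) x(1) w(2) x(2)] w(3) by simp
    have "(w - x) \<diamondop> (w - x) = 2 - 2 * c" using scalar_prod_sub_self[OF w(1) x(1)] w x by simp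
    moreover have "(w - x) \<diamondop> x = c - 1" using minus_scalar_prod_distrib[OF w(1) x(1) x(1)] w x by simp
    ultimately have "?S2 + ?S0 - 2 * \<sigma> * ?S1 \<le> 2 - 2 * c + 2 * (c - 1)\<^sup>2 + \<epsilon> * (2 - 2 * c)"
      using emp_upper[of "w - x"] w x eq by simp
    moreover have "c\<^sup>2 = (u \<diamondop> x)\<^sup>2" using \<sigma> by (auto simp: c_def)
    moreover have "(c - 1)\<^sup>2 = c\<^sup>2 - 2 * c + 1" by (simp add: power2_eq_square algebra_simps)
    moreover have "\<epsilon> * (2 - 2 * c) \<le> \<epsilon> * 2" using pos \<epsilon>_bounds by (intro mult_left_mono) (auto simp: c_def)
    ultimately have "2 * (\<sigma> * ?S1) \<ge> 6 * c - 4 * \<epsilon>" using S0 S2 by simp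
    then show ?thesis using \<epsilon>_bounds unfolding c_def[symmetric] by linarith
  qed
  show ?thesis
  proof (cases "u \<diamondop> x \<ge> 0")
    case True then show ?thesis using main[of 1] by simp
  next
    case False then show ?thesis using main[of "-1"] by simp
  qed
qed

text \<open>With m = 0 every empirical mean is 0, which contradicts the lower bound on the quartic
  mean.\<close>

lemma sample_pos: "m > 0"
proof (rule ccontr)
  assume "\<not> m > 0"
  then have "emp_mean m (\<lambda>j. (a j \<diamondop> x) ^ 4) = 0" by (simp add: emp_mean_def)
  moreover have "emp_mean m (\<lambda>j. (a j \<diamondop> x) ^ 4) \<ge> 3 - \<epsilon>" using good x unfolding good_sample_def by force
  ultimately show False using \<epsilon>_bounds by simp
qed

text \<open>The gradient at z, paired with z - x, is in fact positive: up to the factor \<tau>^2 it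
  is at least three times the truncated mean minus the plain one, minus a remainder of order
  \<tau>.\<close>

lemma no_nearby_critical_point:
  assumes z: "z \<in> carrier_vec n" "z \<noteq> x" and near: "(z - x) \<diamondop> (z - x) \<le> 5 * \<eta>"
  shows "emp_mean m (\<lambda>j. ((a j \<diamondop> z)\<^sup>2 - (a j \<diamondop> x)\<^sup>2) * (a j \<diamondop> z) * (a j \<diamondop> (z - x))) \<noteq> 0"
proof -
  have "z - x \<noteq> 0\<^sub>v n"
  proof
    assume 0: "z - x = 0\<^sub>v n"
    have "z = x"
    proof (rule eq_vecI)
      fix i assume i: "i < dim_vec x"
      then have "vec_index (z - x) i = 0" using 0 x by simp
      then show "vec_index z i = vec_index x i" using i z x by simp
    qed (use z x in auto)
    then show False using z by simp
  qed
  then obtain \<tau> v where v: "\<tau> > 0" "\<tau>\<^sup>2 = (z - x) \<diamondop> (z - x)" "v \<in> carrier_vec n" "v \<diamondop> v = 1" "z - x = \<tau> \<cdot>\<^sub>v v"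
    using unit_vec_normalize[of "z - x" n] z x by auto
  let ?p = "\<lambda>j. a j \<diamondop> x" and ?k = "\<lambda>j. a j \<diamondop> v"
  have zj: "a j \<diamondop> z = ?p j + \<tau> * ?k j" for j
  proof -
    have "a j \<diamondop> (z - x) = \<tau> * ?k j" using v a by simp
    then show ?thesis using scalar_prod_minus_distrib[OF a z(1) x(1)] by simp
  qed
  \<comment> \<open>48^2 times 5 is 11520, below the 20000 in the choice of \<eta>; this estimate is
    the origin of that constant.\<close>
  have "(48 * \<tau> * L\<^sup>2)\<^sup>2 \<le> 1\<^sup>2"
  proof -
    have "(48 * \<tau> * L\<^sup>2)\<^sup>2 = 2304 * L ^ 4 * \<tau>\<^sup>2" by (simp add: power_mult_distrib flip: power_mult)
    also have "\<dots> \<le> 2304 * L ^ 4 * (5 * \<eta>)" using near v(2) L by (intro mult_left_mono) auto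
    also have "\<dots> \<le> 1" using L by (simp add: \<eta>)
    finally show ?thesis by simp
  qed
  then have \<tau>: "48 * \<tau> * L\<^sup>2 \<le> 1" by (rule power2_le_imp_le) simp
  have pt: "((a j \<diamondop> z)\<^sup>2 - (?p j)\<^sup>2) * (a j \<diamondop> z) * (a j \<diamondop> (z - x)) \<ge>
     \<tau>\<^sup>2 * (3 * (min ((?p j)\<^sup>2) L * min ((?k j)\<^sup>2) L) - (?p j)\<^sup>2 * (?k j)\<^sup>2 - 48 * \<tau> * L\<^sup>2)" for j
  proof -
    have "a j \<diamondop> (z - x) = \<tau> * ?k j" using v a by simp
    then have "((a j \<diamondop> z)\<^sup>2 - (?p j)\<^sup>2) * (a j \<diamondop> z) * (a j \<diamondop> (z - x)) =
      \<tau>\<^sup>2 * ((?k j)\<^sup>2 * ((2 * ?p j + \<tau> * ?k j) * (?p j + \<tau> * ?k j)))"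
      unfolding zj by (simp add: power2_eq_square algebra_simps)
    moreover have "\<tau>\<^sup>2 * (3 * (min ((?p j)\<^sup>2) L * min ((?k j)\<^sup>2) L) - (?p j)\<^sup>2 * (?k j)\<^sup>2 - 48 * \<tau> * L\<^sup>2) \<le>
      \<tau>\<^sup>2 * ((?k j)\<^sup>2 * ((2 * ?p j + \<tau> * ?k j) * (?p j + \<tau> * ?k j)))"
      using v(1) L by (intro mult_left_mono truncated_curvature_bound) auto
    ultimately show ?thesis by simp
  qed
  let ?M = "emp_mean m (\<lambda>j. min ((?p j)\<^sup>2) L * min ((?k j)\<^sup>2) L)" and ?A = "emp_mean m (\<lambda>j. (?p j)\<^sup>2 * (?k j)\<^sup>2)"
  have "emp_mean m (\<lambda>j. \<tau>\<^sup>2 * (3 * (min ((?p j)\<^sup>2) L * min ((?k j)\<^sup>2) L) - (?p j)\<^sup>2 * (?k j)\<^sup>2 - 48 * \<tau> * L\<^sup>2))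
    = \<tau>\<^sup>2 * (3 * ?M - ?A - 48 * \<tau> * L\<^sup>2)"
    by (simp only: emp_mean_cmult emp_mean_diff emp_mean_const[OF sample_pos])
  moreover have "emp_mean m (\<lambda>j. \<tau>\<^sup>2 * (3 * (min ((?p j)\<^sup>2) L * min ((?k j)\<^sup>2) L) - (?p j)\<^sup>2 * (?k j)\<^sup>2 - 48 * \<tau> * L\<^sup>2))
    \<le> emp_mean m (\<lambda>j. ((a j \<diamondop> z)\<^sup>2 - (a j \<diamondop> x)\<^sup>2) * (a j \<diamondop> z) * (a j \<diamondop> (z - x)))"
    by (rule emp_mean_mono) (rule pt)
  ultimately have "\<tau>\<^sup>2 * (3 * ?M - ?A - 48 * \<tau> * L\<^sup>2) \<le>
    emp_mean m (\<lambda>j. ((a j \<diamondop> z)\<^sup>2 - (a j \<diamondop> x)\<^sup>2) * (a j \<diamondop> z) * (a j \<diamondop> (z - x)))" by simp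
  moreover have "?M \<ge> 1 + 2 * (v \<diamondop> x)\<^sup>2 - 1/8" "?A \<le> 1 + 2 * (v \<diamondop> x)\<^sup>2 + \<epsilon>"
    using good v unfolding good_sample_def by auto
  \<comment> \<open>The constants add up to 3 (1 - 1/8) - 1 - 1 = 5/8 up to \<epsilon>, so the fixed
    truncation error 1/8 is small enough.\<close>
  then have "3 * ?M - ?A - 48 * \<tau> * L\<^sup>2 > 0" using \<tau> \<epsilon>_bounds zero_le_power2[of "v \<diamondop> x"] by linarith
  then have "\<tau>\<^sup>2 * (3 * ?M - ?A - 48 * \<tau> * L\<^sup>2) > 0" using v(1) by simp
  ultimately show ?thesis by linarith
qed

text \<open>Testing criticality with y = u and y = x yields the two moment identities. If the
  dichotomy places Z near X, testing with z - x, where z z^T = r u u^T, leaves only z = x.\<close>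

lemma critical_point_trichotomy:
  assumes u: "u \<in> carrier_vec n" "u \<diamondop> u = 1" and r: "r \<noteq> 0"
    and crit: "\<And>y. y \<in> carrier_vec n \<Longrightarrow>
      emp_mean m (\<lambda>j. (r * (a j \<diamondop> u)\<^sup>2 - (a j \<diamondop> x)\<^sup>2) * (a j \<diamondop> u) * (a j \<diamondop> y)) = 0"
  shows "6 * emp_mean m (\<lambda>j. (a j \<diamondop> x)\<^sup>2 * (a j \<diamondop> u)\<^sup>2) - 2 * emp_mean m (\<lambda>j. (a j \<diamondop> x) ^ 4) / r \<le>
      - 2 * (2 + 2 * (u \<diamondop> x)\<^sup>2) \<or> (r = 1 \<and> (u \<diamondop> x)\<^sup>2 = 1)"
proof -
  let ?p = "\<lambda>j. a j \<diamondop> x" and ?k = "\<lambda>j. a j \<diamondop> u"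
  let ?S0 = "emp_mean m (\<lambda>j. (?p j) ^ 4)" and ?S1 = "emp_mean m (\<lambda>j. (?p j) ^ 3 * ?k j)"
    and ?S2 = "emp_mean m (\<lambda>j. (?p j)\<^sup>2 * (?k j)\<^sup>2)" and ?S3 = "emp_mean m (\<lambda>j. (?k j)\<^sup>2 * (?p j * ?k j))"
    and ?S4 = "emp_mean m (\<lambda>j. (?k j) ^ 4)"
  define c where "c = u \<diamondop> x"
  have c: "\<bar>c\<bar> \<le> 1" unfolding c_def using abs_scalar_prod_le_1[OF u(1) x(1) u(2) x(2)] .
  have "emp_mean m (\<lambda>j. (r * (?k j)\<^sup>2 - (?p j)\<^sup>2) * ?k j * ?k j) = emp_mean m (\<lambda>j. r * (?k j) ^ 4 - (?p j)\<^sup>2 * (?k j)\<^sup>2)"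
    by (simp add: power4_eq_xxxx power2_eq_square algebra_simps)
  then have e4: "r * ?S4 = ?S2" using crit[OF u(1)] by (simp add: emp_mean_diff emp_mean_cmult)
  have "emp_mean m (\<lambda>j. (r * (?k j)\<^sup>2 - (?p j)\<^sup>2) * ?k j * ?p j) = emp_mean m (\<lambda>j. r * ((?k j)\<^sup>2 * (?p j * ?k j)) - (?p j) ^ 3 * ?k j)"
    by (simp add: power3_eq_cube power2_eq_square algebra_simps)
  then have e3: "r * ?S3 = ?S1" using crit[OF x(1)] by (simp add: emp_mean_diff emp_mean_cmult)
  have CS: "?S3\<^sup>2 \<le> ?S4 * ?S2"
    using emp_mean_Cauchy_Schwarz[of m "\<lambda>j. (?k j)\<^sup>2" "\<lambda>j. ?p j * ?k j"]
    by (simp add: power_mult_distrib flip: power_mult)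
  have "?S0 \<ge> 3 - \<epsilon>" using good x unfolding good_sample_def by force
  moreover have "\<bar>?S2 - (1 + 2 * c\<^sup>2)\<bar> \<le> \<epsilon>" "?S4 \<ge> 3 - \<epsilon>"
    using good u unfolding good_sample_def by (auto simp: c_def abs_le_iff)
  moreover have "\<bar>?S1\<bar> \<ge> 3 * \<bar>c\<bar> - 3 * \<epsilon>" using cubic_moment_lower[OF u] by (simp add: c_def)
  ultimately have D: "r > 0 \<and> (6 * ?S2 - 2 * ?S0 / r \<le> - 2 * (2 + 2 * c\<^sup>2) \<or> (1 - \<eta> \<le> c\<^sup>2 \<and> \<bar>r - 1\<bar> \<le> \<eta>))"
    using critical_moment_dichotomy[OF \<eta>_bounds \<epsilon> c r _ _ _ _ e4 e3 CS] by blast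
  show ?thesis
  proof (cases "6 * ?S2 - 2 * ?S0 / r \<le> - 2 * (2 + 2 * c\<^sup>2)")
    case True then show ?thesis by (simp add: c_def)
  next
    case False
    then have near: "r > 0" "1 - \<eta> \<le> c\<^sup>2" "\<bar>r - 1\<bar> \<le> \<eta>" using D by auto
    \<comment> \<open>The sign selects the square root of r u u^T that lies near x rather than near
      -x.\<close>
    define \<sigma> :: real where "\<sigma> = (if c \<ge> 0 then 1 else - 1)"
    define q where "q = sqrt r"
    have q: "q > 0" "q\<^sup>2 = r" using near(1) by (auto simp: q_def)
    define z where "z = (\<sigma> * q) \<cdot>\<^sub>v u"
    have \<sigma>: "\<sigma>\<^sup>2 = 1" "\<sigma> * c = \<bar>c\<bar>" by (auto simp: \<sigma>_def)
    have z: "z \<in> carrier_vec n" using u by (simp add: z_def)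
    have az: "a j \<diamondop> z = \<sigma> * q * ?k j" for j using a[of j] u by (simp add: z_def)
    have zz: "z \<diamondop> z = r"
    proof -
      have "z \<diamondop> z = (\<sigma> * q) * (\<sigma> * q)" using u by (simp add: z_def)
      also have "\<dots> = \<sigma>\<^sup>2 * q\<^sup>2" by (simp add: power2_eq_square)
      finally show ?thesis using \<sigma> q by simp
    qed
    have zx: "z \<diamondop> x = q * \<bar>c\<bar>"
      using u x \<sigma> by (simp add: z_def c_def mult.commute mult.left_commute flip: \<sigma>(2))
    have "(z - x) \<diamondop> (z - x) = r - 2 * (q * \<bar>c\<bar>) + 1" using scalar_prod_sub_self[OF z x(1)] zz zx x by simp
    also have "\<dots> \<le> 5 * \<eta>"
    proof -
      have "\<bar>c\<bar> * \<bar>c\<bar> \<le> \<bar>c\<bar> * 1" using c by (intro mult_left_mono) auto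
      then have c1: "\<bar>c\<bar> \<ge> 1 - \<eta>" using near(2) by (simp add: power2_eq_square flip: abs_mult)
      have "q \<ge> 1 - \<eta>"
      proof (rule power2_le_imp_le)
        have "(1 - \<eta>) * (1 - \<eta>) \<le> (1 - \<eta>) * 1" using \<eta>_bounds by (intro mult_left_mono) auto
        then show "(1 - \<eta>)\<^sup>2 \<le> q\<^sup>2" using q near(3) by (simp add: power2_eq_square)
      qed (use q in simp)
      then have "q * \<bar>c\<bar> \<ge> (1 - \<eta>) * (1 - \<eta>)" using c1 \<eta>_bounds q by (intro mult_mono) auto
      moreover have "(1 - \<eta>) * (1 - \<eta>) = 1 - 2 * \<eta> + \<eta> * \<eta>" by (simp add: algebra_simps)
      moreover have "r \<le> 1 + \<eta>" "0 \<le> \<eta> * \<eta>" using near(3) by auto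
      ultimately show ?thesis by linarith
    qed
    finally have le: "(z - x) \<diamondop> (z - x) \<le> 5 * \<eta>" .
    have "((a j \<diamondop> z)\<^sup>2 - (?p j)\<^sup>2) * (a j \<diamondop> z) * (a j \<diamondop> (z - x)) =
      (\<sigma> * q) * ((r * (?k j)\<^sup>2 - (?p j)\<^sup>2) * ?k j * (a j \<diamondop> (z - x)))" for j
    proof -
      have "(a j \<diamondop> z)\<^sup>2 = r * (?k j)\<^sup>2" by (simp add: az power_mult_distrib \<sigma> q)
      then show ?thesis by (simp add: az)
    qed
    moreover have "z - x \<in> carrier_vec n" using z x by simp
    ultimately have "emp_mean m (\<lambda>j. ((a j \<diamondop> z)\<^sup>2 - (?p j)\<^sup>2) * (a j \<diamondop> z) * (a j \<diamondop> (z - x))) = 0"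
      by (simp only: emp_mean_cmult crit mult_zero_right)
    then have zx': "z = x" using no_nearby_critical_point[OF z _ le] by blast
    then have "r = 1" using zz x by simp
    moreover have "q = 1" using \<open>r = 1\<close> by (simp add: q_def)
    moreover have "q * \<bar>c\<bar> = 1" using zx zx' x by simp
    then have "c\<^sup>2 = 1" using \<open>q = 1\<close> by (simp add: power2_eq_square flip: abs_mult)
      (metis abs_mult_self_eq mult_1)
    ultimately show ?thesis by (simp add: c_def)
  qed
qed

end

lemma quad_rank_one:
  assumes "\<And>j. a j \<in> carrier_vec n" "u \<in> carrier_vec n"
  shows "quad n a (s \<cdot>\<^sub>m outer u u) j = s * (a j \<diamondop> u)\<^sup>2"
  using assms comm_scalar_prod[of u n "a j"]
  by (simp add: quad_smult[of _ n] quad_def[of n a "outer u u"] bil_outer[of u n u] power2_eq_square)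

lemma frob_norm_rank_one:
  assumes "u \<in> carrier_vec n"
  shows "frob_norm (s \<cdot>\<^sub>m outer u u) = \<bar>s\<bar> * (u \<diamondop> u)"
proof -
  have nn: "u \<diamondop> u \<ge> 0" using assms by (simp add: scalar_prod_sum[where n=n] sum_nonneg)
  have "frob_inner (s \<cdot>\<^sub>m outer u u) (s \<cdot>\<^sub>m outer u u) = (s * (u \<diamondop> u))\<^sup>2"
    using assms frob_inner_commute[of "s \<cdot>\<^sub>m outer u u" n "outer u u"]
    by (simp add: frob_inner_smult_right[of _ n] outer_inner[of u n u u u] power2_eq_square)
  then show ?thesis using nn by (simp add: frob_norm_def abs_mult)
qed

text \<open>Dividing by \<rho>, the Frobenius norm of X, reduces to a unit signal w and the ratio r.
  The test direction is y = w: multiplied by <a,w>^2, the weights 6 <a,u>^2 - 2 <a,w>^2 / r give the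
  numerator of the dichotomy, and the squared norm of the direction is 2 + 2 <u,w>^2.\<close>

lemma landscape_good_sample:
  fixes x :: "real Matrix.vec"
  assumes w: "R > 0" "w \<in> carrier_vec n" "w \<diamondop> w = 1" "x = R \<cdot>\<^sub>v w" and a: "\<And>j. a j \<in> carrier_vec n"
    and gw: "good_sample n m \<epsilon> L a w"
    and L: "L \<ge> 1" and \<eta>: "\<eta> = 1 / (20000 * L ^ 4)" and \<epsilon>: "\<epsilon> = \<eta> / 1000"
    and Z: "Z \<in> rank_one_manifold n" and \<delta>: "\<delta> < 1"
    and ZX: "frob_inner Z (outer x x) \<le> \<delta> * frob_norm Z * frob_norm (outer x x)"
    and crit: "riem_grad n (loss m a (outer x x)) Z = 0\<^sub>m n n"
  shows "lambda_min_hess n (loss m a (outer x x)) Z \<le> - 2"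
proof -
  let ?X = "outer x x"
  have x: "x \<in> carrier_vec n" using w by simp
  define \<rho> where "\<rho> = R\<^sup>2"
  have \<rho>: "\<rho> > 0" using w by (simp add: \<rho>_def)
  have X: "?X = \<rho> \<cdot>\<^sub>m outer w w" using w by (intro eq_matI) (auto simp: \<rho>_def power2_eq_square)
  have Xc: "?X \<in> carrier_mat n n" using x by simp
  obtain s u where s: "s \<noteq> 0" and u: "u \<in> carrier_vec n" "u \<diamondop> u = 1" and Zs: "Z = s \<cdot>\<^sub>m outer u u"
    using rank_one_manifoldE[OF Z] .
  have Zc: "Z \<in> carrier_mat n n" using u Zs by simp
  have q: "quad n a (Z - ?X) j = s * (a j \<diamondop> u)\<^sup>2 - \<rho> * (a j \<diamondop> w)\<^sup>2" for j
    unfolding quad_diff[OF Zc Xc] unfolding Zs X quad_rank_one[OF a u(1)] quad_rank_one[OF a w(2)] ..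
  have c0: "bil n (emp_grad n m a (quad n a (Z - ?X))) u y = 0" if "y \<in> carrier_vec n" for y
    by (rule riem_grad_zeroD[OF a Xc u s Zs crit that])
  define r where "r = s / \<rho>"
  have r: "r \<noteq> 0" using s \<rho> by (simp add: r_def)
  have rs: "s = \<rho> * r" using \<rho> by (simp add: r_def)
  have cr: "emp_mean m (\<lambda>j. (r * (a j \<diamondop> u)\<^sup>2 - (a j \<diamondop> w)\<^sup>2) * (a j \<diamondop> u) * (a j \<diamondop> y)) = 0"
    if y: "y \<in> carrier_vec n" for y
  proof -
    have "bil n (emp_grad n m a (quad n a (Z - ?X))) u y =
      emp_mean m (\<lambda>j. \<rho> * ((r * (a j \<diamondop> u)\<^sup>2 - (a j \<diamondop> w)\<^sup>2) * (a j \<diamondop> u) * (a j \<diamondop> y)))"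
      unfolding bil_emp_grad[of a n, OF a u(1) y] emp_mean_def q rs by (simp add: algebra_simps)
    then show ?thesis using c0[OF y] \<rho> by (simp add: emp_mean_cmult)
  qed
  have "w \<noteq> 0\<^sub>v n" using w by auto
  have "lambda_min_hess n (loss m a ?X) Z \<le> bil n (hess_form n m a ?X Z u s) w w / (2 * (w \<diamondop> w) + 2 * (u \<diamondop> w)\<^sup>2)"
    by (rule lambda_min_hess_le[OF a Xc u s Zs c0 w(2) \<open>w \<noteq> 0\<^sub>v n\<close>])
  moreover have "bil n (hess_form n m a ?X Z u s) w w =
    6 * emp_mean m (\<lambda>j. (a j \<diamondop> w)\<^sup>2 * (a j \<diamondop> u)\<^sup>2) - 2 / r * emp_mean m (\<lambda>j. (a j \<diamondop> w) ^ 4)"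
  proof -
    have pt: "(2 * (\<rho> * r * k\<^sup>2 - \<rho> * p\<^sup>2) / (\<rho> * r) + 4 * k\<^sup>2) * (p * p) = 6 * (p\<^sup>2 * k\<^sup>2) - 2 / r * p ^ 4" for p k
      using r \<rho> by (simp add: field_simps power2_eq_square power4_eq_xxxx)
    have hf: "hess_form n m a ?X Z u s = emp_grad n m a (\<lambda>j. 2 * quad n a (Z - ?X) j / s + 4 * (a j \<diamondop> u)\<^sup>2)"
      by (rule hess_form_def[OF a Xc u s Zs c0])
    have "bil n (hess_form n m a ?X Z u s) w w = emp_mean m (\<lambda>j. 6 * ((a j \<diamondop> w)\<^sup>2 * (a j \<diamondop> u)\<^sup>2) - 2 / r * (a j \<diamondop> w) ^ 4)"
      unfolding hf bil_emp_grad[of a n, OF a w(2) w(2)] emp_mean_def unfolding q rs pt by (rule refl)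
    then show ?thesis by (simp only: emp_mean_diff emp_mean_cmult)
  qed
  moreover have "6 * emp_mean m (\<lambda>j. (a j \<diamondop> w)\<^sup>2 * (a j \<diamondop> u)\<^sup>2) - 2 * emp_mean m (\<lambda>j. (a j \<diamondop> w) ^ 4) / r \<le>
      - 2 * (2 + 2 * (u \<diamondop> w)\<^sup>2) \<or> (r = 1 \<and> (u \<diamondop> w)\<^sup>2 = 1)"
    by (rule critical_point_trichotomy[OF w(2,3) a gw L \<eta> \<epsilon> u r cr])
  moreover have "\<not> (r = 1 \<and> (u \<diamondop> w)\<^sup>2 = 1)"
  proof
    assume h: "r = 1 \<and> (u \<diamondop> w)\<^sup>2 = 1"
    then have "s = \<rho>" using rs by simp
    have "frob_inner Z ?X = \<rho> * \<rho> * (u \<diamondop> w)\<^sup>2"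
      unfolding Zs X \<open>s = \<rho>\<close> using u w frob_inner_commute[of "\<rho> \<cdot>\<^sub>m outer u u" n "outer w w"]
        comm_scalar_prod[of w n u]
      by (simp add: frob_inner_smult_right[of _ n] outer_inner[of _ n] power2_eq_square)
    moreover have "frob_norm Z = \<rho>" unfolding Zs using frob_norm_rank_one[OF u(1)] u \<rho> \<open>s = \<rho>\<close> by simp
    moreover have "frob_norm ?X = \<rho>" unfolding X using frob_norm_rank_one[OF w(2)] w \<rho> by simp
    ultimately have "\<rho> * \<rho> \<le> \<delta> * (\<rho> * \<rho>)" using ZX h by simp
    moreover have "\<rho> * \<rho> > 0" using \<rho> by simp
    ultimately show False using \<delta> by (simp add: mult_le_cancel_right1)
  qed
  ultimately have "lambda_min_hess n (loss m a ?X) Z \<le> (- 2 * (2 + 2 * (u \<diamondop> w)\<^sup>2)) / (2 + 2 * (u \<diamondop> w)\<^sup>2)"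
    using w(3) by (elim order_trans) (auto intro!: divide_right_mono)
  also have "\<dots> = - 2"
  proof -
    have "2 + 2 * (u \<diamondop> w)\<^sup>2 \<noteq> 0" using zero_le_power2[of "u \<diamondop> w"] by linarith
    then show ?thesis by (simp add: field_simps)
  qed
  finally show ?thesis .
qed

section \<open>Nets in the sphere\<close>

text \<open>The series over all integers has value 3; the correction term is its exact tail and
  carries the induction.\<close>

lemma sum_powr_abs_le_3: "(\<Sum>z\<in>{- int M..int M}. (1/2::real) ^ nat \<bar>z\<bar>) \<le> 3 - 2 * (1/2) ^ M"
proof (induction M)
  case (Suc M)
  have "{- int (Suc M)..int (Suc M)} = insert (- int (Suc M)) (insert (int (Suc M)) {- int M..int M})"
    by auto
  then have "(\<Sum>z\<in>{- int (Suc M)..int (Suc M)}. (1/2::real) ^ nat \<bar>z\<bar>) =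
    (1/2) ^ Suc M + (1/2) ^ Suc M + (\<Sum>z\<in>{- int M..int M}. (1/2::real) ^ nat \<bar>z\<bar>)"
    by (simp add: nat_add_distrib)
  then show ?case using Suc by simp
qed simp

text \<open>Counting by a generating function: each k in K satisfies 1 \<le> 2^B times the product
  of the 2^(-|k_i|), and the sum of this product over a box factorises into n sums of size at most
  3.\<close>

lemma card_bounded_l1_le:
  assumes K: "K \<subseteq> PiE {..<n} (\<lambda>_. UNIV :: int set)" and B: "\<And>k. k \<in> K \<Longrightarrow> (\<Sum>i<n. nat \<bar>k i\<bar>) \<le> B"
  shows "finite K \<and> real (card K) \<le> 2 ^ B * 3 ^ n"
proof -
  let ?P = "PiE {..<n} (\<lambda>_. {- int B..int B})"
  have sub: "K \<subseteq> ?P"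
  proof
    fix k assume k: "k \<in> K"
    have "k i \<in> {- int B..int B}" if "i < n" for i
    proof -
      have "nat \<bar>k i\<bar> \<le> (\<Sum>i<n. nat \<bar>k i\<bar>)" using that by (intro member_le_sum) auto
      then have "nat \<bar>k i\<bar> \<le> B" using B[OF k] by simp
      then show ?thesis by auto
    qed
    then show "k \<in> ?P" using k K by (auto simp: PiE_iff)
  qed
  have finP: "finite ?P" by (intro finite_PiE) auto
  then have fin: "finite K" using sub finite_subset by blast
  have "real (card K) = (\<Sum>k\<in>K. 1)" by simp
  also have "\<dots> \<le> (\<Sum>k\<in>K. 2 ^ B * (\<Prod>i<n. (1/2) ^ nat \<bar>k i\<bar>))"
  proof (rule sum_mono)
    fix k assume "k \<in> K"
    then have "(1/2::real) ^ B \<le> (1/2) ^ (\<Sum>i<n. nat \<bar>k i\<bar>)" by (intro power_decreasing B) auto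
    then have "2 ^ B * (1/2::real) ^ B \<le> 2 ^ B * (\<Prod>i<n. (1/2) ^ nat \<bar>k i\<bar>)"
      unfolding power_sum[symmetric] by (intro mult_left_mono) auto
    then show "(1::real) \<le> 2 ^ B * (\<Prod>i<n. (1/2) ^ nat \<bar>k i\<bar>)" by (simp add: power_one_over)
  qed
  also have "\<dots> \<le> (\<Sum>k\<in>?P. 2 ^ B * (\<Prod>i<n. (1/2) ^ nat \<bar>k i\<bar>))"
    by (rule sum_mono2[OF finP sub]) (simp add: prod_nonneg)
  also have "\<dots> = 2 ^ B * (\<Sum>k\<in>?P. \<Prod>i<n. (1/2) ^ nat \<bar>k i\<bar>)" by (simp add: sum_distrib_left)
  also have "(\<Sum>k\<in>?P. \<Prod>i<n. (1/2::real) ^ nat \<bar>k i\<bar>) = (\<Prod>i<n. \<Sum>z\<in>{- int B..int B}. (1/2) ^ nat \<bar>z\<bar>)"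
    by (rule prod_sum_PiE[symmetric]) auto
  also have "\<dots> \<le> (\<Prod>i<n. 3)"
  proof (rule prod_mono)
    fix i
    have "0 \<le> 2 * (1/2::real) ^ B" by simp
    then have "(\<Sum>z\<in>{- int B..int B}. (1/2::real) ^ nat \<bar>z\<bar>) \<le> 3" using sum_powr_abs_le_3[of B] by linarith
    then show "0 \<le> (\<Sum>z\<in>{- int B..int B}. (1/2::real) ^ nat \<bar>z\<bar>) \<and> (\<Sum>z\<in>{- int B..int B}. (1/2::real) ^ nat \<bar>z\<bar>) \<le> 3"
      by (auto intro!: sum_nonneg)
  qed
  finally show ?thesis using fin by simp
qed

lemma l1_le_sqrt_l2: "(\<Sum>i<n. \<bar>f i\<bar>) \<le> sqrt (real n) * sqrt (\<Sum>i<n. (f i :: real)\<^sup>2)"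
proof (rule power2_le_imp_le)
  have "(\<Sum>i<n. \<bar>f i\<bar> * 1)\<^sup>2 \<le> (\<Sum>i<n. \<bar>f i\<bar>\<^sup>2) * (\<Sum>i<n. 1\<^sup>2)" by (rule Cauchy_Schwarz_ineq_sum)
  then show "(\<Sum>i<n. \<bar>f i\<bar>)\<^sup>2 \<le> (sqrt (real n) * sqrt (\<Sum>i<n. (f i)\<^sup>2))\<^sup>2"
    by (simp add: power_mult_distrib sum_nonneg mult.commute)
qed (simp add: sum_nonneg)

text \<open>Coordinates are rounded to a grid of mesh \<eta>/sqrt n. The rounded integer vectors
  have l1-norm at most n/\<eta> + n, so there are only exponentially many of them; counting grid
  points in a cube would cost a further factor of order n^(n/2).\<close>

lemma sphere_net:
  assumes n: "n > 0" and \<eta>: "0 < \<eta>" and D: "D = 3 * 2 ^ (nat \<lceil>1 / \<eta>\<rceil> + 1)"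
  obtains N :: "real Matrix.vec set" where "finite N" "real (card N) \<le> D ^ n"
    "\<And>v. v \<in> N \<Longrightarrow> v \<in> carrier_vec n \<and> v \<diamondop> v = 1"
    "\<And>u. u \<in> carrier_vec n \<Longrightarrow> u \<diamondop> u = 1 \<Longrightarrow> \<exists>v\<in>N. (u - v) \<diamondop> (u - v) \<le> \<eta>\<^sup>2"
proof -
  define h where "h = \<eta> / sqrt (real n)"
  have h: "h > 0" using n \<eta> by (simp add: h_def)
  have nh: "real n * h\<^sup>2 = \<eta>\<^sup>2" using n by (simp add: h_def power_divide)
  define S where "S = {u :: real Matrix.vec. u \<in> carrier_vec n \<and> u \<diamondop> u = 1}"
  define k where "k u = (\<lambda>i\<in>{..<n}. \<lfloor>vec_index u i / h\<rfloor>)" for u :: "real Matrix.vec"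
  define B where "B = n * (nat \<lceil>1 / \<eta>\<rceil> + 1)"
  have kB: "(\<Sum>i<n. nat \<bar>k u i\<bar>) \<le> B" if u: "u \<in> S" for u
  proof -
    have "real (\<Sum>i<n. nat \<bar>k u i\<bar>) = (\<Sum>i<n. \<bar>real_of_int (k u i)\<bar>)" by simp
    also have "\<dots> \<le> (\<Sum>i<n. \<bar>vec_index u i\<bar> / h + 1)"
    proof (rule sum_mono)
      fix i assume "i \<in> {..<n}"
      then have ki: "k u i = \<lfloor>vec_index u i / h\<rfloor>" by (simp add: k_def)
      have "\<bar>real_of_int \<lfloor>vec_index u i / h\<rfloor>\<bar> \<le> \<bar>vec_index u i / h\<bar> + 1" by linarith
      then show "\<bar>real_of_int (k u i)\<bar> \<le> \<bar>vec_index u i\<bar> / h + 1" using h by (simp add: ki)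
    qed
    also have "\<dots> = (\<Sum>i<n. \<bar>vec_index u i\<bar>) / h + real n" by (simp add: sum.distrib sum_divide_distrib)
    also have "(\<Sum>i<n. \<bar>vec_index u i\<bar>) \<le> sqrt (real n)"
    proof -
      have "(\<Sum>i<n. (vec_index u i)\<^sup>2) = 1"
        using u scalar_prod_sum[of u n u] by (simp add: S_def power2_eq_square)
      then show ?thesis using l1_le_sqrt_l2[of "vec_index u" n] by simp
    qed
    then have "(\<Sum>i<n. \<bar>vec_index u i\<bar>) / h \<le> sqrt (real n) / h" using h by (intro divide_right_mono) auto
    also have "sqrt (real n) / h = real n * (1 / \<eta>)" using n by (simp add: h_def)
    also have "real n * (1 / \<eta>) + real n \<le> real B"
    proof -
      have "1 / \<eta> \<le> real (nat \<lceil>1 / \<eta>\<rceil>)" using \<eta> by (simp add: real_nat_ceiling_ge)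
      then have "real n * (1 / \<eta>) \<le> real n * real (nat \<lceil>1 / \<eta>\<rceil>)" by (intro mult_left_mono) auto
      then show ?thesis by (simp add: B_def algebra_simps)
    qed
    finally show ?thesis by (simp only: of_nat_le_iff)
  qed
  have close: "(u - v) \<diamondop> (u - v) \<le> \<eta>\<^sup>2" if "u \<in> S" "v \<in> S" "k u = k v" for u v
  proof -
    have d: "(vec_index u i - vec_index v i)\<^sup>2 \<le> h\<^sup>2" if i: "i < n" for i
    proof -
      have "\<lfloor>vec_index u i / h\<rfloor> = \<lfloor>vec_index v i / h\<rfloor>"
        using fun_cong[OF \<open>k u = k v\<close>, of i] i by (simp add: k_def)
      then have "\<bar>vec_index u i / h - vec_index v i / h\<bar> \<le> 1" by linarith
      then have "\<bar>vec_index u i - vec_index v i\<bar> / h \<le> 1" using h by (simp flip: diff_divide_distrib)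
      then have "\<bar>vec_index u i - vec_index v i\<bar> \<le> h" using h by simp
      then have "\<bar>vec_index u i - vec_index v i\<bar>\<^sup>2 \<le> h\<^sup>2" by (intro power_mono) auto
      then show ?thesis by simp
    qed
    have "(u - v) \<diamondop> (u - v) = (\<Sum>i<n. (vec_index u i - vec_index v i)\<^sup>2)"
    proof -
      have "u \<in> carrier_vec n" "v \<in> carrier_vec n" using that by (auto simp: S_def)
      then show ?thesis using scalar_prod_sum[of "u - v" n "u - v"] by (simp add: power2_eq_square)
    qed
    also have "\<dots> \<le> (\<Sum>i<n. h\<^sup>2)" by (intro sum_mono d) simp
    finally show ?thesis using nh by simp
  qed
  have K: "finite (k ` S) \<and> real (card (k ` S)) \<le> 2 ^ B * 3 ^ n"
    proof (rule card_bounded_l1_le)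
    show "k ` S \<subseteq> PiE {..<n} (\<lambda>_. UNIV)" unfolding k_def by (intro image_subsetI restrict_PiE_iff[THEN iffD2]) simp
  next
    fix k' assume "k' \<in> k ` S"
    then obtain u where "u \<in> S" "k' = k u" by blast
    then show "(\<Sum>i<n. nat \<bar>k' i\<bar>) \<le> B" using kB[of u] by (simp only:)
  qed
  \<comment> \<open>One sphere point per occupied cell is taken instead of the grid point, so net
    points have norm exactly 1.\<close>
  define N where "N = inv_into S k ` k ` S"
  show thesis
  proof (rule that[of N])
    show "finite N" using K by (simp add: N_def)
    have "card N \<le> card (k ` S)" unfolding N_def using K by (intro card_image_le) auto
    then have "real (card N) \<le> 2 ^ B * 3 ^ n" using K by linarith
    also have "(2::real) ^ B = (2 ^ (nat \<lceil>1 / \<eta>\<rceil> + 1)) ^ n" unfolding B_def by (subst mult.commute) (rule power_mult)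
    also have "\<dots> * 3 ^ n = D ^ n" unfolding D power_mult_distrib by (rule mult.commute)
    finally show "real (card N) \<le> D ^ n" .
    show "v \<in> carrier_vec n \<and> v \<diamondop> v = 1" if "v \<in> N" for v
    proof -
      have "v \<in> S" using that by (auto simp: N_def intro: inv_into_into)
      then show ?thesis by (simp add: S_def)
    qed
    fix u :: "real Matrix.vec" assume "u \<in> carrier_vec n" "u \<diamondop> u = 1"
    then have u: "u \<in> S" by (simp add: S_def)
    have "inv_into S k (k u) \<in> S" "k (inv_into S k (k u)) = k u"
      using u by (auto intro: inv_into_into f_inv_into_f)
    then have "(u - inv_into S k (k u)) \<diamondop> (u - inv_into S k (k u)) \<le> \<eta>\<^sup>2" using close[OF u] by simp
    moreover have "inv_into S k (k u) \<in> N" using u by (simp add: N_def)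
    ultimately show "\<exists>v\<in>N. (u - v) \<diamondop> (u - v) \<le> \<eta>\<^sup>2" by blast
  qed
qed

text \<open>Trades ln n for ln m. If m \<ge> (A n)^2, then ln m \<le> sqrt m is enough; otherwise ln
  m \<le> 2 ln A + 2 ln n. The hypothesis m \<ge> A^2 settles n = 1, where ln n = 0 and the
  condition on the sample size says nothing.\<close>

lemma sample_size_log_bound:
  fixes A :: real
  assumes A: "A \<ge> 1" and m: "real m \<ge> A\<^sup>2" "real m > 1" "real m \<ge> A * (4 * ln A + 2) * real n * ln (real n)" and n: "n > 0"
  shows "A * real n * ln (real m) \<le> real m"
proof (cases "real m \<ge> (A * real n)\<^sup>2")
  case True
  have "ln (sqrt (real m) / 2) \<le> sqrt (real m) / 2 - 1" using m(2) by (intro ln_le_minus_one) simp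
  then have "ln (sqrt (real m)) \<le> sqrt (real m) / 2 - 1 + ln 2" using m(2) by (simp add: ln_div)
  moreover have "ln 2 \<le> (1::real)" using ln_le_minus_one[of 2] by simp
  ultimately have l: "ln (real m) \<le> sqrt (real m)" using m(2) by (simp add: ln_sqrt)
  have "A * real n \<le> sqrt (real m)" using True by (rule real_le_rsqrt)
  then have "A * real n * ln (real m) \<le> sqrt (real m) * sqrt (real m)" using l A m(2) by (intro mult_mono) auto
  then show ?thesis using m(2) by simp
next
  case False
  then have n2: "n \<ge> 2" using m(1) n by (cases "n = 1") auto
  have lnm: "ln (real m) \<le> 2 * ln A + 2 * ln (real n)"
  proof -
    have "ln (real m) \<le> ln ((A * real n)\<^sup>2)" using False m by (intro ln_mono) auto
    also have "\<dots> = 2 * ln A + 2 * ln (real n)" using A n by (simp add: ln_realpow ln_mult algebra_simps)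
    finally show ?thesis .
  qed
  have "ln 2 \<le> ln (real n)" using n2 by (intro ln_mono) auto
  moreover have "ln 2 \<ge> (1/2::real)"
  proof -
    have "ln (1/2) \<le> (1/2 - 1 :: real)" by (intro ln_le_minus_one) simp
    then show ?thesis by (simp add: ln_div)
  qed
  ultimately have l2: "1 \<le> 2 * ln (real n)" by simp
  have "0 \<le> ln A" using A by simp
  then have "2 * ln A * 1 \<le> 2 * ln A * (2 * ln (real n))" using l2 by (intro mult_left_mono) auto
  then have "ln (real m) \<le> (4 * ln A + 2) * ln (real n)" using lnm by (simp add: algebra_simps)
  then have "A * real n * ln (real m) \<le> A * real n * ((4 * ln A + 2) * ln (real n))" using A by (intro mult_left_mono) auto
  then show ?thesis using m(3) by (simp add: mult_ac)
qed

section \<open>Gaussian samples\<close>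

abbreviation gip :: "nat \<Rightarrow> (nat \<times> nat \<Rightarrow> real) \<Rightarrow> nat \<Rightarrow> real Matrix.vec \<Rightarrow> real" where
  "gip n \<omega> j v \<equiv> gauss_vec n \<omega> j \<diamondop> v"

lemma gip_sum: "v \<in> carrier_vec n \<Longrightarrow> gip n \<omega> j v = (\<Sum>i<n. \<omega> (j,i) * vec_index v i)"
  by (simp add: scalar_prod_sum[where n=n] gauss_vec_def)

lemma prob_space_std_normal: "prob_space std_normal_distribution"
  by (rule prob_space_normal_density) simp

lemma prob_space_gauss: "prob_space (gauss_space m n)"
  unfolding gauss_space_def by (intro prob_space_PiM prob_space_std_normal)

lemma gauss_coordinate_measurable:
  assumes "j < m" "i < n"
  shows "(\<lambda>\<omega>. \<omega> (j,i)) \<in> borel_measurable (gauss_space m n)"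
proof -
  have "(\<lambda>\<omega>. \<omega> (j,i)) \<in> measurable (gauss_space m n) std_normal_distribution"
    unfolding gauss_space_def using assms by (intro measurable_component_singleton) auto
  then show ?thesis by simp
qed

lemma gip_measurable:
  assumes "j < m" "v \<in> carrier_vec n"
  shows "(\<lambda>\<omega>. gip n \<omega> j v) \<in> borel_measurable (gauss_space m n)"
  unfolding gip_sum[OF assms(2)] by (intro borel_measurable_sum borel_measurable_times gauss_coordinate_measurable assms) auto

lemma gauss_coordinates_indep:
  "prob_space.indep_vars (gauss_space m n) (\<lambda>_. borel) (\<lambda>i \<omega>. \<omega> i) ({..<m} \<times> {..<n})"
\<comment> \<open>The characterisation of independence by the product law requires a nonempty index
  set.\<close>
proof (cases "{..<m} \<times> {..<n} = {}")
  case True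
  interpret prob_space "gauss_space m n" by (rule prob_space_gauss)
  show ?thesis unfolding True by (simp add: indep_vars_def indep_sets_def)
next
  case False
  let ?I = "{..<m} \<times> {..<n}"
  let ?P = "PiM ?I (\<lambda>_. std_normal_distribution)"
  interpret prob_space ?P by (intro prob_space_PiM prob_space_std_normal)
  have comp: "distr ?P std_normal_distribution (\<lambda>\<omega>. \<omega> i) = std_normal_distribution" if "i \<in> ?I" for i
    by (rule distr_PiM_component) (use that prob_space_std_normal in auto)
  have rv: "(\<lambda>\<omega>. \<omega> i) \<in> measurable ?P std_normal_distribution" if "i \<in> ?I" for i
    by (rule measurable_component_singleton[OF that])
  have "distr ?P ?P (\<lambda>x. restrict x ?I) = distr ?P ?P (\<lambda>x. x)"
    by (intro distr_cong refl) (simp add: space_PiM PiE_restrict)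
  also have "\<dots> = PiM ?I (\<lambda>i. distr ?P std_normal_distribution (\<lambda>\<omega>. \<omega> i))"
    by (simp add: comp cong: PiM_cong)
  finally have "indep_vars (\<lambda>_. std_normal_distribution) (\<lambda>i \<omega>. \<omega> i) ?I"
    by (subst indep_vars_iff_distr_eq_PiM'[OF False]) (use rv in auto)
  then show ?thesis unfolding gauss_space_def by (simp add: indep_vars_def cong: measurable_cong_sets)
qed

lemma gauss_coordinate_distributed:
  assumes "j < m" "i < n"
  shows "distributed (gauss_space m n) lborel (\<lambda>\<omega>. \<omega> (j,i)) std_normal_density"
proof -
  have "distr (PiM ({..<m} \<times> {..<n}) (\<lambda>_. std_normal_distribution)) std_normal_distribution (\<lambda>\<omega>. \<omega> (j,i)) = std_normal_distribution"
    by (rule distr_PiM_component) (use assms prob_space_std_normal in auto)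
  then show ?thesis
    unfolding distributed_def gauss_space_def using gauss_coordinate_measurable[OF assms]
    by (auto simp: gauss_space_def cong: distr_cong)
qed

lemma gip_distributed:
  assumes j: "j < m" and v: "v \<in> carrier_vec n" "v \<diamondop> v = 1"
  shows "distributed (gauss_space m n) lborel (\<lambda>\<omega>. gip n \<omega> j v) std_normal_density"
proof -
  interpret prob_space "gauss_space m n" by (rule prob_space_gauss)
  \<comment> \<open>Zero entries are dropped because they would contribute degenerate normals of
    variance 0.\<close>
  define I where "I = {i. i < n \<and> vec_index v i \<noteq> 0}"
  have sI: "(\<Sum>i\<in>I. (f i) * vec_index v i) = (\<Sum>i<n. f i * vec_index v i)" for f :: "nat \<Rightarrow> real"
    by (rule sum.mono_neutral_left) (auto simp: I_def)
  have sq: "(\<Sum>i\<in>I. (\<bar>vec_index v i\<bar> * 1)\<^sup>2) = 1"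
    using sI[of "vec_index v"] v by (simp add: scalar_prod_sum[where n=n] power2_eq_square)
  have fin: "finite I" by (simp add: I_def)
  have ne: "I \<noteq> {}" using sq by auto
  let ?J = "Pair j ` I"
  have "indep_vars (\<lambda>_. borel) (\<lambda>p \<omega>. 0 + vec_index v (snd p) * \<omega> p) ?J"
  proof -
    have "indep_vars (\<lambda>_. borel) (\<lambda>p \<omega>. \<omega> p) ?J"
      by (rule indep_vars_subset[OF gauss_coordinates_indep]) (use j in \<open>auto simp: I_def\<close>)
    then show ?thesis by (rule indep_vars_compose2[where Y="\<lambda>p x. 0 + vec_index v (snd p) * x"]) simp
  qed
  moreover have "distributed (gauss_space m n) lborel (\<lambda>\<omega>. 0 + vec_index v (snd p) * \<omega> p) (normal_density (0 + vec_index v (snd p) * 0) (\<bar>vec_index v (snd p)\<bar> * 1))"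
    if "p \<in> ?J" for p
    using that j by (intro normal_density_affine) (auto simp: I_def intro!: gauss_coordinate_distributed)
  ultimately have "distributed (gauss_space m n) lborel (\<lambda>\<omega>. \<Sum>p\<in>?J. 0 + vec_index v (snd p) * \<omega> p)
    (normal_density (\<Sum>p\<in>?J. 0 + vec_index v (snd p) * 0) (sqrt (\<Sum>p\<in>?J. (\<bar>vec_index v (snd p)\<bar> * 1)\<^sup>2)))"
    by (intro sum_indep_normal) (use fin ne in \<open>auto simp: I_def\<close>)
  moreover have "(\<Sum>p\<in>?J. 0 + vec_index v (snd p) * \<omega> p) = gip n \<omega> j v" for \<omega> :: "nat \<times> nat \<Rightarrow> real"
    using sI[of "\<lambda>i. \<omega> (j,i)"] by (simp add: gip_sum[OF v(1)] sum.reindex inj_on_def mult.commute)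
  moreover have "(\<Sum>p\<in>?J. (\<bar>vec_index v (snd p)\<bar> * 1)\<^sup>2) = 1"
    using sq by (simp add: sum.reindex inj_on_def)
  ultimately show ?thesis by simp
qed

lemma gip_expectation:
  assumes j: "j < m" and v: "v \<in> carrier_vec n" "v \<diamondop> v = 1" and g: "g \<in> borel_measurable borel"
    and h: "has_bochner_integral lborel (\<lambda>x. std_normal_density x * g x) c"
  shows "integrable (gauss_space m n) (\<lambda>\<omega>. g (gip n \<omega> j v))" "prob_space.expectation (gauss_space m n) (\<lambda>\<omega>. g (gip n \<omega> j v)) = c"
proof -
  note D = gip_distributed[OF j v]
  have "integrable lborel (\<lambda>x. std_normal_density x * g x)" using h by (rule integrable.intros)
  then show "integrable (gauss_space m n) (\<lambda>\<omega>. g (gip n \<omega> j v))"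
    using distributed_integrable[OF D, of g] g by simp
  show "prob_space.expectation (gauss_space m n) (\<lambda>\<omega>. g (gip n \<omega> j v)) = c"
    using distributed_integral[OF D, of g] g has_bochner_integral_integral_eq[OF h] by simp
qed

text \<open>The integrand is twice the normal density of variance 4. The exponent 3/8 = 1/8 + 1/4 is
  the one that the second-order term of the exponential moment below produces.\<close>

lemma std_normal_exp_square:
  "has_bochner_integral lborel (\<lambda>x. std_normal_density x * exp (3 / 8 * x\<^sup>2)) 2"
proof -
  have "std_normal_density x * exp (3 / 8 * x\<^sup>2) = 2 * normal_density 0 2 x" for x
  proof -
    have "exp (- x\<^sup>2 / 2) * exp (3 / 8 * x\<^sup>2) = exp (- x\<^sup>2 / 8)" by (simp flip: exp_add)
    moreover have "sqrt (2 * pi * 2\<^sup>2) = 2 * sqrt (2 * pi)" by (subst real_sqrt_mult) simp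
    ultimately show ?thesis by (simp add: normal_density_def)
  qed
  moreover have "has_bochner_integral lborel (\<lambda>x. 2 * normal_density 0 2 x) (2 * 1)"
    by (intro has_bochner_integral_mult_right) (simp add: has_bochner_integral_iff)
  ultimately show ?thesis by simp
qed

lemma gip_moments:
  assumes j: "j < m" and v: "v \<in> carrier_vec n" "v \<diamondop> v = 1"
  shows "integrable (gauss_space m n) (\<lambda>\<omega>. (gip n \<omega> j v)\<^sup>2)" "prob_space.expectation (gauss_space m n) (\<lambda>\<omega>. (gip n \<omega> j v)\<^sup>2) = 1"
    "integrable (gauss_space m n) (\<lambda>\<omega>. (gip n \<omega> j v) ^ 4)" "prob_space.expectation (gauss_space m n) (\<lambda>\<omega>. (gip n \<omega> j v) ^ 4) = 3"
    "integrable (gauss_space m n) (\<lambda>\<omega>. (gip n \<omega> j v) ^ 6)" "prob_space.expectation (gauss_space m n) (\<lambda>\<omega>. (gip n \<omega> j v) ^ 6) = 15"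
    "integrable (gauss_space m n) (\<lambda>\<omega>. (gip n \<omega> j v) ^ 8)" "prob_space.expectation (gauss_space m n) (\<lambda>\<omega>. (gip n \<omega> j v) ^ 8) = 105"
    "integrable (gauss_space m n) (\<lambda>\<omega>. exp (3 / 8 * (gip n \<omega> j v)\<^sup>2))" "prob_space.expectation (gauss_space m n) (\<lambda>\<omega>. exp (3 / 8 * (gip n \<omega> j v)\<^sup>2)) = 2"
  using gip_expectation[OF j v _ std_normal_moment_even[of 1]] gip_expectation[OF j v _ std_normal_moment_even[of 2]]
    gip_expectation[OF j v _ std_normal_moment_even[of 3]] gip_expectation[OF j v _ std_normal_moment_even[of 4]]
    gip_expectation[OF j v _ std_normal_exp_square]
  by (simp_all add: fact_numeral)

text \<open>Coordinates are grouped by sample index, and each statistic is a function of its own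
  group.\<close>

lemma gip_rows_indep:
  assumes x: "x \<in> carrier_vec n" and v: "v \<in> carrier_vec n" and g: "(\<lambda>p. g (fst p) (snd p)) \<in> borel_measurable (borel \<Otimes>\<^sub>M borel)"
  shows "prob_space.indep_vars (gauss_space m n) (\<lambda>_. borel) (\<lambda>j \<omega>. g (gip n \<omega> j x) (gip n \<omega> j v) :: real) {..<m}"
proof -
  interpret prob_space "gauss_space m n" by (rule prob_space_gauss)
  let ?K = "\<lambda>j. {j} \<times> {..<n}"
  have 1: "indep_vars (\<lambda>j. PiM (?K j) (\<lambda>_. borel)) (\<lambda>j \<omega>. restrict (\<lambda>i. \<omega> i) (?K j)) {..<m}"
    by (rule indep_vars_restrict[OF gauss_coordinates_indep]) (auto simp: disjoint_family_on_def)
  let ?Y = "\<lambda>j f. g (\<Sum>i<n. f (j,i) * vec_index x i) (\<Sum>i<n. f (j,i) * vec_index v i)"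
  have lin: "(\<lambda>f. \<Sum>i<n. f (j,i) * vec_index y i) \<in> borel_measurable (PiM (?K j) (\<lambda>_. borel))" for j and y :: "real Matrix.vec"
    by (intro borel_measurable_sum borel_measurable_times measurable_component_singleton) auto
  have "?Y j \<in> borel_measurable (PiM (?K j) (\<lambda>_. borel))" for j
    using measurable_compose[OF measurable_Pair[OF lin lin] g] by simp
  from indep_vars_compose2[OF 1 this]
  show ?thesis by (simp add: gip_sum[OF x] gip_sum[OF v])
qed

lemma gip_fourth_moment:
  assumes j: "j < m" and y: "y \<in> carrier_vec n"
  shows "integrable (gauss_space m n) (\<lambda>\<omega>. (gip n \<omega> j y) ^ 4)"
    "prob_space.expectation (gauss_space m n) (\<lambda>\<omega>. (gip n \<omega> j y) ^ 4) = 3 * (y \<diamondop> y)\<^sup>2"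
proof -
  have "integrable (gauss_space m n) (\<lambda>\<omega>. (gip n \<omega> j y) ^ 4) \<and>
    prob_space.expectation (gauss_space m n) (\<lambda>\<omega>. (gip n \<omega> j y) ^ 4) = 3 * (y \<diamondop> y)\<^sup>2"
  proof (cases "y = 0\<^sub>v n")
    case True
    then show ?thesis by (simp add: gip_sum)
  next
    case False
    obtain \<tau> v where v: "\<tau> > 0" "\<tau>\<^sup>2 = y \<diamondop> y" "v \<in> carrier_vec n" "v \<diamondop> v = 1" "y = \<tau> \<cdot>\<^sub>v v"
      using unit_vec_normalize[OF y False] .
    have g: "(gip n \<omega> j y) ^ 4 = \<tau> ^ 4 * (gip n \<omega> j v) ^ 4" for \<omega>
      using v(3) by (simp add: gip_sum v(5) power_mult_distrib sum_distrib_left mult.left_commute flip: power_mult_distrib)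
    have "(y \<diamondop> y)\<^sup>2 = \<tau> ^ 4" unfolding v(2)[symmetric] by simp
    then show ?thesis using gip_moments(3,4)[OF j v(3,4)] by (simp add: g)
  qed
  then show "integrable (gauss_space m n) (\<lambda>\<omega>. (gip n \<omega> j y) ^ 4)"
    "prob_space.expectation (gauss_space m n) (\<lambda>\<omega>. (gip n \<omega> j y) ^ 4) = 3 * (y \<diamondop> y)\<^sup>2" by auto
qed

text \<open>The polarisation 12 p^2 k^2 = (p+k)^4 + (p-k)^4 - 2 p^4 - 2 k^4 reduces the mixed moment
  to fourth moments of single Gaussians, so that the joint law of two correlated ones is
  avoided.\<close>

lemma gip_joint_moment:
  assumes j: "j < m" and x: "x \<in> carrier_vec n" "x \<diamondop> x = 1" and v: "v \<in> carrier_vec n" "v \<diamondop> v = 1"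
  shows "integrable (gauss_space m n) (\<lambda>\<omega>. (gip n \<omega> j x)\<^sup>2 * (gip n \<omega> j v)\<^sup>2)"
    "prob_space.expectation (gauss_space m n) (\<lambda>\<omega>. (gip n \<omega> j x)\<^sup>2 * (gip n \<omega> j v)\<^sup>2) = 1 + 2 * (v \<diamondop> x)\<^sup>2"
proof -
  let ?M = "gauss_space m n"
  have g: "(gip n \<omega> j x)\<^sup>2 * (gip n \<omega> j v)\<^sup>2 = ((gip n \<omega> j (x + v)) ^ 4 + (gip n \<omega> j (x - v)) ^ 4 - 2 * (gip n \<omega> j x) ^ 4 - 2 * (gip n \<omega> j v) ^ 4) / 12" for \<omega>
  proof -
    have gc: "gauss_vec n \<omega> j \<in> carrier_vec n" by (simp add: gauss_vec_def)
    have "gip n \<omega> j (x + v) = gip n \<omega> j x + gip n \<omega> j v" "gip n \<omega> j (x - v) = gip n \<omega> j x - gip n \<omega> j v"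
      using scalar_prod_add_distrib[OF gc x(1) v(1)] scalar_prod_minus_distrib[OF gc x(1) v(1)] by auto
    then show ?thesis by (simp only:) (simp add: power4_eq_xxxx power2_eq_square algebra_simps)
  qed
  have c: "x + v \<in> carrier_vec n" "x - v \<in> carrier_vec n" using x v by auto
  note I = gip_fourth_moment(1)[OF j c(1)] gip_fourth_moment(1)[OF j c(2)] gip_fourth_moment(1)[OF j x(1)] gip_fourth_moment(1)[OF j v(1)]
  note E = gip_fourth_moment(2)[OF j c(1)] gip_fourth_moment(2)[OF j c(2)] gip_fourth_moment(2)[OF j x(1)] gip_fourth_moment(2)[OF j v(1)]
  show "integrable ?M (\<lambda>\<omega>. (gip n \<omega> j x)\<^sup>2 * (gip n \<omega> j v)\<^sup>2)"
    unfolding g using I by simp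
  have "(x + v) \<diamondop> (x + v) = 2 + 2 * (v \<diamondop> x)"
    using x v comm_scalar_prod[OF x(1) v(1)]
    by (simp add: add_scalar_prod_distrib[where n=n] scalar_prod_add_distrib[where n=n])
  moreover have "(x - v) \<diamondop> (x - v) = 2 - 2 * (v \<diamondop> x)"
    using scalar_prod_sub_self[OF x(1) v(1)] x v comm_scalar_prod[OF x(1) v(1)] by simp
  ultimately show "prob_space.expectation ?M (\<lambda>\<omega>. (gip n \<omega> j x)\<^sup>2 * (gip n \<omega> j v)\<^sup>2) = 1 + 2 * (v \<diamondop> x)\<^sup>2"
    unfolding g using I E x v by simp (simp add: power2_eq_square algebra_simps)
qed

section \<open>Exponential moments and tail bounds\<close>

lemma exp_le_quadratic: "0 \<le> s \<Longrightarrow> exp s \<le> 1 + s + s\<^sup>2 * exp (s::real)"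
proof -
  assume s: "0 \<le> s"
  have "(1 - s) * exp s \<le> 1"
  proof -
    have "1 - s \<le> exp (- s)" using exp_ge_add_one_self[of "- s"] by simp
    then have "(1 - s) * exp s \<le> exp (- s) * exp s" by (intro mult_right_mono) auto
    then show ?thesis by (simp flip: exp_add)
  qed
  then have "(1 + s) * ((1 - s) * exp s) \<le> (1 + s) * 1" using s by (intro mult_left_mono) auto
  then show ?thesis by (simp add: power2_eq_square algebra_simps)
qed

lemma exp_minus_le_quadratic: "0 \<le> s \<Longrightarrow> exp (- s) \<le> 1 - s + (s::real)\<^sup>2"
proof -
  assume s: "0 \<le> s"
  have "exp (- s) * (1 + s) \<le> exp (- s) * exp s" using exp_ge_add_one_self[of s] by (intro mult_left_mono) auto
  then have "exp (- s) * (1 + s) \<le> 1" by (simp flip: exp_add)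
  also have "1 \<le> (1 - s + s\<^sup>2) * (1 + s)" using s by (simp add: power2_eq_square algebra_simps)
  finally show ?thesis using s by simp
qed

text \<open>y \<le> e^y at y = k^2/32, raised to the fourth power; 32^4 = 2^20.\<close>

lemma eighth_power_le_exp: "(k::real) ^ 8 \<le> 2 ^ 20 * exp (k\<^sup>2 / 8)"
proof -
  have "k\<^sup>2 / 32 \<le> exp (k\<^sup>2 / 32)" using exp_ge_add_one_self[of "k\<^sup>2 / 32"] by linarith
  then have "(k\<^sup>2 / 32) ^ 4 \<le> exp (k\<^sup>2 / 32) ^ 4" by (intro power_mono) auto
  also have "\<dots> = exp (k\<^sup>2 / 8)" by (simp flip: exp_of_nat_mult)
  finally show ?thesis by (simp add: power_divide flip: power_mult)
qed

text \<open>w is a bounded weight and W a majorant of known moment. The level T only restricts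
  \<theta>: through w^2 \<le> 1 + p^4 the second-order coefficient is free of T, so the tail rate
  loses a factor T and not T^2. The mixed term is split by the arithmetic-geometric mean inequality
  into a part in p and a part in k.\<close>

lemma weighted_exp_pointwise:
  fixes w p k T \<theta> W :: real
  assumes w: "0 \<le> w" "w \<le> T" "w\<^sup>2 \<le> 1 + p ^ 4" "w \<le> W" and l: "0 \<le> \<theta>" "\<theta> * T \<le> 1 / 8"
  shows "exp (\<theta> * (w * k\<^sup>2)) \<le> 1 + \<theta> * (W * k\<^sup>2) + \<theta>\<^sup>2 * (1 + p ^ 8 + 2 ^ 19 * exp (3 / 8 * k\<^sup>2))"
proof -
  define s where "s = \<theta> * (w * k\<^sup>2)"
  have s0: "0 \<le> s" using w l by (simp add: s_def)
  have "\<theta> * w \<le> \<theta> * T" using w l by (intro mult_left_mono) auto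
  then have "(\<theta> * w) * k\<^sup>2 \<le> (1 / 8) * k\<^sup>2" using l by (intro mult_right_mono) auto
  then have s8: "s \<le> k\<^sup>2 / 8" by (simp add: s_def mult.assoc)
  define A where "A = k ^ 4 * exp (k\<^sup>2 / 8)"
  have A0: "0 \<le> A" by (simp add: A_def)
  have "s\<^sup>2 * exp s \<le> s\<^sup>2 * exp (k\<^sup>2 / 8)" using s8 by (intro mult_left_mono) auto
  also have "\<dots> = \<theta>\<^sup>2 * (w\<^sup>2 * A)" by (simp add: s_def A_def power_mult_distrib flip: power_mult)
  also have "\<dots> \<le> \<theta>\<^sup>2 * ((1 + p ^ 4) * A)" using w A0 by (intro mult_left_mono mult_right_mono) auto
  also have "\<dots> \<le> \<theta>\<^sup>2 * (1 + p ^ 8 + 2 ^ 19 * exp (3 / 8 * k\<^sup>2))"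
  proof (intro mult_left_mono)
    have "2 * ((1 + p ^ 4) * A) \<le> (1 + p ^ 4)\<^sup>2 + A\<^sup>2" using sum_squares_bound[of "1 + p ^ 4" A] by (simp only: mult.assoc)
    moreover have "(1 + p ^ 4)\<^sup>2 \<le> 2 + 2 * p ^ 8"
    proof -
      have "2 * (1 * p ^ 4) \<le> 1\<^sup>2 + (p ^ 4)\<^sup>2" using sum_squares_bound[of 1 "p ^ 4"] by simp
      then show ?thesis by (simp add: power2_sum flip: power_mult)
    qed
    moreover have "A\<^sup>2 \<le> 2 ^ 20 * exp (3 / 8 * k\<^sup>2)"
    proof -
      have e1: "(exp (k\<^sup>2 / 8))\<^sup>2 = exp (k\<^sup>2 / 4)" by (simp flip: exp_of_nat_mult)
      have e2: "exp (k\<^sup>2 / 8) * exp (k\<^sup>2 / 4) = exp (3 / 8 * k\<^sup>2)" by (simp flip: exp_add)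
      have "A\<^sup>2 = k ^ 8 * exp (k\<^sup>2 / 4)" by (simp add: A_def power_mult_distrib e1 flip: power_mult)
      also have "\<dots> \<le> 2 ^ 20 * exp (k\<^sup>2 / 8) * exp (k\<^sup>2 / 4)" by (intro mult_right_mono eighth_power_le_exp) simp
      finally show ?thesis by (simp only: mult.assoc e2)
    qed
    ultimately have "2 * ((1 + p ^ 4) * A) \<le> 2 + 2 * p ^ 8 + 2 ^ 20 * exp (3 / 8 * k\<^sup>2)" by linarith
    then show "(1 + p ^ 4) * A \<le> 1 + p ^ 8 + 2 ^ 19 * exp (3 / 8 * k\<^sup>2)" by simp
  qed simp
  finally have "s\<^sup>2 * exp s \<le> \<theta>\<^sup>2 * (1 + p ^ 8 + 2 ^ 19 * exp (3 / 8 * k\<^sup>2))" .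
  moreover have "s \<le> \<theta> * (W * k\<^sup>2)" unfolding s_def using w l by (intro mult_left_mono mult_right_mono) auto
  ultimately show ?thesis using exp_le_quadratic[OF s0] unfolding s_def[symmetric] by linarith
qed

text \<open>The majorant W in the linear term has the exact mean e, so no truncated moment is
  computed. The constant comes from E p^8 = 105 and E exp(3/8 k^2) = 2, since 1 + 105 + 2^20 \<le>
  2^21.\<close>

lemma weighted_mgf_bound:
  assumes j: "j < m" and x: "x \<in> carrier_vec n" "x \<diamondop> x = 1" and v: "v \<in> carrier_vec n" "v \<diamondop> v = 1"
    and w: "\<And>p. 0 \<le> w p" "\<And>p. w p \<le> T" "\<And>p. (w p)\<^sup>2 \<le> 1 + p ^ 4" "\<And>p. w p \<le> W p"
    and l: "0 \<le> \<theta>" "\<theta> * T \<le> 1 / 8"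
    and W: "integrable (gauss_space m n) (\<lambda>\<omega>. W (gip n \<omega> j x) * (gip n \<omega> j v)\<^sup>2)"
      "prob_space.expectation (gauss_space m n) (\<lambda>\<omega>. W (gip n \<omega> j x) * (gip n \<omega> j v)\<^sup>2) = e"
  shows "(\<integral>\<^sup>+\<omega>. ennreal (exp (\<theta> * (w (gip n \<omega> j x) * (gip n \<omega> j v)\<^sup>2))) \<partial>gauss_space m n)
     \<le> ennreal (exp (\<theta> * e + 2 ^ 21 * \<theta>\<^sup>2))"
proof -
  interpret prob_space "gauss_space m n" by (rule prob_space_gauss)
  let ?R = "\<lambda>\<omega>. 1 + \<theta> * (W (gip n \<omega> j x) * (gip n \<omega> j v)\<^sup>2) + \<theta>\<^sup>2 * (1 + (gip n \<omega> j x) ^ 8 + 2 ^ 19 * exp (3 / 8 * (gip n \<omega> j v)\<^sup>2))"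
  have R: "integrable (gauss_space m n) ?R"
    using W(1) gip_moments(7)[OF j x] gip_moments(9)[OF j v] by simp
  have ER: "expectation ?R = 1 + \<theta> * e + \<theta>\<^sup>2 * (1 + 105 + 2 ^ 19 * 2)"
    using W gip_moments(7,8)[OF j x] gip_moments(9,10)[OF j v] by (simp add: prob_space)
  have pt: "exp (\<theta> * (w (gip n \<omega> j x) * (gip n \<omega> j v)\<^sup>2)) \<le> ?R \<omega>" for \<omega>
    by (rule weighted_exp_pointwise[OF w(1,2,3,4) l])
  have "(\<integral>\<^sup>+\<omega>. ennreal (exp (\<theta> * (w (gip n \<omega> j x) * (gip n \<omega> j v)\<^sup>2))) \<partial>gauss_space m n) \<le> (\<integral>\<^sup>+\<omega>. ennreal (?R \<omega>) \<partial>gauss_space m n)"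
    by (intro nn_integral_mono ennreal_leI pt)
  also have "\<dots> = ennreal (expectation ?R)"
    by (rule nn_integral_eq_integral[OF R]) (intro AE_I2 order_trans[OF exp_ge_zero pt])
  also have "\<dots> \<le> ennreal (exp (\<theta> * e + 2 ^ 21 * \<theta>\<^sup>2))"
  proof (rule ennreal_leI)
    have "\<theta>\<^sup>2 * (1 + 105 + 2 ^ 19 * 2) \<le> \<theta>\<^sup>2 * 2 ^ 21" by (intro mult_left_mono) auto
    then show "expectation ?R \<le> exp (\<theta> * e + 2 ^ 21 * \<theta>\<^sup>2)"
      unfolding ER using exp_ge_add_one_self[of "\<theta> * e + 2 ^ 21 * \<theta>\<^sup>2"] mult.commute[of "\<theta>\<^sup>2" "2 ^ 21"] by linarith
  qed
  finally show ?thesis .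
qed

lemma (in prob_space) bounded_mgf_lower:
  assumes X: "random_variable borel X" "\<And>\<omega>. 0 \<le> X \<omega>" "\<And>\<omega>. X \<omega> \<le> B" and e: "e \<le> expectation X" and l: "0 \<le> \<theta>"
  shows "(\<integral>\<^sup>+\<omega>. ennreal (exp (- \<theta> * X \<omega>)) \<partial>M) \<le> ennreal (exp (- \<theta> * e + \<theta>\<^sup>2 * B\<^sup>2))"
proof -
  have iX: "integrable M X" by (rule integrable_const_bound[where B=B]) (use X in auto)
  let ?R = "\<lambda>\<omega>. 1 - \<theta> * X \<omega> + \<theta>\<^sup>2 * B\<^sup>2"
  have pt: "exp (- \<theta> * X \<omega>) \<le> ?R \<omega>" for \<omega>
  proof -
    have "(X \<omega>)\<^sup>2 \<le> B\<^sup>2" using X by (intro power_mono) auto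
    then have "\<theta>\<^sup>2 * (X \<omega>)\<^sup>2 \<le> \<theta>\<^sup>2 * B\<^sup>2" by (intro mult_left_mono) auto
    then show ?thesis using exp_minus_le_quadratic[of "\<theta> * X \<omega>"] X l by (simp add: power_mult_distrib)
  qed
  have "(\<integral>\<^sup>+\<omega>. ennreal (exp (- \<theta> * X \<omega>)) \<partial>M) \<le> (\<integral>\<^sup>+\<omega>. ennreal (?R \<omega>) \<partial>M)"
    by (intro nn_integral_mono ennreal_leI pt)
  also have "\<dots> = ennreal (expectation ?R)"
    by (rule nn_integral_eq_integral) (use iX in \<open>auto intro!: AE_I2 order_trans[OF exp_ge_zero pt]\<close>)
  also have "\<dots> \<le> ennreal (exp (- \<theta> * e + \<theta>\<^sup>2 * B\<^sup>2))"
  proof (rule ennreal_leI)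
    have "expectation ?R = 1 - \<theta> * expectation X + \<theta>\<^sup>2 * B\<^sup>2" using iX by (simp add: prob_space)
    moreover have "\<theta> * e \<le> \<theta> * expectation X" using e l by (intro mult_left_mono)
    ultimately show "expectation ?R \<le> exp (- \<theta> * e + \<theta>\<^sup>2 * B\<^sup>2)"
      using exp_ge_add_one_self[of "- \<theta> * e + \<theta>\<^sup>2 * B\<^sup>2"] by linarith
  qed
  finally show ?thesis .
qed

text \<open>Nonnegative integrals are used so that the exponentials enter without integrability
  obligations.\<close>

lemma (in prob_space) indep_Chernoff:
  assumes ind: "indep_vars (\<lambda>_. borel) Y {..<m::nat}"
    and mgf: "\<And>j. j < m \<Longrightarrow> (\<integral>\<^sup>+\<omega>. ennreal (exp (Y j \<omega>)) \<partial>M) \<le> ennreal (exp b)"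
  shows "prob {\<omega>\<in>space M. (\<Sum>j<m. Y j \<omega>) \<ge> t} \<le> exp (real m * b - t)"
proof -
  have rv: "random_variable borel (Y j)" if "j < m" for j using ind that by (auto simp: indep_vars_def)
  have rvs: "random_variable borel (\<lambda>\<omega>. \<Sum>j<m. Y j \<omega>)" by (intro borel_measurable_sum rv) simp
  have "emeasure M {\<omega>\<in>space M. (\<Sum>j<m. Y j \<omega>) \<ge> t} = (\<integral>\<^sup>+\<omega>. indicator {\<omega>\<in>space M. (\<Sum>j<m. Y j \<omega>) \<ge> t} \<omega> \<partial>M)"
    by (intro nn_integral_indicator[symmetric] borel_measurable_le[OF _ rvs]) simp
  also have "\<dots> \<le> (\<integral>\<^sup>+\<omega>. ennreal (exp (- t)) * (\<Prod>j<m. ennreal (exp (Y j \<omega>))) \<partial>M)"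
  proof (rule nn_integral_mono)
    fix \<omega>
    have eq: "ennreal (exp (- t)) * (\<Prod>j<m. ennreal (exp (Y j \<omega>))) = ennreal (exp ((\<Sum>j<m. Y j \<omega>) - t))"
      by (simp add: prod_ennreal prod_nonneg exp_sum exp_diff exp_minus divide_inverse mult.commute flip: ennreal_mult)
    show "indicator {\<omega>\<in>space M. (\<Sum>j<m. Y j \<omega>) \<ge> t} \<omega> \<le> ennreal (exp (- t)) * (\<Prod>j<m. ennreal (exp (Y j \<omega>)))"
      unfolding eq by (auto simp: indicator_def simp flip: ennreal_1 intro!: ennreal_leI)
  qed
  also have "\<dots> = ennreal (exp (- t)) * (\<integral>\<^sup>+\<omega>. (\<Prod>j<m. ennreal (exp (Y j \<omega>))) \<partial>M)"
    using rv by (intro nn_integral_cmult borel_measurable_prod_ennreal) auto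
  also have "(\<integral>\<^sup>+\<omega>. (\<Prod>j<m. ennreal (exp (Y j \<omega>))) \<partial>M) = (\<Prod>j<m. \<integral>\<^sup>+\<omega>. ennreal (exp (Y j \<omega>)) \<partial>M)"
    by (intro indep_vars_nn_integral indep_vars_compose2[OF ind]) auto
  also have "ennreal (exp (- t)) * \<dots> \<le> ennreal (exp (- t)) * (\<Prod>j<m. ennreal (exp b))"
    by (intro mult_left_mono prod_mono_ennreal mgf) auto
  also have "\<dots> = ennreal (exp (real m * b - t))"
  proof -
    have "exp (real m * b - t) = exp (- t) * exp b ^ m"
      by (simp add: exp_diff exp_minus divide_inverse exp_of_nat_mult exp_of_nat2_mult mult.commute)
    then show ?thesis by (simp add: ennreal_power ennreal_mult)
  qed
  finally show ?thesis by (simp add: emeasure_eq_measure)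
qed

section \<open>From the net to the sphere\<close>

lemma sqrt_emp_mean_triangle:
  "sqrt (emp_mean m (\<lambda>j. (f j + g j)\<^sup>2)) \<le> sqrt (emp_mean m (\<lambda>j. (f j)\<^sup>2)) + sqrt (emp_mean m (\<lambda>j. (g j)\<^sup>2))"
proof -
  have e: "sqrt (emp_mean m (\<lambda>j. (h j)\<^sup>2)) = sqrt (1 / real m) * L2_set h {..<m}" for h :: "nat \<Rightarrow> real"
    unfolding emp_mean_def L2_set_def by (rule real_sqrt_mult)
  have "sqrt (1 / real m) * L2_set (\<lambda>j. f j + g j) {..<m} \<le> sqrt (1 / real m) * (L2_set f {..<m} + L2_set g {..<m})"
    by (intro mult_left_mono L2_set_triangle_ineq) simp
  then show ?thesis by (simp add: e distrib_left)
qed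

lemma scalar_prod_Cauchy_Schwarz:
  fixes a u :: "real Matrix.vec"
  assumes "a \<in> carrier_vec n" "u \<in> carrier_vec n"
  shows "(a \<diamondop> u)\<^sup>2 \<le> (a \<diamondop> a) * (u \<diamondop> u)"
  using assms Cauchy_Schwarz_ineq_sum[of "vec_index a" "vec_index u" "{..<n}"]
  by (simp add: scalar_prod_sum[where n=n] power2_eq_square)

definition is_sphere_net :: "nat \<Rightarrow> real \<Rightarrow> real Matrix.vec set \<Rightarrow> bool" where
  "is_sphere_net n \<eta> N \<longleftrightarrow> (\<forall>v\<in>N. v \<in> carrier_vec n \<and> v \<diamondop> v = 1) \<and>
     (\<forall>u\<in>carrier_vec n. u \<diamondop> u = 1 \<longrightarrow> (\<exists>v\<in>N. (u - v) \<diamondop> (u - v) \<le> \<eta>\<^sup>2))"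

text \<open>A weighted empirical L2 seminorm. With b_j = <a_j,x> its square is
  \<open>S\<^sub>2\<close>; with b_j = 1 it is the plain second moment. Being a seminorm is what
  carries upper bounds from the net to the sphere.\<close>

definition wnorm :: "nat \<Rightarrow> (nat \<Rightarrow> real Matrix.vec) \<Rightarrow> (nat \<Rightarrow> real) \<Rightarrow> real Matrix.vec \<Rightarrow> real" where
  "wnorm m a b u = sqrt (emp_mean m (\<lambda>j. (b j * (a j \<diamondop> u))\<^sup>2))"

lemma wnorm_nonneg: "0 \<le> wnorm m a b u"
  by (auto simp: wnorm_def intro!: emp_mean_nonneg)

lemma wnorm_sq: "(wnorm m a b u)\<^sup>2 = emp_mean m (\<lambda>j. (b j * (a j \<diamondop> u))\<^sup>2)"
  unfolding wnorm_def by (intro real_sqrt_pow2 emp_mean_nonneg) simp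

lemma wnorm_diff:
  assumes a: "\<And>j. a j \<in> carrier_vec n" and uv: "u \<in> carrier_vec n" "v \<in> carrier_vec n"
  shows "wnorm m a b u \<le> wnorm m a b v + wnorm m a b (u - v)"
proof -
  have "b j * (a j \<diamondop> u) = b j * (a j \<diamondop> v) + b j * (a j \<diamondop> (u - v))" for j
    unfolding scalar_prod_minus_distrib[OF a uv] by (simp add: algebra_simps)
  then show ?thesis
    using sqrt_emp_mean_triangle[of m "\<lambda>j. b j * (a j \<diamondop> v)" "\<lambda>j. b j * (a j \<diamondop> (u - v))"]
    by (simp only: wnorm_def)
qed

lemma wnorm_smult:
  assumes a: "\<And>j. a j \<in> carrier_vec n" and v: "v \<in> carrier_vec n" and \<tau>: "0 \<le> \<tau>"
  shows "wnorm m a b (\<tau> \<cdot>\<^sub>v v) = \<tau> * wnorm m a b v"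
proof -
  have "(b j * (a j \<diamondop> (\<tau> \<cdot>\<^sub>v v)))\<^sup>2 = \<tau>\<^sup>2 * (b j * (a j \<diamondop> v))\<^sup>2" for j
    using a v by (simp add: power_mult_distrib)
  then show ?thesis using \<tau> by (simp add: wnorm_def emp_mean_cmult real_sqrt_mult)
qed

lemma wnorm_small:
  assumes a: "\<And>j. a j \<in> carrier_vec n" and d: "d \<in> carrier_vec n" "d \<diamondop> d \<le> \<eta>\<^sup>2" and \<eta>: "0 < \<eta>"
    and B: "\<And>v. v \<in> carrier_vec n \<Longrightarrow> v \<diamondop> v = 1 \<Longrightarrow> wnorm m a b v \<le> B" and B0: "0 \<le> B"
  shows "wnorm m a b d \<le> \<eta> * B"
proof (cases "d = 0\<^sub>v n")
  case True
  have "a j \<diamondop> 0\<^sub>v n = 0" for j using a by simp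
  then show ?thesis using True \<eta> B0 by (simp add: wnorm_def emp_mean_def)
next
  case False
  obtain \<tau> v where v: "\<tau> > 0" "\<tau>\<^sup>2 = d \<diamondop> d" "v \<in> carrier_vec n" "v \<diamondop> v = 1" "d = \<tau> \<cdot>\<^sub>v v"
    using unit_vec_normalize[OF d(1) False] .
  have "wnorm m a b d = \<tau> * wnorm m a b v"
    unfolding v(5) by (rule wnorm_smult[OF a v(3)]) (use v(1) in simp)
  also have "\<dots> \<le> \<eta> * B"
  proof (rule mult_mono)
    show "\<tau> \<le> \<eta>"
    proof (rule power2_le_imp_le)
      show "\<tau>\<^sup>2 \<le> \<eta>\<^sup>2" using v(2) d(2) by simp
    qed (use \<eta> in simp)
    show "wnorm m a b v \<le> B" by (rule B[OF v(3,4)])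
  qed (use \<eta> wnorm_nonneg in auto)
  finally show ?thesis .
qed

text \<open>A crude bound that serves to make the supremum over the sphere finite.\<close>

lemma wnorm_bounded:
  assumes a: "\<And>j. a j \<in> carrier_vec n" and u: "u \<in> carrier_vec n" "u \<diamondop> u = 1"
  shows "wnorm m a b u \<le> sqrt (emp_mean m (\<lambda>j. (b j)\<^sup>2 * (a j \<diamondop> a j)))"
  unfolding wnorm_def power_mult_distrib
  using scalar_prod_Cauchy_Schwarz[OF a u(1)] u
  by (intro real_sqrt_le_mono emp_mean_mono mult_left_mono) auto

text \<open>The finite supremum M over the sphere bounds itself: M \<le> \<beta> + \<eta> M, so
  \<eta> \<le> 1/10 gives M \<le> 10/9 \<beta>.\<close>

lemma wnorm_net_bound:
  assumes a: "\<And>j. a j \<in> carrier_vec n" and net: "is_sphere_net n \<eta> N" and \<eta>: "0 < \<eta>" "\<eta> \<le> 1/10"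
    and \<beta>: "\<And>v. v \<in> N \<Longrightarrow> wnorm m a b v \<le> \<beta>" and u: "u \<in> carrier_vec n" "u \<diamondop> u = 1"
  shows "wnorm m a b u \<le> 10 / 9 * \<beta>"
proof -
  define S where "S = wnorm m a b ` {u \<in> carrier_vec n. u \<diamondop> u = 1}"
  have bdd: "bdd_above S"
    unfolding S_def
  proof (rule bdd_aboveI2)
    fix w :: "real Matrix.vec" assume "w \<in> {u \<in> carrier_vec n. u \<diamondop> u = 1}"
    then have "w \<in> carrier_vec n" "w \<diamondop> w = 1" by auto
    then show "wnorm m a b w \<le> sqrt (emp_mean m (\<lambda>j. (b j)\<^sup>2 * (a j \<diamondop> a j)))" by (rule wnorm_bounded[OF a])
  qed
  have up: "wnorm m a b v \<le> Sup S" if "v \<in> carrier_vec n" "v \<diamondop> v = 1" for v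
    using that by (intro cSup_upper bdd) (auto simp: S_def)
  have S0: "0 \<le> Sup S" using up[OF u] wnorm_nonneg[of m a b u] by linarith
  have "s \<le> \<beta> + \<eta> * Sup S" if sS: "s \<in> S" for s
  proof -
    obtain w where w: "w \<in> carrier_vec n" "w \<diamondop> w = 1" "s = wnorm m a b w" using sS by (auto simp: S_def)
    obtain v where v: "v \<in> N" "(w - v) \<diamondop> (w - v) \<le> \<eta>\<^sup>2" "v \<in> carrier_vec n"
      using net w(1,2) unfolding is_sphere_net_def by blast
    have "w - v \<in> carrier_vec n" using w v by simp
    then have "wnorm m a b (w - v) \<le> \<eta> * Sup S" by (rule wnorm_small[OF a _ v(2) \<eta>(1) up S0])
    then show ?thesis using wnorm_diff[OF _ w(1) v(3), where a=a and m=m and b=b] \<beta>[OF v(1)] w(3) a by fastforce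
  qed
  then have "Sup S \<le> \<beta> + \<eta> * Sup S" using u by (intro cSup_least) (auto simp: S_def)
  moreover have "\<eta> * Sup S \<le> 1/10 * Sup S" using \<eta> S0 by (intro mult_right_mono) auto
  ultimately have "Sup S \<le> 10 / 9 * \<beta>" by simp
  then show ?thesis using up[OF u] by linarith
qed

lemma square_ip_close:
  fixes u v x :: "real Matrix.vec"
  assumes u: "u \<in> carrier_vec n" "u \<diamondop> u = 1" and v: "v \<in> carrier_vec n" "v \<diamondop> v = 1"
    and x: "x \<in> carrier_vec n" "x \<diamondop> x = 1" and d: "(u - v) \<diamondop> (u - v) \<le> \<eta>\<^sup>2" and \<eta>: "0 < \<eta>"
  shows "\<bar>(u \<diamondop> x)\<^sup>2 - (v \<diamondop> x)\<^sup>2\<bar> \<le> 2 * \<eta>"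
proof -
  have "((u - v) \<diamondop> x)\<^sup>2 \<le> \<eta>\<^sup>2"
    using scalar_prod_Cauchy_Schwarz[of "u - v" n x] u v x d by simp
  then have "\<bar>(u - v) \<diamondop> x\<bar> \<le> \<eta>" using \<eta> by (metis abs_le_square_iff abs_of_pos)
  then have 1: "\<bar>u \<diamondop> x - v \<diamondop> x\<bar> \<le> \<eta>" using minus_scalar_prod_distrib[OF u(1) v(1) x(1)] by simp
  have "\<bar>u \<diamondop> x\<bar> \<le> 1" "\<bar>v \<diamondop> x\<bar> \<le> 1"
    using abs_scalar_prod_le_1[OF u(1) x(1) u(2) x(2)] abs_scalar_prod_le_1[OF v(1) x(1) v(2) x(2)] .
  then have "\<bar>u \<diamondop> x - v \<diamondop> x\<bar> * \<bar>u \<diamondop> x + v \<diamondop> x\<bar> \<le> \<eta> * 2"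
    using 1 \<eta> by (intro mult_mono) auto
  moreover have "(u \<diamondop> x)\<^sup>2 - (v \<diamondop> x)\<^sup>2 = (u \<diamondop> x - v \<diamondop> x) * (u \<diamondop> x + v \<diamondop> x)"
    by (simp add: power2_eq_square algebra_simps)
  ultimately show ?thesis by (simp add: abs_mult)
qed

text \<open>The mean moves by at most K times the mean of |<a_j, u - v>|. Cauchy-Schwarz bounds the
  latter by the unweighted seminorm of u - v, and this seminorm is at most 2 on the sphere.\<close>

lemma lipschitz_mean_close:
  assumes a: "\<And>j. a j \<in> carrier_vec n" and net: "is_sphere_net n \<eta> N" and \<eta>: "0 < \<eta>" "\<eta> \<le> 1/10"
    and A1: "\<And>v. v \<in> N \<Longrightarrow> emp_mean m (\<lambda>j. (a j \<diamondop> v)\<^sup>2) \<le> 2"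
    and u: "u \<in> carrier_vec n" and v: "v \<in> carrier_vec n" and d: "(u - v) \<diamondop> (u - v) \<le> \<eta>\<^sup>2"
    and m: "m > 0" and lip: "\<And>j k k'. \<bar>F j k - F j k'\<bar> \<le> K * \<bar>k - k'\<bar>" and K: "0 \<le> K"
  shows "emp_mean m (\<lambda>j. F j (a j \<diamondop> v)) \<le> emp_mean m (\<lambda>j. F j (a j \<diamondop> u)) + 2 * K * \<eta>"
proof -
  let ?w = "wnorm m a (\<lambda>_. 1)"
  have w32: "?w w \<le> 3/2" if "w \<in> N" for w
  proof (rule power2_le_imp_le)
    have "(?w w)\<^sup>2 \<le> 2" using A1[OF that] by (simp add: wnorm_sq)
    also have "\<dots> \<le> (3/2)\<^sup>2" by (simp add: power2_eq_square)
    finally show "(?w w)\<^sup>2 \<le> (3/2)\<^sup>2" .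
  qed simp
  have "?w w \<le> 2" if "w \<in> carrier_vec n" "w \<diamondop> w = 1" for w using wnorm_net_bound[OF a net \<eta> w32 that] by simp
  then have wd: "?w (u - v) \<le> \<eta> * 2" by (intro wnorm_small[OF a _ d \<eta>(1)]) (use u v in auto)
  have "(emp_mean m (\<lambda>j. \<bar>a j \<diamondop> (u - v)\<bar> * 1))\<^sup>2 \<le> emp_mean m (\<lambda>j. \<bar>a j \<diamondop> (u - v)\<bar>\<^sup>2) * emp_mean m (\<lambda>j. 1\<^sup>2)"
    by (rule emp_mean_Cauchy_Schwarz)
  then have "(emp_mean m (\<lambda>j. \<bar>a j \<diamondop> (u - v)\<bar>))\<^sup>2 \<le> (?w (u - v))\<^sup>2"
    using m by (simp add: wnorm_sq emp_mean_const)
  then have "emp_mean m (\<lambda>j. \<bar>a j \<diamondop> (u - v)\<bar>) \<le> ?w (u - v)"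
    by (rule power2_le_imp_le) (rule wnorm_nonneg)
  then have "K * emp_mean m (\<lambda>j. \<bar>a j \<diamondop> (u - v)\<bar>) \<le> K * (\<eta> * 2)" using wd K by (intro mult_left_mono) auto
  moreover have "emp_mean m (\<lambda>j. F j (a j \<diamondop> v)) \<le> emp_mean m (\<lambda>j. F j (a j \<diamondop> u) + K * \<bar>a j \<diamondop> (u - v)\<bar>)"
  proof (rule emp_mean_mono)
    fix j
    show "F j (a j \<diamondop> v) \<le> F j (a j \<diamondop> u) + K * \<bar>a j \<diamondop> (u - v)\<bar>"
      using lip[of j "a j \<diamondop> v" "a j \<diamondop> u"] unfolding scalar_prod_minus_distrib[OF a u v] abs_minus_commute[of "a j \<diamondop> u"]
      by linarith
  qed
  ultimately show ?thesis by (simp add: emp_mean_add emp_mean_cmult mult_ac)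
qed

text \<open>The truncated square is the square of min |k| (sqrt L), which gives the constant 2 sqrt
  L, weakened to 2 L by L \<ge> 1.\<close>

lemma min_square_lipschitz:
  fixes L :: real
  assumes "L \<ge> 1"
  shows "\<bar>min (k\<^sup>2) L - min (k'\<^sup>2) L\<bar> \<le> 2 * L * \<bar>k - k'\<bar>"
proof -
  define M where "M = sqrt L"
  have M: "0 \<le> M" "L = M\<^sup>2" using assms by (auto simp: M_def)
  have MleL: "M \<le> L" 
  proof -
    have "1 \<le> M" using assms by (simp add: M_def)
    then have "M * 1 \<le> M * M" by (intro mult_left_mono) auto
    then show ?thesis by (simp add: M(2) power2_eq_square)
  qed
  have e: "min (k\<^sup>2) L = (min \<bar>k\<bar> M)\<^sup>2" for k
  proof (cases "\<bar>k\<bar> \<le> M")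
    case True
    then have "\<bar>k\<bar>\<^sup>2 \<le> M\<^sup>2" by (intro power_mono) auto
    then show ?thesis using True M by simp
  next
    case False
    then have "M\<^sup>2 \<le> \<bar>k\<bar>\<^sup>2" using M by (intro power_mono) auto
    then show ?thesis using False M by simp
  qed
  have "\<bar>min \<bar>k\<bar> M - min \<bar>k'\<bar> M\<bar> * \<bar>min \<bar>k\<bar> M + min \<bar>k'\<bar> M\<bar> \<le> \<bar>k - k'\<bar> * (2 * M)"
    by (intro mult_mono) (use M(1) in auto)
  also have "\<dots> \<le> \<bar>k - k'\<bar> * (2 * L)" using MleL by (intro mult_left_mono) auto
  finally show ?thesis
    unfolding e unfolding power2_eq_square square_diff_square_factored abs_mult by (simp only: mult_ac)
qed

lemma min_square_product_lipschitz:
  fixes L :: real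
  assumes "L \<ge> 1"
  shows "\<bar>min (p\<^sup>2) L * min (k\<^sup>2) L - min (p\<^sup>2) L * min (k'\<^sup>2) L\<bar> \<le> 4 * L\<^sup>2 * \<bar>k - k'\<bar>"
    "\<bar>(min (k\<^sup>2) L)\<^sup>2 - (min (k'\<^sup>2) L)\<^sup>2\<bar> \<le> 4 * L\<^sup>2 * \<bar>k - k'\<bar>"
proof -
  note l = min_square_lipschitz[OF assms, of k k']
  have b: "0 \<le> min (q\<^sup>2) L" "min (q\<^sup>2) L \<le> L" for q using assms by auto
  have "min (p\<^sup>2) L * \<bar>min (k\<^sup>2) L - min (k'\<^sup>2) L\<bar> \<le> L * (2 * L * \<bar>k - k'\<bar>)"
    by (intro mult_mono b l) (use assms in auto)
  also have "\<dots> \<le> 4 * L\<^sup>2 * \<bar>k - k'\<bar>" using assms by (simp add: power2_eq_square)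
  finally show "\<bar>min (p\<^sup>2) L * min (k\<^sup>2) L - min (p\<^sup>2) L * min (k'\<^sup>2) L\<bar> \<le> 4 * L\<^sup>2 * \<bar>k - k'\<bar>"
    using b[of p] unfolding right_diff_distrib[symmetric] abs_mult by simp
  have "\<bar>min (k\<^sup>2) L + min (k'\<^sup>2) L\<bar> * \<bar>min (k\<^sup>2) L - min (k'\<^sup>2) L\<bar> \<le> (2 * L) * (2 * L * \<bar>k - k'\<bar>)"
    by (intro mult_mono l) (use assms b[of k] b[of k'] in auto)
  moreover have "(min (k\<^sup>2) L)\<^sup>2 - (min (k'\<^sup>2) L)\<^sup>2 = (min (k\<^sup>2) L + min (k'\<^sup>2) L) * (min (k\<^sup>2) L - min (k'\<^sup>2) L)"
    by (simp add: power2_eq_square algebra_simps)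
  ultimately show "\<bar>(min (k\<^sup>2) L)\<^sup>2 - (min (k'\<^sup>2) L)\<^sup>2\<bar> \<le> 4 * L\<^sup>2 * \<bar>k - k'\<bar>"
    by (simp add: abs_mult power2_eq_square)
qed

text \<open>The upper bound, which has no truncation, travels through the seminorm; the lower bounds
  travel through Lipschitz truncations and are enlarged only afterwards. Two levels are needed: the
  local argument chooses \<epsilon> small in terms of L, so L can only give a fixed error, whereas
  L' may depend on \<epsilon>.\<close>

lemma good_sample_from_net:
  assumes a: "\<And>j. a j \<in> carrier_vec n" and x: "x \<in> carrier_vec n" "x \<diamondop> x = 1" and m: "m > 0"
    and net: "is_sphere_net n \<eta> N"
    and L: "1 \<le> L" "L \<le> L'" and \<epsilon>: "0 < \<epsilon>" "\<epsilon> \<le> 1/100" and \<eta>: "\<eta> = \<epsilon> / (120 * L'\<^sup>2)"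
    and A1: "\<And>v. v \<in> N \<Longrightarrow> emp_mean m (\<lambda>j. (a j \<diamondop> v)\<^sup>2) \<le> 2"
    and A2: "\<And>v. v \<in> N \<Longrightarrow> emp_mean m (\<lambda>j. (a j \<diamondop> x)\<^sup>2 * (a j \<diamondop> v)\<^sup>2) \<le> 1 + 2 * (v \<diamondop> x)\<^sup>2 + \<epsilon> / 2"
    and A3: "\<And>v. v \<in> N \<Longrightarrow> emp_mean m (\<lambda>j. min ((a j \<diamondop> x)\<^sup>2) L' * min ((a j \<diamondop> v)\<^sup>2) L') \<ge> 1 + 2 * (v \<diamondop> x)\<^sup>2 - \<epsilon> / 2"
    and A4: "\<And>v. v \<in> N \<Longrightarrow> emp_mean m (\<lambda>j. (min ((a j \<diamondop> v)\<^sup>2) L')\<^sup>2) \<ge> 3 - \<epsilon> / 2"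
    and A5: "\<And>v. v \<in> N \<Longrightarrow> emp_mean m (\<lambda>j. min ((a j \<diamondop> x)\<^sup>2) L * min ((a j \<diamondop> v)\<^sup>2) L) \<ge> 1 + 2 * (v \<diamondop> x)\<^sup>2 - 1/12"
  shows "good_sample n m \<epsilon> L a x"
  unfolding good_sample_def
proof (intro ballI impI)
  fix u :: "real Matrix.vec" assume u: "u \<in> carrier_vec n" "u \<diamondop> u = 1"
  have L': "1 \<le> L'" using L by simp
  have L2: "1 \<le> L'\<^sup>2" using L' by simp
  have \<eta>L: "\<eta> * L'\<^sup>2 = \<epsilon> / 120" using L' by (simp add: \<eta>)
  have \<eta>0: "0 < \<eta>" using \<epsilon> L' unfolding \<eta> by (intro divide_pos_pos) auto
  have \<eta>1: "\<eta> \<le> \<epsilon> / 120"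
  proof -
    have "\<eta> * 1 \<le> \<eta> * L'\<^sup>2" using \<eta>0 L2 by (intro mult_left_mono) auto
    then show ?thesis using \<eta>L by simp
  qed
  have \<eta>2: "\<eta> \<le> 1/10" using \<eta>1 \<epsilon> by simp
  have N: "v \<in> carrier_vec n \<and> v \<diamondop> v = 1" if "v \<in> N" for v using net that unfolding is_sphere_net_def by blast
  obtain v where v: "v \<in> N" "(u - v) \<diamondop> (u - v) \<le> \<eta>\<^sup>2" using net u unfolding is_sphere_net_def by blast
  have vc: "v \<in> carrier_vec n" "v \<diamondop> v = 1" using N[OF v(1)] by auto
  have c: "\<bar>(u \<diamondop> x)\<^sup>2 - (v \<diamondop> x)\<^sup>2\<bar> \<le> 2 * \<eta>"
    by (rule square_ip_close[OF u vc x v(2) \<eta>0])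
  note lip = lipschitz_mean_close[OF a net \<eta>0 \<eta>2 A1 u(1) vc(1) v(2) m]
  have l3: "emp_mean m (\<lambda>j. min ((a j \<diamondop> x)\<^sup>2) L' * min ((a j \<diamondop> v)\<^sup>2) L') \<le> emp_mean m (\<lambda>j. min ((a j \<diamondop> x)\<^sup>2) L' * min ((a j \<diamondop> u)\<^sup>2) L') + 2 * (4 * L'\<^sup>2) * \<eta>"
    by (rule lip[of "\<lambda>j k. min ((a j \<diamondop> x)\<^sup>2) L' * min (k\<^sup>2) L'"]) (assumption, rule min_square_product_lipschitz(1)[OF L'], simp)
  have l5: "emp_mean m (\<lambda>j. min ((a j \<diamondop> x)\<^sup>2) L * min ((a j \<diamondop> v)\<^sup>2) L) \<le> emp_mean m (\<lambda>j. min ((a j \<diamondop> x)\<^sup>2) L * min ((a j \<diamondop> u)\<^sup>2) L) + 2 * (4 * L\<^sup>2) * \<eta>"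
    by (rule lip[of "\<lambda>j k. min ((a j \<diamondop> x)\<^sup>2) L * min (k\<^sup>2) L"]) (assumption, rule min_square_product_lipschitz(1)[OF L(1)], simp)
  have l4: "emp_mean m (\<lambda>j. (min ((a j \<diamondop> v)\<^sup>2) L')\<^sup>2) \<le> emp_mean m (\<lambda>j. (min ((a j \<diamondop> u)\<^sup>2) L')\<^sup>2) + 2 * (4 * L'\<^sup>2) * \<eta>"
    by (rule lip[of "\<lambda>j k. (min (k\<^sup>2) L')\<^sup>2"]) (assumption, rule min_square_product_lipschitz(2)[OF L'], simp)
  have e8: "2 * (4 * L'\<^sup>2) * \<eta> = \<epsilon> / 15" using \<eta>L by (simp add: mult_ac)
  have "L\<^sup>2 \<le> L'\<^sup>2" using L by (intro power_mono) auto
  then have "L\<^sup>2 * \<eta> \<le> L'\<^sup>2 * \<eta>" using \<eta>0 by (intro mult_right_mono) auto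
  then have e8': "2 * (4 * L\<^sup>2) * \<eta> \<le> \<epsilon> / 15" using \<eta>L by (simp add: mult_ac)
  let ?W = "wnorm m a (\<lambda>j. a j \<diamondop> x)"
  have W2: "(?W w)\<^sup>2 = emp_mean m (\<lambda>j. (a j \<diamondop> x)\<^sup>2 * (a j \<diamondop> w)\<^sup>2)" for w
    by (simp only: wnorm_sq power_mult_distrib)
  \<comment> \<open>The square is at most 3 + \<epsilon>/2 \<le> 81/25, and 10/9 times 9/5 is the
    bound 2 on the whole sphere.\<close>
  have WN: "?W w \<le> 9/5" if "w \<in> N" for w
  proof -
    have "\<bar>w \<diamondop> x\<bar> \<le> 1" using N[OF that] x by (intro abs_scalar_prod_le_1[of _ n]) auto
    then have "(w \<diamondop> x)\<^sup>2 \<le> 1" by (simp add: abs_square_le_1)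
    then have "(?W w)\<^sup>2 \<le> 81/25" using A2[OF that] \<epsilon> unfolding W2 by linarith
    also have "\<dots> = (9/5)\<^sup>2" by (simp add: power2_eq_square)
    finally show ?thesis by (rule power2_le_imp_le) simp
  qed
  have Wu: "?W w \<le> 2" if "w \<in> carrier_vec n" "w \<diamondop> w = 1" for w
    using wnorm_net_bound[OF a net \<eta>0 \<eta>2 WN that] by simp
  have "u - v \<in> carrier_vec n" using u vc by simp
  then have "?W (u - v) \<le> \<eta> * 2" by (rule wnorm_small[OF a _ v(2) \<eta>0 Wu]) simp_all
  then have Wd: "?W u \<le> ?W v + 2 * \<eta>" using wnorm_diff[OF _ u(1) vc(1), where a=a and m=m and b="\<lambda>j. a j \<diamondop> x"] a by simp
  have W0: "0 \<le> ?W v" "0 \<le> ?W u" by (rule wnorm_nonneg)+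
  have U: "(?W u)\<^sup>2 \<le> (?W v)\<^sup>2 + 9 * \<eta>"
  proof -
    have "(?W u)\<^sup>2 \<le> (?W v + 2 * \<eta>)\<^sup>2" using Wd W0 by (intro power_mono) auto
    also have "\<dots> = (?W v)\<^sup>2 + \<eta> * (4 * ?W v + 4 * \<eta>)" by (simp add: power2_eq_square algebra_simps)
    also have "\<dots> \<le> (?W v)\<^sup>2 + \<eta> * 9" using Wu[OF vc] \<eta>0 \<eta>2 by (intro add_left_mono mult_left_mono) auto
    finally show ?thesis by simp
  qed
  have mono3: "emp_mean m (\<lambda>j. min ((a j \<diamondop> x)\<^sup>2) L' * min ((a j \<diamondop> u)\<^sup>2) L') \<le> emp_mean m (\<lambda>j. (a j \<diamondop> x)\<^sup>2 * (a j \<diamondop> u)\<^sup>2)"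
    using L' by (intro emp_mean_mono mult_mono) auto
  have mono4: "emp_mean m (\<lambda>j. (min ((a j \<diamondop> u)\<^sup>2) L')\<^sup>2) \<le> emp_mean m (\<lambda>j. (a j \<diamondop> u) ^ 4)"
  proof (rule emp_mean_mono)
    fix j
    have "(min ((a j \<diamondop> u)\<^sup>2) L')\<^sup>2 \<le> ((a j \<diamondop> u)\<^sup>2)\<^sup>2" using L' by (intro power_mono) auto
    then show "(min ((a j \<diamondop> u)\<^sup>2) L')\<^sup>2 \<le> (a j \<diamondop> u) ^ 4" by (simp flip: power_mult)
  qed
  show "emp_mean m (\<lambda>j. (a j \<diamondop> x)\<^sup>2 * (a j \<diamondop> u)\<^sup>2) \<le> 1 + 2 * (u \<diamondop> x)\<^sup>2 + \<epsilon> \<and>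
    emp_mean m (\<lambda>j. (a j \<diamondop> x)\<^sup>2 * (a j \<diamondop> u)\<^sup>2) \<ge> 1 + 2 * (u \<diamondop> x)\<^sup>2 - \<epsilon> \<and>
    emp_mean m (\<lambda>j. (a j \<diamondop> u) ^ 4) \<ge> 3 - \<epsilon> \<and>
    emp_mean m (\<lambda>j. min ((a j \<diamondop> x)\<^sup>2) L * min ((a j \<diamondop> u)\<^sup>2) L) \<ge> 1 + 2 * (u \<diamondop> x)\<^sup>2 - 1/8"
  proof (intro conjI)
    show "emp_mean m (\<lambda>j. (a j \<diamondop> x)\<^sup>2 * (a j \<diamondop> u)\<^sup>2) \<le> 1 + 2 * (u \<diamondop> x)\<^sup>2 + \<epsilon>"
      using U A2[OF v(1)] c \<eta>1 unfolding W2 by linarith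
    show "emp_mean m (\<lambda>j. (a j \<diamondop> x)\<^sup>2 * (a j \<diamondop> u)\<^sup>2) \<ge> 1 + 2 * (u \<diamondop> x)\<^sup>2 - \<epsilon>"
      using l3 A3[OF v(1)] mono3 c \<eta>1 e8 \<epsilon> by linarith
    show "emp_mean m (\<lambda>j. (a j \<diamondop> u) ^ 4) \<ge> 3 - \<epsilon>" using l4 A4[OF v(1)] mono4 e8 \<epsilon> by linarith
    show "emp_mean m (\<lambda>j. min ((a j \<diamondop> x)\<^sup>2) L * min ((a j \<diamondop> u)\<^sup>2) L) \<ge> 1 + 2 * (u \<diamondop> x)\<^sup>2 - 1/8"
      using l5 A5[OF v(1)] e8' c \<eta>1 \<epsilon> by linarith
  qed
qed

section \<open>Probability of the good event\<close>

lemma gip_tail: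
  assumes j: "j < m" and x: "x \<in> carrier_vec n" "x \<diamondop> x = 1"
  shows "measure (gauss_space m n) {\<omega>\<in>space (gauss_space m n). (gip n \<omega> j x)\<^sup>2 \<ge> T} \<le> 2 * exp (- (3 / 8 * T))"
proof -
  let ?M = "gauss_space m n"
  have "measure ?M {\<omega>\<in>space ?M. exp (3 / 8 * (gip n \<omega> j x)\<^sup>2) \<ge> exp (3 / 8 * T)} \<le>
    (\<integral>\<omega>. exp (3 / 8 * (gip n \<omega> j x)\<^sup>2) \<partial>?M) / exp (3 / 8 * T)"
    by (rule integral_Markov_inequality_measure[OF gip_moments(9)[OF j x] sets.top]) auto
  also have "{\<omega>\<in>space ?M. exp (3 / 8 * (gip n \<omega> j x)\<^sup>2) \<ge> exp (3 / 8 * T)} = {\<omega>\<in>space ?M. (gip n \<omega> j x)\<^sup>2 \<ge> T}"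
    by (intro Collect_cong) simp
  also have "(\<integral>\<omega>. exp (3 / 8 * (gip n \<omega> j x)\<^sup>2) \<partial>?M) / exp (3 / 8 * T) = 2 * exp (- (3 / 8 * T))"
    unfolding gip_moments(10)[OF j x] exp_minus[of "3 / 8 * T"] by (rule divide_inverse)
  finally show ?thesis .
qed

lemma weighted_square_upper_tail:
  assumes x: "x \<in> carrier_vec n" "x \<diamondop> x = 1" and v: "v \<in> carrier_vec n" "v \<diamondop> v = 1"
    and w: "\<And>p. 0 \<le> w p" "\<And>p. w p \<le> T" "\<And>p. (w p)\<^sup>2 \<le> 1 + p ^ 4" "\<And>p. w p \<le> W p"
    and wm: "w \<in> borel_measurable borel" and T: "T \<ge> 1" and \<epsilon>: "0 < \<epsilon>" "\<epsilon> \<le> 1"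
    and W: "\<And>j. j < m \<Longrightarrow> integrable (gauss_space m n) (\<lambda>\<omega>. W (gip n \<omega> j x) * (gip n \<omega> j v)\<^sup>2)"
      "\<And>j. j < m \<Longrightarrow> prob_space.expectation (gauss_space m n) (\<lambda>\<omega>. W (gip n \<omega> j x) * (gip n \<omega> j v)\<^sup>2) = e"
  shows "measure (gauss_space m n) {\<omega>\<in>space (gauss_space m n). (\<Sum>j<m. w (gip n \<omega> j x) * (gip n \<omega> j v)\<^sup>2) \<ge> real m * (e + \<epsilon>)}
    \<le> exp (- (real m * \<epsilon>\<^sup>2 / (2 ^ 23 * T)))"
proof -
  interpret prob_space "gauss_space m n" by (rule prob_space_gauss)
  \<comment> \<open>With this \<theta> the second-order term consumes at most half of the deviation
    \<epsilon>; the other half is the gain in the exponent.\<close>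
  define \<theta> where "\<theta> = \<epsilon> / (2 ^ 22 * T)"
  have \<theta>: "\<theta> > 0" using \<epsilon> T by (simp add: \<theta>_def)
  have \<theta>T: "\<theta> * T = \<epsilon> / 2 ^ 22" using T by (simp add: \<theta>_def)
  have "\<epsilon> / 2 ^ 22 \<le> 1 / 8" using \<epsilon> by simp
  then have \<theta>8: "\<theta> * T \<le> 1 / 8" using \<theta>T by simp
  let ?Y = "\<lambda>j \<omega>. \<theta> * (w (gip n \<omega> j x) * (gip n \<omega> j v)\<^sup>2)"
  have ind: "indep_vars (\<lambda>_. borel) ?Y {..<m}"
    by (rule gip_rows_indep[OF x(1) v(1), of "\<lambda>p k. \<theta> * (w p * k\<^sup>2)"]) (use wm in measurable)
  have "prob {\<omega>\<in>space (gauss_space m n). (\<Sum>j<m. ?Y j \<omega>) \<ge> \<theta> * (real m * (e + \<epsilon>))}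
    \<le> exp (real m * (\<theta> * e + 2 ^ 21 * \<theta>\<^sup>2) - \<theta> * (real m * (e + \<epsilon>)))"
    by (rule indep_Chernoff[OF ind]) (rule weighted_mgf_bound[OF _ x v w _ \<theta>8 W], use \<theta> in auto)
  also have "\<dots> \<le> exp (- (real m * \<epsilon>\<^sup>2 / (2 ^ 23 * T)))"
  proof -
    have "real m * (\<theta> * e + 2 ^ 21 * \<theta>\<^sup>2) - \<theta> * (real m * (e + \<epsilon>)) = real m * (\<theta> * (2 ^ 21 * \<theta> - \<epsilon>))"
      by (simp add: algebra_simps power2_eq_square)
    also have "\<dots> \<le> real m * (\<theta> * (- (\<epsilon> / 2)))"
    proof -
      have "\<theta> * 1 \<le> \<theta> * T" using \<theta> T by (intro mult_left_mono) auto
      then have "2 ^ 21 * \<theta> \<le> \<epsilon> / 2" using \<theta>T by simp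
      then show ?thesis using \<theta> by (intro mult_left_mono) auto
    qed
    also have "real m * (\<theta> * (- (\<epsilon> / 2))) = - (real m * \<epsilon>\<^sup>2 / (2 ^ 23 * T))"
      using T by (simp add: \<theta>_def power2_eq_square)
    finally show ?thesis by simp
  qed
  finally show ?thesis using \<theta> by (simp flip: sum_distrib_left)
qed

lemma bounded_lower_tail:
  assumes x: "x \<in> carrier_vec n" and v: "v \<in> carrier_vec n"
    and g: "(\<lambda>p. g (fst p) (snd p)) \<in> borel_measurable (borel \<Otimes>\<^sub>M borel)"
    and b: "\<And>p k. 0 \<le> g p k" "\<And>p k. g p k \<le> B" and B: "B \<ge> 1" and \<epsilon>: "0 < \<epsilon>"
    and e: "\<And>j. j < m \<Longrightarrow> e \<le> prob_space.expectation (gauss_space m n) (\<lambda>\<omega>. g (gip n \<omega> j x) (gip n \<omega> j v))"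
  shows "measure (gauss_space m n) {\<omega>\<in>space (gauss_space m n). (\<Sum>j<m. g (gip n \<omega> j x) (gip n \<omega> j v)) \<le> real m * (e - \<epsilon>)}
    \<le> exp (- (real m * \<epsilon>\<^sup>2 / (4 * B\<^sup>2)))"
proof -
  interpret prob_space "gauss_space m n" by (rule prob_space_gauss)
  \<comment> \<open>The minimiser of the exponent \<theta>^2 B^2 - \<theta> \<epsilon>.\<close>
  define \<theta> where "\<theta> = \<epsilon> / (2 * B\<^sup>2)"
  have \<theta>: "\<theta> > 0" using \<epsilon> B by (simp add: \<theta>_def)
  have ind0: "indep_vars (\<lambda>_. borel) (\<lambda>j \<omega>. g (gip n \<omega> j x) (gip n \<omega> j v)) {..<m}"
    by (rule gip_rows_indep[OF x v g])
  then have rv: "random_variable borel (\<lambda>\<omega>. g (gip n \<omega> j x) (gip n \<omega> j v))" if "j < m" for j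
    using that by (auto simp: indep_vars_def)
  let ?Y = "\<lambda>j \<omega>. - \<theta> * g (gip n \<omega> j x) (gip n \<omega> j v)"
  have ind: "indep_vars (\<lambda>_. borel) ?Y {..<m}"
    by (rule indep_vars_compose2[OF ind0, of "\<lambda>_ y. - \<theta> * y"]) simp
  have "prob {\<omega>\<in>space (gauss_space m n). (\<Sum>j<m. ?Y j \<omega>) \<ge> - \<theta> * (real m * (e - \<epsilon>))}
    \<le> exp (real m * (- \<theta> * e + \<theta>\<^sup>2 * B\<^sup>2) - (- \<theta> * (real m * (e - \<epsilon>))))"
    by (rule indep_Chernoff[OF ind]) (rule bounded_mgf_lower[OF rv b e], use \<theta> in auto)
  also have "real m * (- \<theta> * e + \<theta>\<^sup>2 * B\<^sup>2) - (- \<theta> * (real m * (e - \<epsilon>))) = real m * (\<theta> * (\<theta> * B\<^sup>2 - \<epsilon>))"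
    by (simp add: algebra_simps power2_eq_square)
  also have "\<theta> * B\<^sup>2 = \<epsilon> / 2" using B by (simp add: \<theta>_def)
  also have "real m * (\<theta> * (\<epsilon> / 2 - \<epsilon>)) = - (real m * \<epsilon>\<^sup>2 / (4 * B\<^sup>2))"
    using B by (simp add: \<theta>_def power2_eq_square field_simps)
  finally show ?thesis using \<theta> by (simp add: sum_negf flip: sum_distrib_left)
qed

text \<open>If a truncation is active, L is below P + K for the squares P, K, and P K (P + K) \<le>
  P^3 + K^3 lets the sixth powers pay for the whole product.\<close>

lemma min_square_product_lower:
  fixes p k L :: real
  assumes "L > 0"
  shows "min (p\<^sup>2) L * min (k\<^sup>2) L \<ge> p\<^sup>2 * k\<^sup>2 - (p ^ 6 + k ^ 6) / L"
proof -
  define P K where "P = p\<^sup>2" and "K = k\<^sup>2"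
  have P: "0 \<le> P" "0 \<le> K" by (auto simp: P_def K_def)
  have pk: "p ^ 6 = P ^ 3" "k ^ 6 = K ^ 3" by (auto simp: P_def K_def simp flip: power_mult)
  have nn: "0 \<le> (P ^ 3 + K ^ 3) / L" using P assms by simp
  show ?thesis
  proof (cases "P \<le> L \<and> K \<le> L")
    case True
    then show ?thesis using nn unfolding pk P_def[symmetric] K_def[symmetric] by simp
  next
    case False
    have "0 \<le> (P - K)\<^sup>2 * (P + K)" using P by simp
    then have s: "P * K * (P + K) \<le> P ^ 3 + K ^ 3"
      by (simp add: power2_eq_square power3_eq_cube algebra_simps)
    have "P * K * L \<le> P * K * (P + K)" using False P by (intro mult_left_mono) auto
    then have "P * K \<le> (P ^ 3 + K ^ 3) / L" using s assms by (simp add: pos_le_divide_eq)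
    moreover have "0 \<le> min P L * min K L" using P assms by simp
    ultimately show ?thesis unfolding pk P_def[symmetric] K_def[symmetric] by linarith
  qed
qed

lemma min_square_sq_lower:
  fixes k L :: real
  assumes "L > 0"
  shows "(min (k\<^sup>2) L)\<^sup>2 \<ge> k ^ 4 - k ^ 6 / L"
proof -
  define K where "K = k\<^sup>2"
  have K: "0 \<le> K" by (simp add: K_def)
  have pk: "k ^ 4 = K\<^sup>2" "k ^ 6 = K ^ 3" by (auto simp: K_def simp flip: power_mult)
  have nn: "0 \<le> K ^ 3 / L" using K assms by simp
  show ?thesis
  proof (cases "K \<le> L")
    case True
    then show ?thesis using nn unfolding pk K_def[symmetric] by simp
  next
    case False
    have "K\<^sup>2 * L \<le> K\<^sup>2 * K" using False by (intro mult_left_mono) auto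
    then have "K\<^sup>2 \<le> K ^ 3 / L" using assms by (simp add: pos_le_divide_eq power3_eq_cube power2_eq_square)
    moreover have "0 \<le> (min K L)\<^sup>2" by simp
    ultimately show ?thesis unfolding pk K_def[symmetric] by linarith
  qed
qed

text \<open>Each of the two sixth moments is 15, hence the loss 30/L.\<close>

lemma expectation_truncated_product:
  assumes j: "j < m" and x: "x \<in> carrier_vec n" "x \<diamondop> x = 1" and v: "v \<in> carrier_vec n" "v \<diamondop> v = 1" and L: "L > 0"
  shows "prob_space.expectation (gauss_space m n) (\<lambda>\<omega>. min ((gip n \<omega> j x)\<^sup>2) L * min ((gip n \<omega> j v)\<^sup>2) L)
    \<ge> 1 + 2 * (v \<diamondop> x)\<^sup>2 - 30 / L"
proof -
  interpret prob_space "gauss_space m n" by (rule prob_space_gauss)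
  let ?l = "\<lambda>\<omega>. (gip n \<omega> j x)\<^sup>2 * (gip n \<omega> j v)\<^sup>2 - ((gip n \<omega> j x) ^ 6 + (gip n \<omega> j v) ^ 6) / L"
  have i: "integrable (gauss_space m n) ?l"
    using gip_joint_moment(1)[OF j x v] gip_moments(5)[OF j x] gip_moments(5)[OF j v] by simp
  have E: "expectation ?l = 1 + 2 * (v \<diamondop> x)\<^sup>2 - 30 / L"
    using gip_joint_moment[OF j x v] gip_moments(5,6)[OF j x] gip_moments(5,6)[OF j v] by simp
  have "expectation ?l \<le> expectation (\<lambda>\<omega>. min ((gip n \<omega> j x)\<^sup>2) L * min ((gip n \<omega> j v)\<^sup>2) L)"
  proof (rule integral_mono[OF i])
    show "integrable (gauss_space m n) (\<lambda>\<omega>. min ((gip n \<omega> j x)\<^sup>2) L * min ((gip n \<omega> j v)\<^sup>2) L)"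
      by (rule integrable_const_bound[where B="L * L"])
        (use L gip_measurable[OF j x(1)] gip_measurable[OF j v(1)] in \<open>auto simp: abs_mult intro!: mult_mono\<close>)
  qed (use min_square_product_lower[OF L] in auto)
  then show ?thesis using E by simp
qed

lemma expectation_truncated_square:
  assumes j: "j < m" and v: "v \<in> carrier_vec n" "v \<diamondop> v = 1" and L: "L > 0"
  shows "prob_space.expectation (gauss_space m n) (\<lambda>\<omega>. (min ((gip n \<omega> j v)\<^sup>2) L)\<^sup>2) \<ge> 3 - 30 / L"
proof -
  interpret prob_space "gauss_space m n" by (rule prob_space_gauss)
  let ?l = "\<lambda>\<omega>. (gip n \<omega> j v) ^ 4 - (gip n \<omega> j v) ^ 6 / L"
  have i: "integrable (gauss_space m n) ?l" using gip_moments(3,5)[OF j v] by simp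
  have E: "expectation ?l = 3 - 15 / L" using gip_moments(3-6)[OF j v] by simp
  have "expectation ?l \<le> expectation (\<lambda>\<omega>. (min ((gip n \<omega> j v)\<^sup>2) L)\<^sup>2)"
  proof (rule integral_mono[OF i])
    show "integrable (gauss_space m n) (\<lambda>\<omega>. (min ((gip n \<omega> j v)\<^sup>2) L)\<^sup>2)"
      by (rule integrable_const_bound[where B="L\<^sup>2"])
        (use L gip_measurable[OF j v(1)] in \<open>auto intro!: power_mono\<close>)
  qed (use min_square_sq_lower[OF L] in auto)
  moreover have "15 / L \<le> 30 / L" using L by (intro divide_right_mono) auto
  ultimately show ?thesis using E by simp
qed

text \<open>A union bound over the rows for the weights and over the net for the five mean
  estimates. L \<ge> 480 makes 30/L at most 1/16, which leaves room below the error 1/12 allowed on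
  the net.\<close>

lemma prob_good_sample:
  fixes L \<epsilon> :: real
  assumes L: "L \<ge> 480" and \<epsilon>: "0 < \<epsilon>" "\<epsilon> \<le> 1/100"
  obtains A :: real where "A \<ge> 1"
    "\<And>n m x. n > 0 \<Longrightarrow> real m \<ge> 3 \<Longrightarrow> A * real n * ln (real m) \<le> real m \<Longrightarrow>
       x \<in> carrier_vec n \<Longrightarrow> x \<diamondop> x = 1 \<Longrightarrow>
       \<exists>E\<in>sets (gauss_space m n). measure (gauss_space m n) E \<ge> 1 - 2 / real m - exp (- real n) \<and>
         (\<forall>\<omega>\<in>E. good_sample n m \<epsilon> L (gauss_vec n \<omega>) x)"
proof -
  \<comment> \<open>Truncation at this level costs at most \<epsilon>/4 and the deviation another
    \<epsilon>/4, in total the \<epsilon>/2 allowed on the net.\<close>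
  define L' where "L' = max L (120 / \<epsilon>)"
  have L': "L \<le> L'" "L' \<ge> 1" "L' > 0" "L > 0" using L by (auto simp: L'_def)
  have eL': "30 / L' \<le> \<epsilon> / 4"
  proof -
    have "120 / \<epsilon> \<le> L'" by (simp add: L'_def)
    then have "120 \<le> \<epsilon> * L'" using \<epsilon> by (simp add: pos_divide_le_eq mult.commute)
    then show ?thesis using L' by (simp add: pos_divide_le_eq)
  qed
  have eL: "30 / L \<le> 1/16" using L by (simp add: pos_divide_le_eq)
  define \<eta> where "\<eta> = \<epsilon> / (120 * L'\<^sup>2)"
  have \<eta>: "0 < \<eta>" using \<epsilon> L' by (simp add: \<eta>_def)
  define D :: real where "D = 3 * 2 ^ (nat \<lceil>1 / \<eta>\<rceil> + 1)"
  have "1 \<le> (2::real) ^ (nat \<lceil>1 / \<eta>\<rceil> + 1)" by (rule one_le_power) simp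
  then have D: "D \<ge> 3" by (simp add: D_def)
  define B where "B = L'\<^sup>2"
  have B: "B \<ge> 1" using L' by (simp add: B_def)
  \<comment> \<open>K ln m is the largest denominator among the tail bounds, once T = 6 ln m is
    inserted.\<close>
  define K where "K = 2 ^ 23 * B\<^sup>2 * 6"
  have K0: "K > 0" using B by (simp add: K_def)
  \<comment> \<open>In ln D + 3 the summand ln D cancels the cardinality of the net, two units
    absorb the factor 5 for the five bad events per net point, and the last unit is the final
    exp(-n).\<close>
  define A where "A = K * (16 / \<epsilon>\<^sup>2) * (ln D + 3)"
  have lnD: "0 \<le> ln D" using D by simp
  show thesis
  proof (rule that[of A])
    have "1 \<le> 16 / \<epsilon>\<^sup>2"
    proof -
      have "\<epsilon>\<^sup>2 \<le> 1\<^sup>2" using \<epsilon> by (intro power_mono) auto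
      then show ?thesis using \<epsilon> by (simp add: pos_le_divide_eq)
    qed
    moreover have "1 \<le> K"
    proof -
      have "1 \<le> B\<^sup>2" using B by simp
      then show ?thesis by (simp add: K_def)
    qed
    ultimately have "1 * 1 * 1 \<le> K * (16 / \<epsilon>\<^sup>2) * (ln D + 3)" using lnD by (intro mult_mono) auto
    then show "A \<ge> 1" by (simp add: A_def)
  next
    fix n m :: nat and x :: "real Matrix.vec"
    assume n: "n > 0" and m3: "real m \<ge> 3" and mA: "A * real n * ln (real m) \<le> real m"
      and x: "x \<in> carrier_vec n" "x \<diamondop> x = 1"
    let ?M = "gauss_space m n"
    interpret prob_space ?M by (rule prob_space_gauss)
    have m: "m > 0" using m3 by simp
    obtain N where N: "finite N" "real (card N) \<le> D ^ n" "\<And>v. v \<in> N \<Longrightarrow> v \<in> carrier_vec n \<and> v \<diamondop> v = 1"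
      "\<And>u. u \<in> carrier_vec n \<Longrightarrow> u \<diamondop> u = 1 \<Longrightarrow> \<exists>v\<in>N. (u - v) \<diamondop> (u - v) \<le> \<eta>\<^sup>2"
      using sphere_net[OF n \<eta> D_def] by blast
    have net: "is_sphere_net n \<eta> N" using N(3,4) by (auto simp: is_sphere_net_def)
    have lnm: "ln (real m) \<ge> 1"
    proof -
      have "exp 1 \<le> real m" using exp_le m3 by linarith
      then show ?thesis using m by (simp add: ln_ge_iff)
    qed
    \<comment> \<open>3/8 times 6 exceeds 2, so each weight reaches T with probability at most
      2/m^2, and the union over m rows costs 2/m.\<close>
    define T where "T = 6 * ln (real m)"
    have T: "T \<ge> 1" using lnm by (simp add: T_def)
    \<comment> \<open>The strict cut-off makes w agree with the square exactly on the complement of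
      \<open>bad0\<close>.\<close>
    define w where "w p = (if p\<^sup>2 < T then p\<^sup>2 else 0)" for p :: real
    have w: "0 \<le> w p" "w p \<le> T" "(w p)\<^sup>2 \<le> 1 + p ^ 4" "w p \<le> p\<^sup>2" for p
      using T by (auto simp: w_def simp flip: power_mult)
    have wm: "w \<in> borel_measurable borel" unfolding w_def by measurable
    \<comment> \<open>A common bound for all five tails: the smallest squared deviation over the
      largest denominator.\<close>
    define q where "q = exp (- (real m * (\<epsilon>\<^sup>2 / 16) / (2 ^ 23 * B\<^sup>2 * T)))"
    have B2: "1 \<le> B\<^sup>2" using B by simp
    have q_bound: "exp (- (real m * s / c)) \<le> q" if s: "\<epsilon>\<^sup>2 / 16 \<le> s" and c: "0 < c" "c \<le> 2 ^ 23 * B\<^sup>2 * T" for s c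
    proof -
      have "real m * (\<epsilon>\<^sup>2 / 16) / (2 ^ 23 * B\<^sup>2 * T) \<le> real m * (\<epsilon>\<^sup>2 / 16) / c"
        using c B T by (intro divide_left_mono mult_pos_pos) auto
      also have "\<dots> \<le> real m * s / c" using s c by (intro divide_right_mono mult_left_mono) auto
      finally show ?thesis by (simp add: q_def)
    qed
    have BT: "1 * 1 \<le> B\<^sup>2 * T" using B2 T by (intro mult_mono) auto
    have \<epsilon>1: "\<epsilon>\<^sup>2 \<le> 1"
    proof -
      have "\<epsilon>\<^sup>2 \<le> 1\<^sup>2" using \<epsilon> by (intro power_mono) auto
      then show ?thesis by simp
    qed
    define bad0 where "bad0 j = {\<omega>\<in>space ?M. (gip n \<omega> j x)\<^sup>2 \<ge> T}" for j
    define bad1 where "bad1 v = {\<omega>\<in>space ?M. (\<Sum>j<m. 1 * (gip n \<omega> j v)\<^sup>2) \<ge> real m * (1 + 1)}" for v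
    define bad2 where "bad2 v = {\<omega>\<in>space ?M. (\<Sum>j<m. w (gip n \<omega> j x) * (gip n \<omega> j v)\<^sup>2) \<ge> real m * ((1 + 2 * (v \<diamondop> x)\<^sup>2) + \<epsilon> / 2)}" for v
    define bad3 where "bad3 v = {\<omega>\<in>space ?M. (\<Sum>j<m. min ((gip n \<omega> j x)\<^sup>2) L' * min ((gip n \<omega> j v)\<^sup>2) L') \<le> real m * ((1 + 2 * (v \<diamondop> x)\<^sup>2 - 30 / L') - \<epsilon> / 4)}" for v
    define bad4 where "bad4 v = {\<omega>\<in>space ?M. (\<Sum>j<m. (min ((gip n \<omega> j v)\<^sup>2) L')\<^sup>2) \<le> real m * ((3 - 30 / L') - \<epsilon> / 4)}" for v
    define bad5 where "bad5 v = {\<omega>\<in>space ?M. (\<Sum>j<m. min ((gip n \<omega> j x)\<^sup>2) L * min ((gip n \<omega> j v)\<^sup>2) L) \<le> real m * ((1 + 2 * (v \<diamondop> x)\<^sup>2 - 30 / L) - \<epsilon> / 4)}" for v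
    define bad where "bad v = bad1 v \<union> bad2 v \<union> bad3 v \<union> bad4 v \<union> bad5 v" for v
    have gm: "(\<lambda>\<omega>. gip n \<omega> j v) \<in> borel_measurable ?M" if "j < m" "v \<in> carrier_vec n" for j v
      using gip_measurable[OF that] .
    have sm: "(\<lambda>\<omega>. \<Sum>j<m. F (gip n \<omega> j x) (gip n \<omega> j v)) \<in> borel_measurable ?M"
      if v: "v \<in> carrier_vec n" and F: "(\<lambda>p. F (fst p) (snd p)) \<in> borel_measurable (borel \<Otimes>\<^sub>M borel)" for F :: "real \<Rightarrow> real \<Rightarrow> real" and v
    proof (rule borel_measurable_sum)
      fix j assume "j \<in> {..<m}"
      then have "j < m" by simp
      from measurable_compose[OF measurable_Pair[OF gm[OF this x(1)] gm[OF this v]] F]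
      show "(\<lambda>\<omega>. F (gip n \<omega> j x) (gip n \<omega> j v)) \<in> borel_measurable ?M" by simp
    qed
    have s0: "bad0 j \<in> events" if "j < m" for j
      unfolding bad0_def using gm[OF that x(1)] by measurable
    have F1: "(\<lambda>p. 1 * (snd p)\<^sup>2) \<in> borel_measurable (borel \<Otimes>\<^sub>M borel :: (real \<times> real) measure)" by measurable
    have F2: "(\<lambda>p. w (fst p) * (snd p)\<^sup>2) \<in> borel_measurable (borel \<Otimes>\<^sub>M borel :: (real \<times> real) measure)" using wm by measurable
    have F3: "(\<lambda>p. min ((fst p)\<^sup>2) l * min ((snd p)\<^sup>2) l) \<in> borel_measurable (borel \<Otimes>\<^sub>M borel :: (real \<times> real) measure)" for l by measurable
    have F4: "(\<lambda>p. (min ((snd p)\<^sup>2) l)\<^sup>2) \<in> borel_measurable (borel \<Otimes>\<^sub>M borel :: (real \<times> real) measure)" for l by measurable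
    have s1: "bad1 v \<in> events" "bad2 v \<in> events" "bad3 v \<in> events" "bad4 v \<in> events" "bad5 v \<in> events" if "v \<in> N" for v
    proof -
      have v: "v \<in> carrier_vec n" using N(3)[OF that] by simp
      show "bad1 v \<in> events" unfolding bad1_def by (rule borel_measurable_le[OF _ sm[OF v F1]]) simp
      show "bad2 v \<in> events" unfolding bad2_def by (rule borel_measurable_le[OF _ sm[OF v F2]]) simp
      show "bad3 v \<in> events" unfolding bad3_def by (rule borel_measurable_le[OF sm[OF v F3]]) simp
      show "bad4 v \<in> events" unfolding bad4_def by (rule borel_measurable_le[OF sm[OF v F4]]) simp
      show "bad5 v \<in> events" unfolding bad5_def by (rule borel_measurable_le[OF sm[OF v F3]]) simp
    qed
    have LL: "L * L \<le> B" "L' * L' \<le> B" "(L')\<^sup>2 \<le> B"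
      using L L' by (auto simp: B_def power2_eq_square intro!: mult_mono)
    have c1: "4 * B\<^sup>2 \<le> 2 ^ 23 * B\<^sup>2 * T"
    proof -
      have "4 * B\<^sup>2 * 1 \<le> (2 ^ 23 * B\<^sup>2) * T" using B2 T by (intro mult_mono) auto
      then show ?thesis by simp
    qed
    have pb: "prob (bad v) \<le> 5 * q" if "v \<in> N" for v
    proof -
      have v: "v \<in> carrier_vec n" "v \<diamondop> v = 1" using N(3)[OF that] by auto
      have "prob (bad1 v) \<le> exp (- (real m * 1\<^sup>2 / (2 ^ 23 * 1)))"
        unfolding bad1_def
        by (rule weighted_square_upper_tail[OF x v, where W="\<lambda>_. 1"]) (use gip_moments(1,2)[OF _ v] in auto)
      also have "\<dots> \<le> q" by (rule q_bound) (use \<epsilon>1 BT in auto)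
      finally have p1: "prob (bad1 v) \<le> q" .
      have "prob (bad2 v) \<le> exp (- (real m * (\<epsilon> / 2)\<^sup>2 / (2 ^ 23 * T)))"
        unfolding bad2_def
        by (rule weighted_square_upper_tail[OF x v w wm T _ _ gip_joint_moment[OF _ x v]]) (use \<epsilon> in auto)
      also have "\<dots> \<le> q"
      proof (rule q_bound)
        have "1 * T \<le> B\<^sup>2 * T" using B2 T by (intro mult_right_mono) auto
        then show "2 ^ 23 * T \<le> 2 ^ 23 * B\<^sup>2 * T" by simp
      qed (use T in \<open>auto simp: power_divide\<close>)
      finally have p2: "prob (bad2 v) \<le> q" .
      have qq: "exp (- (real m * (\<epsilon> / 4)\<^sup>2 / (4 * B\<^sup>2))) \<le> q"
        by (rule q_bound) (use c1 B in \<open>auto simp: power_divide\<close>)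
      have "prob (bad3 v) \<le> exp (- (real m * (\<epsilon> / 4)\<^sup>2 / (4 * B\<^sup>2)))"
        unfolding bad3_def
      proof (rule bounded_lower_tail[OF x(1) v(1) F3 _ _ B _ expectation_truncated_product[OF _ x v L'(3)]])
        show "min (p\<^sup>2) L' * min (k\<^sup>2) L' \<le> B" for p k :: real
          using L' by (intro order_trans[OF mult_mono LL(2)]) auto
      qed (use L' \<epsilon> in auto)
      then have p3: "prob (bad3 v) \<le> q" using qq by linarith
      have "prob (bad4 v) \<le> exp (- (real m * (\<epsilon> / 4)\<^sup>2 / (4 * B\<^sup>2)))"
        unfolding bad4_def
      proof (rule bounded_lower_tail[OF x(1) v(1) F4 _ _ B _ expectation_truncated_square[OF _ v L'(3)]])
        show "(min (k\<^sup>2) L')\<^sup>2 \<le> B" for k :: real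
          using L' by (intro order_trans[OF power_mono LL(3)]) auto
      qed (use L' \<epsilon> in auto)
      then have p4: "prob (bad4 v) \<le> q" using qq by linarith
      have "prob (bad5 v) \<le> exp (- (real m * (\<epsilon> / 4)\<^sup>2 / (4 * B\<^sup>2)))"
        unfolding bad5_def
      proof (rule bounded_lower_tail[OF x(1) v(1) F3 _ _ B _ expectation_truncated_product[OF _ x v L'(4)]])
        show "min (p\<^sup>2) L * min (k\<^sup>2) L \<le> B" for p k :: real
          using L' by (intro order_trans[OF mult_mono LL(1)]) auto
      qed (use L' \<epsilon> in auto)
      then have p5: "prob (bad5 v) \<le> q" using qq by linarith
      have "prob (bad v) \<le> prob (bad1 v) + prob (bad2 v) + prob (bad3 v) + prob (bad4 v) + prob (bad5 v)"
        unfolding bad_def using s1[OF that]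
        by (intro order_trans[OF measure_Un_le] add_mono order_refl) auto
      then show ?thesis using p1 p2 p3 p4 p5 by linarith
    qed
    have qn: "5 * D ^ n * q \<le> exp (- real n)"
    proof -
      have "ln (real m) > 0" using lnm by simp
      have "A * real n * ln (real m) / (ln (real m) * (A / (ln D + 3))) \<le> real m / (ln (real m) * (A / (ln D + 3)))"
        using mA lnm \<open>0 < ln (real m)\<close> K0 \<epsilon> lnD by (intro divide_right_mono) (auto simp: A_def)
      moreover have "A * real n * ln (real m) / (ln (real m) * (A / (ln D + 3))) = real n * (ln D + 3)"
      proof -
        have "A \<noteq> 0" "ln D + 3 \<noteq> 0" using K0 \<epsilon> lnD by (auto simp: A_def)
        then show ?thesis using \<open>0 < ln (real m)\<close> by (simp add: field_simps)
      qed
      moreover have "real m / (ln (real m) * (A / (ln D + 3))) = real m * (\<epsilon>\<^sup>2 / 16) / (2 ^ 23 * B\<^sup>2 * T)"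
      proof -
        have "A / (ln D + 3) = K * (16 / \<epsilon>\<^sup>2)" using lnD by (simp add: A_def)
        then show ?thesis unfolding \<open>A / (ln D + 3) = K * (16 / \<epsilon>\<^sup>2)\<close> K_def T_def using \<epsilon> by (simp add: field_simps)
      qed
      ultimately have le: "real n * (ln D + 3) \<le> real m * (\<epsilon>\<^sup>2 / 16) / (2 ^ 23 * B\<^sup>2 * T)" by simp
      have "q \<le> exp (- (real n * (ln D + 3)))" using le by (simp add: q_def)
      then have "5 * D ^ n * q \<le> 5 * D ^ n * exp (- (real n * (ln D + 3)))" using D by (intro mult_left_mono) auto
      also have "\<dots> = 5 * exp (- 2 * real n) * exp (- real n)"
      proof -
        have "D ^ n = exp (real n * ln D)" using D by (simp add: exp_of_nat_mult)
        then show ?thesis by (simp add: mult.assoc algebra_simps flip: exp_add)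
      qed
      also have "\<dots> \<le> 1 * exp (- real n)"
      proof (rule mult_right_mono)
        have "(5/2)\<^sup>2 \<le> (exp (1::real))\<^sup>2"
        proof (rule power_mono)
          have "1 + 1 + 1\<^sup>2 / 2 \<le> exp (1::real)" by (rule exp_lower_Taylor_quadratic) simp
          then show "5 / 2 \<le> exp (1::real)" by simp
        qed simp
        also have "(exp (1::real))\<^sup>2 = exp 2" by (simp flip: exp_of_nat_mult)
        also have "exp 2 \<le> exp (2 * real n)" using n by simp
        finally have "5 \<le> exp (2 * real n)" by (simp add: power2_eq_square)
        then show "5 * exp (- 2 * real n) \<le> 1" by (simp add: exp_minus divide_inverse[symmetric])
      qed simp
      finally show ?thesis by simp
    qed
    define bads where "bads = (\<Union>j\<in>{..<m}. bad0 j) \<union> (\<Union>v\<in>N. bad v)"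
    have sb: "bad v \<in> events" if "v \<in> N" for v using s1[OF that] by (auto simp: bad_def)
    have e0: "(\<Union>j\<in>{..<m}. bad0 j) \<in> events" using s0 by auto
    have e1: "(\<Union>v\<in>N. bad v) \<in> events" using sb N(1) by auto
    have be: "bads \<in> events" using e0 e1 by (auto simp: bads_def)
    have "prob (\<Union>j\<in>{..<m}. bad0 j) \<le> (\<Sum>j\<in>{..<m}. prob (bad0 j))"
      by (rule finite_measure_subadditive_finite) (use s0 in auto)
    also have "\<dots> \<le> (\<Sum>j\<in>{..<m}. 2 * exp (- (3 / 8 * T)))"
      by (rule sum_mono) (use gip_tail[OF _ x] in \<open>auto simp: bad0_def\<close>)
    also have "\<dots> = real m * (2 * exp (- (3 / 8 * T)))" by simp
    also have "\<dots> \<le> 2 / real m"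
    proof -
      have "exp (- (3 / 8 * T)) \<le> exp (- 2 * ln (real m))" using lnm by (simp add: T_def)
      also have "\<dots> = exp (- ln (real m)) * exp (- ln (real m))" by (simp flip: exp_add)
      also have "\<dots> = 1 / (real m * real m)" using m by (simp add: exp_minus divide_inverse)
      finally have "real m * (2 * exp (- (3 / 8 * T))) \<le> real m * (2 * (1 / (real m * real m)))"
        by (intro mult_left_mono) auto
      then show ?thesis using m by simp
    qed
    finally have P0: "prob (\<Union>j\<in>{..<m}. bad0 j) \<le> 2 / real m" .
    have "prob (\<Union>v\<in>N. bad v) \<le> (\<Sum>v\<in>N. prob (bad v))"
      by (rule finite_measure_subadditive_finite) (use sb N(1) in auto)
    also have "\<dots> \<le> (\<Sum>v\<in>N. 5 * q)" by (rule sum_mono) (rule pb)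
    also have "\<dots> = real (card N) * (5 * q)" by simp
    also have "\<dots> \<le> D ^ n * (5 * q)" by (intro mult_right_mono N(2)) (simp add: q_def)
    also have "\<dots> \<le> exp (- real n)" using qn by (simp add: mult_ac)
    finally have P1: "prob (\<Union>v\<in>N. bad v) \<le> exp (- real n)" .
    have "prob bads \<le> 2 / real m + exp (- real n)"
      unfolding bads_def using measure_Un_le[OF e0 e1] P0 P1 by linarith
    then have PE: "prob (space ?M - bads) \<ge> 1 - 2 / real m - exp (- real n)"
      using prob_compl[OF be] by simp
    have "good_sample n m \<epsilon> L (gauss_vec n \<omega>) x" if \<omega>: "\<omega> \<in> space ?M - bads" for \<omega>
    proof (rule good_sample_from_net[OF _ x m net _ L'(1) \<epsilon> \<eta>_def])
      show "gauss_vec n \<omega> j \<in> carrier_vec n" for j by (simp add: gauss_vec_def)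
      show "1 \<le> L" using L by simp
      have nb0: "(gip n \<omega> j x)\<^sup>2 < T" if "j < m" for j
        using \<omega> that by (auto simp: bads_def bad0_def not_le)
      have nb: "\<omega> \<notin> bad v" if "v \<in> N" for v using \<omega> that by (auto simp: bads_def)
      have em: "emp_mean m f \<le> c" if "(\<Sum>j<m. f j) \<le> real m * c" for f c
        using that m by (simp add: emp_mean_def pos_divide_le_eq mult.commute)
      have em': "emp_mean m f \<ge> c" if "(\<Sum>j<m. f j) \<ge> real m * c" for f c
        using that m by (simp add: emp_mean_def pos_le_divide_eq mult.commute)
      fix v assume v: "v \<in> N"
      have sp: "\<omega> \<in> space ?M" using \<omega> by simp
      show "emp_mean m (\<lambda>j. (gip n \<omega> j v)\<^sup>2) \<le> 2"
        by (rule em) (use nb[OF v] sp in \<open>auto simp: bad_def bad1_def not_le\<close>)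
      show "emp_mean m (\<lambda>j. (gip n \<omega> j x)\<^sup>2 * (gip n \<omega> j v)\<^sup>2) \<le> 1 + 2 * (v \<diamondop> x)\<^sup>2 + \<epsilon> / 2"
      proof (rule em)
        \<comment> \<open>Outside \<open>bad0\<close> every weight is below T, so the truncated sum
          is the true one.\<close>
        have "(\<Sum>j<m. (gip n \<omega> j x)\<^sup>2 * (gip n \<omega> j v)\<^sup>2) = (\<Sum>j<m. w (gip n \<omega> j x) * (gip n \<omega> j v)\<^sup>2)"
          by (intro sum.cong refl) (simp add: w_def nb0)
        then show "(\<Sum>j<m. (gip n \<omega> j x)\<^sup>2 * (gip n \<omega> j v)\<^sup>2) \<le> real m * (1 + 2 * (v \<diamondop> x)\<^sup>2 + \<epsilon> / 2)"
          using nb[OF v] sp by (auto simp: bad_def bad2_def not_le)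
      qed
      have "emp_mean m (\<lambda>j. min ((gip n \<omega> j x)\<^sup>2) L' * min ((gip n \<omega> j v)\<^sup>2) L') \<ge> (1 + 2 * (v \<diamondop> x)\<^sup>2 - 30 / L') - \<epsilon> / 4"
        by (rule em') (use nb[OF v] sp in \<open>auto simp: bad_def bad3_def not_le\<close>)
      then show "emp_mean m (\<lambda>j. min ((gip n \<omega> j x)\<^sup>2) L' * min ((gip n \<omega> j v)\<^sup>2) L') \<ge> 1 + 2 * (v \<diamondop> x)\<^sup>2 - \<epsilon> / 2"
        using eL' by linarith
      have "emp_mean m (\<lambda>j. (min ((gip n \<omega> j v)\<^sup>2) L')\<^sup>2) \<ge> (3 - 30 / L') - \<epsilon> / 4"
        by (rule em') (use nb[OF v] sp in \<open>auto simp: bad_def bad4_def not_le\<close>)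
      then show "emp_mean m (\<lambda>j. (min ((gip n \<omega> j v)\<^sup>2) L')\<^sup>2) \<ge> 3 - \<epsilon> / 2" using eL' by linarith
      have "emp_mean m (\<lambda>j. min ((gip n \<omega> j x)\<^sup>2) L * min ((gip n \<omega> j v)\<^sup>2) L) \<ge> (1 + 2 * (v \<diamondop> x)\<^sup>2 - 30 / L) - \<epsilon> / 4"
        by (rule em') (use nb[OF v] sp in \<open>auto simp: bad_def bad5_def not_le\<close>)
      then show "emp_mean m (\<lambda>j. min ((gip n \<omega> j x)\<^sup>2) L * min ((gip n \<omega> j v)\<^sup>2) L) \<ge> 1 + 2 * (v \<diamondop> x)\<^sup>2 - 1/12"
        using eL \<epsilon> by linarith
    qed
    then show "\<exists>E\<in>events. prob E \<ge> 1 - 2 / real m - exp (- real n) \<and> (\<forall>\<omega>\<in>E. good_sample n m \<epsilon> L (gauss_vec n \<omega>) x)"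
      using PE be by blast
  qed
qed

text \<open>E is only required to be contained in the set where the conclusion holds, which avoids
  measurability questions about a statement on all critical Z. The condition
  \<open>\<delta>\<^sub>0 < 1\<close> is essential: otherwise Z = X, where the Hessian is
  nonnegative, meets every condition on Z.\<close>

theorem theorem4p5:
  shows "\<exists>C\<^sub>1>0::real. \<exists>C\<^sub>2>0::real. \<forall>\<delta>\<^sub>1>0::real. \<exists>C>0::real.
    \<forall>\<delta>\<^sub>0::real. 0 < \<delta>\<^sub>0 \<and> \<delta>\<^sub>0 < 1 \<longrightarrow>
    (\<exists>\<Lambda><0::real. \<forall>(n::nat) (m::nat) (x::real Matrix.vec).
      x \<in> carrier_vec n \<and> x \<noteq> 0\<^sub>v n \<and> m \<ge> 1 \<and> real m \<ge> C * real n * ln (real n) \<longrightarrow>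
      (\<exists>E\<in>sets (gauss_space m n).
        measure (gauss_space m n) E \<ge> 1 - C\<^sub>1 / real m - exp (- C\<^sub>2 * real n) \<and>
        (\<forall>\<omega>\<in>E. let X = outer x x; f = loss m (gauss_vec n \<omega>) X in
          \<forall>Z\<in>rank_one_manifold n.
            frob_inner Z X \<le> \<delta>\<^sub>0 * frob_norm Z * frob_norm X \<and>
            1/3 - \<delta>\<^sub>0 \<le> frob_norm Z / frob_norm X \<and>
            frob_norm Z / frob_norm X \<le> 1/3 + \<delta>\<^sub>0 \<and>
            riem_grad n f Z = 0\<^sub>m n n \<longrightarrow>
            lambda_min_hess n f Z \<le> \<Lambda> \<and>
            (\<delta>\<^sub>0 < 1/6 \<and> \<delta>\<^sub>1 < 5/36 \<longrightarrow> lambda_min_hess n f Z < -1))))"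
proof -
  define L \<eta> \<epsilon> :: real where "L = 480" and "\<eta> = 1 / (20000 * L ^ 4)" and "\<epsilon> = \<eta> / 1000"
  have L: "L \<ge> 480" "L \<ge> 1" by (auto simp: L_def)
  have \<epsilon>: "0 < \<epsilon>" "\<epsilon> \<le> 1/100" by (auto simp: \<epsilon>_def \<eta>_def L_def)
  obtain A :: real where A: "A \<ge> 1" and good:
    "\<And>n m x. n > 0 \<Longrightarrow> real m \<ge> 3 \<Longrightarrow> A * real n * ln (real m) \<le> real m \<Longrightarrow>
       x \<in> carrier_vec n \<Longrightarrow> x \<diamondop> x = 1 \<Longrightarrow>
       \<exists>E\<in>sets (gauss_space m n). measure (gauss_space m n) E \<ge> 1 - 2 / real m - exp (- real n) \<and>
         (\<forall>\<omega>\<in>E. good_sample n m \<epsilon> L (gauss_vec n \<omega>) x)"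
    using prob_good_sample[OF L(1) \<epsilon>] by blast
  \<comment> \<open>For m below 3 or below \<open>A\<^sup>2\<close> this choice makes the
    probability bound nonpositive, so the empty event will do.\<close>
  define C\<^sub>1 where "C\<^sub>1 = max 3 (A\<^sup>2)"
  define C where "C = A * (4 * ln A + 2)"
  have C: "C > 0" using A by (simp add: C_def add_nonneg_pos)
  have main: "\<exists>E\<in>sets (gauss_space m n).
      measure (gauss_space m n) E \<ge> 1 - C\<^sub>1 / real m - exp (- 1 * real n) \<and>
      (\<forall>\<omega>\<in>E. \<forall>Z\<in>rank_one_manifold n. frob_inner Z (outer x x) \<le> \<delta>\<^sub>0 * frob_norm Z * frob_norm (outer x x) \<longrightarrow>
         riem_grad n (loss m (gauss_vec n \<omega>) (outer x x)) Z = 0\<^sub>m n n \<longrightarrow>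
         lambda_min_hess n (loss m (gauss_vec n \<omega>) (outer x x)) Z \<le> - 2)"
    if \<delta>: "\<delta>\<^sub>0 < 1" and x: "x \<in> carrier_vec n" "x \<noteq> 0\<^sub>v n" and m: "m \<ge> 1" "real m \<ge> C * real n * ln (real n)"
    for \<delta>\<^sub>0 :: real and n m :: nat and x :: "real Matrix.vec"
  proof (cases "real m \<ge> C\<^sub>1")
    case False
    then have "1 \<le> C\<^sub>1 / real m" using m(1) by (simp add: pos_le_divide_eq)
    then have "1 - C\<^sub>1 / real m - exp (- 1 * real n) \<le> 0" using exp_gt_zero[of "- 1 * real n"] by linarith
    then show ?thesis by (intro bexI[of _ "{}"]) auto
  next
    case True
    then have m3: "real m \<ge> 3" and mA: "real m \<ge> A\<^sup>2" by (auto simp: C\<^sub>1_def)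
    have n: "n > 0" using x by (cases n) (auto intro!: eq_vecI)
    have "A * real n * ln (real m) \<le> real m"
      by (rule sample_size_log_bound[OF A mA _ _ n]) (use m3 m(2) in \<open>auto simp: C_def\<close>)
    obtain R w where w: "R > 0" "R\<^sup>2 = x \<diamondop> x" "w \<in> carrier_vec n" "w \<diamondop> w = 1" "x = R \<cdot>\<^sub>v w"
      using unit_vec_normalize[OF x] .
    obtain E where E: "E \<in> sets (gauss_space m n)" "measure (gauss_space m n) E \<ge> 1 - 2 / real m - exp (- real n)"
      "\<And>\<omega>. \<omega> \<in> E \<Longrightarrow> good_sample n m \<epsilon> L (gauss_vec n \<omega>) w"
      using good[OF n m3 \<open>A * real n * ln (real m) \<le> real m\<close> w(3,4)] by blast
    have "2 / real m \<le> C\<^sub>1 / real m" by (intro divide_right_mono) (auto simp: C\<^sub>1_def)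
    then have "measure (gauss_space m n) E \<ge> 1 - C\<^sub>1 / real m - exp (- 1 * real n)" using E(2) by simp
    moreover have "lambda_min_hess n (loss m (gauss_vec n \<omega>) (outer x x)) Z \<le> - 2"
      if "\<omega> \<in> E" "Z \<in> rank_one_manifold n" "frob_inner Z (outer x x) \<le> \<delta>\<^sub>0 * frob_norm Z * frob_norm (outer x x)"
        "riem_grad n (loss m (gauss_vec n \<omega>) (outer x x)) Z = 0\<^sub>m n n" for \<omega> Z
      by (rule landscape_good_sample[OF w(1,3,4,5) _ E(3)[OF that(1)] L(2) \<eta>_def \<epsilon>_def that(2) \<delta> that(3,4)])
        (simp add: gauss_vec_def)
    ultimately show ?thesis using E(1) by blast
  qed
  have C\<^sub>1: "C\<^sub>1 > 0" by (simp add: C\<^sub>1_def)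
  show ?thesis
  proof (rule exI[of _ C\<^sub>1], rule conjI, rule C\<^sub>1, rule exI[of _ 1], rule conjI, simp, intro allI impI,
      rule exI[of _ C], rule conjI, rule C, intro allI impI, rule exI[of _ "- 2"], rule conjI, simp, intro allI impI)
    fix \<delta>\<^sub>1 \<delta>\<^sub>0 :: real and n m :: nat and x :: "real Matrix.vec"
    assume \<delta>: "0 < \<delta>\<^sub>0 \<and> \<delta>\<^sub>0 < 1"
      and x: "x \<in> carrier_vec n \<and> x \<noteq> 0\<^sub>v n \<and> 1 \<le> m \<and> C * real n * ln (real n) \<le> real m"
    obtain E where E: "E \<in> sets (gauss_space m n)" "measure (gauss_space m n) E \<ge> 1 - C\<^sub>1 / real m - exp (- 1 * real n)"
      "\<And>\<omega> Z. \<omega> \<in> E \<Longrightarrow> Z \<in> rank_one_manifold n \<Longrightarrow> frob_inner Z (outer x x) \<le> \<delta>\<^sub>0 * frob_norm Z * frob_norm (outer x x) \<Longrightarrow>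
         riem_grad n (loss m (gauss_vec n \<omega>) (outer x x)) Z = 0\<^sub>m n n \<Longrightarrow>
         lambda_min_hess n (loss m (gauss_vec n \<omega>) (outer x x)) Z \<le> - 2"
      using main[of \<delta>\<^sub>0 x n m] \<delta> x by blast
    show "\<exists>E\<in>sets (gauss_space m n).
        measure (gauss_space m n) E \<ge> 1 - C\<^sub>1 / real m - exp (- 1 * real n) \<and>
        (\<forall>\<omega>\<in>E. let X = outer x x; f = loss m (gauss_vec n \<omega>) X in
          \<forall>Z\<in>rank_one_manifold n.
            frob_inner Z X \<le> \<delta>\<^sub>0 * frob_norm Z * frob_norm X \<and>
            1/3 - \<delta>\<^sub>0 \<le> frob_norm Z / frob_norm X \<and>
            frob_norm Z / frob_norm X \<le> 1/3 + \<delta>\<^sub>0 \<and>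
            riem_grad n f Z = 0\<^sub>m n n \<longrightarrow>
            lambda_min_hess n f Z \<le> - 2 \<and>
            (\<delta>\<^sub>0 < 1/6 \<and> \<delta>\<^sub>1 < 5/36 \<longrightarrow> lambda_min_hess n f Z < -1))"
      unfolding Let_def
    proof (intro bexI[OF _ E(1)] conjI E(2) ballI impI)
      fix \<omega> Z
      assume h: "\<omega> \<in> E" "Z \<in> rank_one_manifold n" "frob_inner Z (outer x x) \<le> \<delta>\<^sub>0 * frob_norm Z * frob_norm (outer x x) \<and>
            1/3 - \<delta>\<^sub>0 \<le> frob_norm Z / frob_norm (outer x x) \<and>
            frob_norm Z / frob_norm (outer x x) \<le> 1/3 + \<delta>\<^sub>0 \<and>
            riem_grad n (loss m (gauss_vec n \<omega>) (outer x x)) Z = 0\<^sub>m n n"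
      have le: "lambda_min_hess n (loss m (gauss_vec n \<omega>) (outer x x)) Z \<le> - 2" using E(3) h by blast
      then show "lambda_min_hess n (loss m (gauss_vec n \<omega>) (outer x x)) Z \<le> - 2" .
      show "lambda_min_hess n (loss m (gauss_vec n \<omega>) (outer x x)) Z < - 1" using le by simp
    qed
  qed
qed

end
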